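(* Let $0<\alpha\le 1$, $|1-\theta|<\frac{\alpha}{2}$ and $1<p<\infty$. For $f\in L^p(\mathbb{R}^n;C\ell_{0,n})$ put $$R(\widehat f):=\inf\left\{\sigma>0:\ \operatorname{supp}\widehat f\subseteq\overline{B(0,\sigma)}\right\}.$$ (i) Let $f\in L^p(\mathbb{R}^n;C\ell_{0,n})$ be such that $\operatorname{supp}\widehat f\subseteq\overline{B(0,R)}$ for some $0<R<\infty$. Then the limit $$\lim_{k\to\infty}\left\|(D_\theta^\alpha)^kf\right\|_p^{\frac{1}{\alpha k}}$$ exists, is finite, and coincides with $R(\widehat f)$. (ii) Conversely, if $u\in\mathcal{B}_R^p(D_\theta^\alpha)$ for some $R>0$ is such that $u(\cdot,0)=f$, and the limit $\lim_{k\to\infty}\left\|(D_\theta^\alpha)^kf\right\|_p^{\frac{1}{\alpha k}}$ exists and is finite, then $\operatorname{supp}\widehat f\subseteq\overline{B\left(0,R(\widehat f)\right)}$.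
   Context: $C\ell_{0,n}$ is the Clifford algebra generated by $e_1,\dots,e_n$ with $e_je_k+e_ke_j=-2\delta_{jk}$, with complex coefficients allowed ($i$ is the imaginary unit, commuting with all $e_j$). Its elements are $\lambda=\sum_A\lambda_Ae_A$, $A\subseteq\{1,\dots,n\}$, and vectors $\xi\in\mathbb{R}^n$ are identified with $\xi=\sum_j\xi_je_j$, so $\xi^2=-|\xi|^2$. The norm is $|\lambda|_0=2^{n/2}\left(\sum_A|\lambda_A|^2\right)^{1/2}$. $L^p(\mathbb{R}^n;C\ell_{0,n})$ has norm $\|f\|_p=\left(\int_{\mathbb{R}^n}|f(x)|_0^p\,dx\right)^{1/p}$. Fourier transform: $\widehat f(\xi)=(\mathcal{F}f)(\xi)=\int_{\mathbb{R}^n}f(x)e^{-i\langle x,\xi\rangle}dx$, extended to tempered distributions. All Fourier multipliers act by left multiplication by the symbol and are extended from Schwartz functions to $L^p$ functions in the distributional sense: - Riesz-Hilbert transform: $\mathcal{H}=\mathcal{F}^{-1}\frac{-i\xi}{|\xi|}\mathcal{F}$ (bounded on $L^p$, $1<p<\infty$). - Dirac operator of Riesz-Feller type: $\mathcal{F}(D_\theta^\alpha f)(\xi)=|\xi|^\alpha h_\theta(\xi)\widehat f(\xi)$ with $h_\theta(\xi)=e^{-\frac{i\pi\theta}{2}}\left(\cos\frac{\pi\theta}{2}+\frac{\xi}{|\xi|}\sin\frac{\pi\theta}{2}\right)$, $\xi\ne0$. Kernels: for $\Re(z)>0$, $K_{\alpha,n}(x,z)=\frac{1}{(2\pi)^n}\int_{\mathbb{R}^n}e^{-z|\xi|^\alpha}e^{i\langle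 x,\xi\rangle}d\xi$ and $E^\pm_{\alpha,n}(\cdot,z)=\frac12\left(K_{\alpha,n}(\cdot,z)\pm\mathcal{H}K_{\alpha,n}(\cdot,z)\right)$. Convolution: $(E*f)(x)=\int_{\mathbb{R}^n}E(x-y)f(y)\,dy$. $B(0,R)$ is the open Euclidean ball in $\mathbb{R}^n$. Generalized Bernstein space: $\mathcal{B}_R^p(D_\theta^\alpha)$ consists of all Clifford-valued functions $u$ on $\mathbb{R}^{n}\times\mathbb{R}$ such that, with $f=u(\cdot,0)$: (1) $u$ is the solution of the Cauchy problem $\partial_{x_0}u+D_\theta^\alpha u=0$ for $x_0\neq0$, $u(\cdot,0)=f$, $\lim_{|x_0|\to\infty}u(x,x_0)=0$, given by $u(\cdot,x_0)=E^{+}_{\alpha,n}(\cdot,x_0)*f$ for $x_0>0$ and $u(\cdot,x_0)=E^{-}_{\alpha,n}(\cdot,x_0e^{-i\pi\theta})*f$ for $x_0<0$; (2) $f\in L^p(\mathbb{R}^n;C\ell_{0,n})$; (3) $\sup_{x_0\in\mathbb{R}}e^{-|x_0|R^\alpha}\|u(\cdot,x_0)\|_p<\infty$. *)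

theory Defs
  imports "HOL-Analysis.Analysis"
begin

section \<open>The complexified Clifford algebra with negative definite signature\<close>

text \<open>
  An element is the family of its complex coordinates with respect to the basis \<open>e_A\<close>, where
  \<open>A\<close> ranges over the subsets of the index type \<open>'n\<close>, and \<open>e_A\<close> is the product of the
  generators \<open>e_j\<close>, \<open>j \<in> A\<close>, taken in increasing order. The componentwise product
  \<open>*\<close> that the library puts on this vector type is not the Clifford product.
\<close>

type_synonym 'n rspace = "(real, 'n) vec"

type_synonym 'n cliff = "(complex, 'n set) vec"

definition blade :: "'n::{finite,linorder} set \<Rightarrow> 'n cliff"
  where "blade A = axis A 1"

text \<open>
  Bringing \<open>e_A e_B\<close> into increasing order costs one sign for every inversion, and one for every
  common index because \<open>e_j e_j = - 1\<close>.
\<close>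

definition blade_sign :: "'n::{finite,linorder} set \<Rightarrow> 'n set \<Rightarrow> complex"
  where "blade_sign A B = (- 1) ^ (card {(a, b). a \<in> A \<and> b \<in> B \<and> b < a} + card (A \<inter> B))"

definition cliff_mult :: "'n::{finite,linorder} cliff \<Rightarrow> 'n cliff \<Rightarrow> 'n cliff"  (infixl \<open>\<odot>\<close> 70)
  where "x \<odot> y = (\<chi> C. \<Sum>(A, B) | sym_diff A B = C. blade_sign A B * x $ A * y $ B)"

definition cliff_of_complex :: "complex \<Rightarrow> 'n::{finite,linorder} cliff"
  where "cliff_of_complex c = c *s blade {}"

definition cliff_of_vec :: "'n rspace \<Rightarrow> 'n::{finite,linorder} cliff"
  where "cliff_of_vec \<xi> = (\<Sum>j\<in>UNIV. complex_of_real (\<xi> $ j) *s blade {j})"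

definition cliff_norm :: "'n::{finite,linorder} cliff \<Rightarrow> real"
  where "cliff_norm x = 2 powr (real CARD('n) / 2) * sqrt (\<Sum>A\<in>UNIV. (cmod (x $ A))\<^sup>2)"

lemma blade_mult_blade: "blade A \<odot> blade B = blade_sign A B *s blade (sym_diff A B)"
proof -
  have "(\<Sum>(A', B') | sym_diff A' B' = C. blade_sign A' B' * blade A $ A' * blade B $ B')
      = (blade_sign A B *s blade (sym_diff A B)) $ C" for C
  proof -
    have "(\<Sum>(A', B') | sym_diff A' B' = C. blade_sign A' B' * blade A $ A' * blade B $ B')
        = (\<Sum>q\<in>{(A', B'). sym_diff A' B' = C}.
             if q = (A, B) then blade_sign A B else 0)"
      by (rule sum.cong) (auto simp: blade_def axis_def split: if_splits)
    also have "\<dots> = (if sym_diff A B = C then blade_sign A B else 0)"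
      by (simp add: sum.delta)
    finally show ?thesis
      by (auto simp: blade_def axis_def split: if_splits)
  qed
  then show ?thesis
    by (simp add: cliff_mult_def vec_eq_iff)
qed

lemma generators_anticommute:
  fixes j k :: "'n::{finite,linorder}"
  shows "blade {j} \<odot> blade {k} + blade {k} \<odot> blade {j} = cliff_of_complex (if j = k then - 2 else 0)"
proof -
  have "{(a, b). a \<in> {j} \<and> b \<in> {k} \<and> b < a} = (if k < j then {(j, k)} else {})" for j k :: 'n
    by auto
  then have s: "blade_sign {j} {k} = (if j = k \<or> k < j then - 1 else 1)" for j k :: 'n
    by (auto simp: blade_sign_def)
  show ?thesis
    by (cases j k rule: linorder_cases)
       (auto simp: blade_mult_blade s cliff_of_complex_def insert_commute vec_eq_iff insert_Diff_if)
qed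

lemma cliff_of_complex_mult: "cliff_of_complex c \<odot> y = c *s y"
proof -
  have "(\<Sum>(A, B) | sym_diff A B = C. blade_sign A B * (c *s blade {}) $ A * y $ B) = c * y $ C" for C
  proof -
    have "(\<Sum>(A, B) | sym_diff A B = C. blade_sign A B * (c *s blade {}) $ A * y $ B)
        = (\<Sum>q\<in>{(A, B). sym_diff A B = C}. if q = ({}, C) then c * y $ C else 0)"
      by (rule sum.cong) (auto simp: blade_def axis_def blade_sign_def split: if_splits)
    also have "\<dots> = c * y $ C"
      by (simp add: sum.delta)
    finally show ?thesis .
  qed
  then show ?thesis
    by (simp add: cliff_mult_def cliff_of_complex_def vec_eq_iff)
qed


section \<open>Lebesgue spaces and test functions\<close>

definition Lp_space :: "real \<Rightarrow> ('n rspace \<Rightarrow> 'n::{finite,linorder} cliff) set"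
  where "Lp_space p = {f. f \<in> borel_measurable lebesgue \<and>
           integrable lebesgue (\<lambda>x. cliff_norm (f x) powr p)}"

definition Lp_norm :: "real \<Rightarrow> ('n rspace \<Rightarrow> 'n::{finite,linorder} cliff) \<Rightarrow> real"
  where "Lp_norm p f = (LINT x|lebesgue. cliff_norm (f x) powr p) powr (1 / p)"

primrec partials :: "'n list \<Rightarrow> ('n rspace \<Rightarrow> complex) \<Rightarrow> 'n::finite rspace \<Rightarrow> complex"
  where
    "partials [] \<phi> = \<phi>"
  | "partials (j # js) \<phi> = (\<lambda>x. frechet_derivative (partials js \<phi>) (at x) (axis j 1))"

definition smooth :: "('n::finite rspace \<Rightarrow> complex) \<Rightarrow> bool"
  where "smooth \<phi> \<longleftrightarrow> (\<forall>js x. partials js \<phi> differentiable (at x))"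

definition schwartz :: "('n::finite rspace \<Rightarrow> complex) \<Rightarrow> bool"
  where "schwartz \<phi> \<longleftrightarrow> smooth \<phi> \<and>
           (\<forall>js m. bounded (range (\<lambda>x. (1 + norm x) ^ m *\<^sub>R partials js \<phi> x)))"


section \<open>Fourier transform and Fourier multipliers\<close>

definition fourier :: "('n rspace \<Rightarrow> 'n::{finite,linorder} cliff) \<Rightarrow> 'n rspace \<Rightarrow> 'n cliff"
  where "fourier f \<xi> = (LINT x|lebesgue. exp (- \<i> * complex_of_real (x \<bullet> \<xi>)) *s f x)"

definition inv_fourier :: "('n rspace \<Rightarrow> 'n::{finite,linorder} cliff) \<Rightarrow> 'n rspace \<Rightarrow> 'n cliff"
  where "inv_fourier g x = complex_of_real (1 / (2 * pi) ^ CARD('n)) *s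
           (LINT \<xi>|lebesgue. exp (\<i> * complex_of_real (x \<bullet> \<xi>)) *s g \<xi>)"

text \<open>
  Clifford-valued distributions are represented by functionals \<open>T\<close> that are defined on all
  functions with values in the algebra; only the values at scalar test functions identify the
  distribution. The wider domain lets an operation on distributions be defined by its transpose
  even if the transpose does not preserve the Schwartz space: for \<open>\<phi>\<close> in that space and the symbol
  \<open>m\<close> of the Riesz-Feller Dirac operator, \<open>fourier (\<lambda>\<xi>. inv_fourier \<phi> \<xi> \<odot> m \<xi>)\<close> is in general
  not rapidly decreasing, but it lies in every \<open>L\<^sup>q\<close> and can be paired with an \<open>L\<^sup>p\<close> function.

  Because the pairing is the integral of \<open>\<phi> x \<odot> f x\<close>, left multiplication of a distribution by
  \<open>m\<close> transposes to right multiplication of the test function by \<open>m\<close>.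
\<close>

type_synonym 'n cliff_dist = "('n rspace \<Rightarrow> 'n cliff) \<Rightarrow> 'n cliff"

definition dist_of_fun :: "('n rspace \<Rightarrow> 'n cliff) \<Rightarrow> 'n::{finite,linorder} cliff_dist"
  where "dist_of_fun f = (\<lambda>\<phi>. LINT x|lebesgue. \<phi> x \<odot> f x)"

definition dist_fourier :: "'n::{finite,linorder} cliff_dist \<Rightarrow> 'n cliff_dist"
  where "dist_fourier T = (\<lambda>\<phi>. T (fourier \<phi>))"

definition dist_inv_fourier :: "'n::{finite,linorder} cliff_dist \<Rightarrow> 'n cliff_dist"
  where "dist_inv_fourier T = (\<lambda>\<phi>. T (inv_fourier \<phi>))"

definition dist_left_mult :: "('n rspace \<Rightarrow> 'n cliff) \<Rightarrow> 'n::{finite,linorder} cliff_dist \<Rightarrow> 'n cliff_dist"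
  where "dist_left_mult m T = (\<lambda>\<phi>. T (\<lambda>\<xi>. \<phi> \<xi> \<odot> m \<xi>))"

definition dist_multiplier :: "('n rspace \<Rightarrow> 'n cliff) \<Rightarrow> 'n::{finite,linorder} cliff_dist \<Rightarrow> 'n cliff_dist"
  where "dist_multiplier m T = dist_inv_fourier (dist_left_mult m (dist_fourier T))"

definition dist_apply :: "'n::{finite,linorder} cliff_dist \<Rightarrow> ('n rspace \<Rightarrow> complex) \<Rightarrow> 'n cliff"
  where "dist_apply T \<phi> = T (\<lambda>x. cliff_of_complex (\<phi> x))"

definition dist_eq :: "'n::{finite,linorder} cliff_dist \<Rightarrow> 'n cliff_dist \<Rightarrow> bool"
  where "dist_eq S T \<longleftrightarrow> (\<forall>\<phi>. schwartz \<phi> \<longrightarrow> dist_apply S \<phi> = dist_apply T \<phi>)"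

definition dist_support :: "'n::{finite,linorder} cliff_dist \<Rightarrow> ('n rspace) set"
  where "dist_support T = - \<Union>{U. open U \<and>
           (\<forall>\<phi>. smooth \<phi> \<and> compact (closure {\<xi>. \<phi> \<xi> \<noteq> 0}) \<and> closure {\<xi>. \<phi> \<xi> \<noteq> 0} \<subseteq> U
                 \<longrightarrow> dist_apply T \<phi> = 0)}"

text \<open>The infimum is over at most one value, and it is \<open>\<infinity>\<close> if the distribution is not in \<open>L\<^sup>p\<close>.\<close>

definition dist_Lp_norm :: "real \<Rightarrow> 'n::{finite,linorder} cliff_dist \<Rightarrow> ereal"
  where "dist_Lp_norm p T = (INF g\<in>{g \<in> Lp_space p. dist_eq T (dist_of_fun g)}. ereal (Lp_norm p g))"

definition ereal_powr :: "ereal \<Rightarrow> real \<Rightarrow> ereal"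
  where "ereal_powr x a = (if x = \<infinity> then \<infinity> else ereal (real_of_ereal x powr a))"

text \<open>The spectral radius is \<open>\<infinity>\<close> if the Fourier transform is not compactly supported.\<close>

definition spectral_radius :: "('n rspace \<Rightarrow> 'n::{finite,linorder} cliff) \<Rightarrow> ereal"
  where "spectral_radius f =
           (INF \<sigma>\<in>{\<sigma>::real. 0 < \<sigma> \<and> dist_support (dist_fourier (dist_of_fun f)) \<subseteq> closure (ball 0 \<sigma>)}.
              ereal \<sigma>)"


section \<open>Dirac operator of Riesz-Feller type\<close>

text \<open>Division by \<open>norm \<xi>\<close> yields \<open>0\<close> at the origin, so the symbols below are total.\<close>

definition feller_factor :: "real \<Rightarrow> 'n rspace \<Rightarrow> 'n::{finite,linorder} cliff"
  where "feller_factor \<theta> \<xi> = exp (- \<i> * complex_of_real (pi * \<theta> / 2)) *s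
           (cliff_of_complex (complex_of_real (cos (pi * \<theta> / 2)))
            + complex_of_real (sin (pi * \<theta> / 2) / norm \<xi>) *s cliff_of_vec \<xi>)"

definition feller_dirac :: "real \<Rightarrow> real \<Rightarrow> 'n::{finite,linorder} cliff_dist \<Rightarrow> 'n cliff_dist"
  where "feller_dirac \<alpha> \<theta> =
           dist_multiplier (\<lambda>\<xi>. complex_of_real (norm \<xi> powr \<alpha>) *s feller_factor \<theta> \<xi>)"

definition dirac_power_root :: "real \<Rightarrow> real \<Rightarrow> real \<Rightarrow> ('n rspace \<Rightarrow> 'n::{finite,linorder} cliff) \<Rightarrow> nat \<Rightarrow> ereal"
  where "dirac_power_root \<alpha> \<theta> p f k =
           ereal_powr (dist_Lp_norm p ((feller_dirac \<alpha> \<theta> ^^ k) (dist_of_fun f))) (1 / (\<alpha> * real k))"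


section \<open>Kernels and the generalized Bernstein space\<close>

text \<open>
  The Riesz-Hilbert transform is only applied to the kernels \<open>K\<close> below, which are integrable and
  have an integrable Fourier transform, so that the integrals can be taken literally.
\<close>

definition riesz_hilbert :: "('n rspace \<Rightarrow> 'n::{finite,linorder} cliff) \<Rightarrow> 'n rspace \<Rightarrow> 'n cliff"
  where "riesz_hilbert f =
           inv_fourier (\<lambda>\<xi>. ((- \<i> / complex_of_real (norm \<xi>)) *s cliff_of_vec \<xi>) \<odot> fourier f \<xi>)"

definition K_kernel :: "real \<Rightarrow> complex \<Rightarrow> 'n::finite rspace \<Rightarrow> complex"
  where "K_kernel \<alpha> z x = complex_of_real (1 / (2 * pi) ^ CARD('n)) *
           (LINT \<xi>|lebesgue. exp (- z * complex_of_real (norm \<xi> powr \<alpha>)) * exp (\<i> * complex_of_real (x \<bullet> \<xi>)))"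

definition E_plus :: "real \<Rightarrow> complex \<Rightarrow> 'n rspace \<Rightarrow> 'n::{finite,linorder} cliff"
  where "E_plus \<alpha> z x = (1 / 2) *s
           (cliff_of_complex (K_kernel \<alpha> z x) + riesz_hilbert (\<lambda>y. cliff_of_complex (K_kernel \<alpha> z y)) x)"

definition E_minus :: "real \<Rightarrow> complex \<Rightarrow> 'n rspace \<Rightarrow> 'n::{finite,linorder} cliff"
  where "E_minus \<alpha> z x = (1 / 2) *s
           (cliff_of_complex (K_kernel \<alpha> z x) - riesz_hilbert (\<lambda>y. cliff_of_complex (K_kernel \<alpha> z y)) x)"

definition convolution ::
    "('n rspace \<Rightarrow> 'n cliff) \<Rightarrow> ('n rspace \<Rightarrow> 'n cliff) \<Rightarrow> 'n rspace \<Rightarrow> 'n::{finite,linorder} cliff"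
  where "convolution E f x = (LINT y|lebesgue. E (x - y) \<odot> f y)"

text \<open>
  The equation holds with a pointwise derivative in \<open>t\<close> and the Dirac operator in \<open>x\<close> taken in the
  sense of distributions. It is imposed for \<open>t \<noteq> 0\<close> only: in general \<open>u x\<close> jumps at \<open>t = 0\<close>.
\<close>

definition solves_cauchy_problem :: "real \<Rightarrow> real \<Rightarrow> ('n rspace \<Rightarrow> 'n cliff) \<Rightarrow>
    ('n rspace \<Rightarrow> real \<Rightarrow> 'n::{finite,linorder} cliff) \<Rightarrow> bool"
  where "solves_cauchy_problem \<alpha> \<theta> f u \<longleftrightarrow>
    (\<forall>t. t \<noteq> 0 \<longrightarrow> (\<exists>v. (\<forall>x. (u x has_vector_derivative v x) (at t)) \<and>
        dist_eq (\<lambda>\<phi>. dist_of_fun v \<phi> + feller_dirac \<alpha> \<theta> (dist_of_fun (\<lambda>x. u x t)) \<phi>) (\<lambda>\<phi>. 0))) \<and>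
    (\<forall>x. u x 0 = f x) \<and>
    (\<forall>x. (u x \<longlongrightarrow> 0) at_infinity)"

definition bernstein_space ::
    "real \<Rightarrow> real \<Rightarrow> real \<Rightarrow> real \<Rightarrow> ('n rspace \<Rightarrow> real \<Rightarrow> 'n::{finite,linorder} cliff) set"
  where "bernstein_space \<alpha> \<theta> p R = {u. let f = (\<lambda>x. u x 0) in
    solves_cauchy_problem \<alpha> \<theta> f u \<and>
    (\<forall>t>0. \<forall>x. u x t = convolution (E_plus \<alpha> (complex_of_real t)) f x) \<and>
    (\<forall>t<0. \<forall>x. u x t =
       convolution (E_minus \<alpha> (complex_of_real t * exp (- \<i> * complex_of_real (pi * \<theta>)))) f x) \<and>
    f \<in> Lp_space p \<and>
    (\<forall>t. (\<lambda>x. u x t) \<in> Lp_space p) \<and>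
    bdd_above (range (\<lambda>t. exp (- \<bar>t\<bar> * R powr \<alpha>) * Lp_norm p (\<lambda>x. u x t)))}"

end

theory Submission
  imports Defs "HOL-Probability.Characteristic_Functions" "HOL-Probability.Sinc_Integral"
begin

text \<open>
  Write \<open>m\<close> for the symbol of the Dirac operator. By De Moivre's formula \<open>m\<^sup>k\<close> is \<open>|\<xi>|\<^sup>\<alpha>\<^sup>k\<close> times a bounded
  combination of \<open>1\<close> and \<open>\<omega> = \<xi>/|\<xi>|\<close>, so powers reduce to homogeneous scalar symbols.

  Upper bound: if the spectrum of \<open>f\<close> lies in a ball of radius less than \<open>\<sigma>\<close>, then the \<open>k\<close>-th power acts on
  \<open>f\<close> as convolution with the inverse Fourier transform of \<open>\<zeta> m\<^sup>k\<close>, where \<open>\<zeta>\<close> is a cutoff supported in the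
  ball of radius \<open>\<sigma>\<close>. A dyadic decomposition towards the origin, where \<open>m\<^sup>k\<close> is not smooth, bounds the
  \<open>L\<^sup>1\<close> norm of this kernel by a polynomial in \<open>k\<close> times \<open>\<sigma>\<^sup>\<alpha>\<^sup>k\<close>, and Young's inequality applies.

  Lower bound: if a test function \<open>\<psi>\<close> supported in \<open>|\<xi>| \<ge> \<epsilon>\<close> detects the Fourier transform of \<open>f\<close>, then
  the pairing with \<open>\<psi>\<close> equals the pairing of the \<open>k\<close>-th power with \<open>\<psi> m\<^sup>-\<^sup>k\<close>, whose Fourier transform
  is at most a polynomial in \<open>k\<close> times \<open>\<epsilon>\<^sup>-\<^sup>\<alpha>\<^sup>k\<close> in the dual space. Taking roots removes the polynomials.

  In part (ii) finiteness of the limit bounds the spectral radius by the lower bound. The spectral radius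
  \<open>0\<close> needs an extra argument, as the closure of an empty ball is empty: no nonzero function in \<open>L\<^sup>p\<close> has
  its spectrum in the origin.
\<close>

section \<open>Calculus of smooth functions\<close>

text \<open>The symbol is not smooth at the origin, so multiplying by it leaves the Schwartz space
  after one application. The proof therefore works in the class \<open>wiener\<close> of continuous
  bounded integrable functions with integrable Fourier transform. Fourier inversion holds there
  pointwise, which cancels the transforms between consecutive applications of the operator, and the
  transforms are bounded and integrable, so they pair with L^p functions. One Jensen inequality with
  a weight yields both the pairing estimate and Young's inequality.

  The polynomial in \<open>k\<close> has degree 2n: integrability of a Fourier transform is bought
  with 2n derivatives, because (1 + |x|)^(-2n) is dominated by the product of the 1/(1 + x_j^2), and
  each derivative of |x|^s costs a factor of order s = k \<alpha>.

  Equality of distributions tests scalar functions only, whereas \<psi> m^(-k) is Clifford valued.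
  It is split into coordinates with the blades on the left, where they can be pulled out of the
  pairing because \<open>f\<close> stands on its right.\<close>

definition pd :: "'n::finite \<Rightarrow> ('n rspace \<Rightarrow> complex) \<Rightarrow> 'n rspace \<Rightarrow> complex"
  where "pd j \<phi> = (\<lambda>x. frechet_derivative \<phi> (at x) (axis j 1))"

lemma partials_Cons_pd: "partials (j # js) \<phi> = pd j (partials js \<phi>)"
  by (simp add: pd_def)

text \<open>Peeling off the innermost derivative instead of the outermost lets inductions generalise
  over the function: a class closed under \<open>pd\<close> is closed under all
  \<open>partials\<close>.\<close>

lemma partials_snoc_pd: "partials (js @ [j]) \<phi> = partials js (pd j \<phi>)"
  by (induction js) (simp_all add: pd_def)

lemma pd_eqI: "(\<phi> has_derivative \<phi>') (at x) \<Longrightarrow> pd j \<phi> x = \<phi>' (axis j 1)"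
  unfolding pd_def using frechet_derivative_at by metis

lemma has_derivative_frechet:
  "\<phi> differentiable at x \<Longrightarrow> (\<phi> has_derivative frechet_derivative \<phi> (at x)) (at x)"
  by (simp add: frechet_derivative_works)

lemma pd_add:
  assumes "\<phi> differentiable at x" "\<psi> differentiable at x"
  shows "pd j (\<lambda>x. \<phi> x + \<psi> x) x = pd j \<phi> x + pd j \<psi> x"
  by (subst pd_eqI[OF has_derivative_add[OF assms[THEN has_derivative_frechet]]]) (simp add: pd_def)

lemma pd_mult:
  assumes "\<phi> differentiable at x" "\<psi> differentiable at x"
  shows "pd j (\<lambda>x. \<phi> x * \<psi> x) x = \<phi> x * pd j \<psi> x + pd j \<phi> x * \<psi> x"
  by (subst pd_eqI[OF has_derivative_mult[OF assms[THEN has_derivative_frechet]]]) (simp add: pd_def)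

lemma pd_const [simp]: "pd j (\<lambda>x. c) = (\<lambda>x. 0)"
  by (rule ext) (simp add: pd_eqI[OF has_derivative_const])

text \<open>\<open>frechet_derivative\<close> is a choice from the set of derivatives at
  \<open>x\<close>. Functions that agree near \<open>x\<close> have the same such set, be it empty
  or not, so the choices coincide.\<close>

lemma pd_cong_open:
  assumes "open U" "x \<in> U" "\<And>y. y \<in> U \<Longrightarrow> \<phi> y = \<psi> y"
  shows "pd j \<phi> x = pd j \<psi> x"
proof -
  have "(\<phi> has_derivative D) (at x) \<longleftrightarrow> (\<psi> has_derivative D) (at x)" for D
    using has_derivative_transform_within_open[of \<phi> D x UNIV U \<psi>]
      has_derivative_transform_within_open[of \<psi> D x UNIV U \<phi>] assms by auto
  then show ?thesis
    by (simp add: pd_def frechet_derivative_def)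
qed

lemma partials_eq_0_open:
  assumes "open U" "\<And>y. y \<in> U \<Longrightarrow> \<phi> y = 0" "x \<in> U"
  shows "partials js \<phi> x = 0"
  using assms(3)
proof (induction js arbitrary: x)
  case Nil
  then show ?case using assms by simp
next
  case (Cons j js)
  have "pd j (partials js \<phi>) x = pd j (\<lambda>x. 0) x"
    by (rule pd_cong_open[OF assms(1) Cons.prems]) (use Cons.IH in auto)
  then show ?case by (simp add: partials_Cons_pd del: partials.simps)
qed

text \<open>Smoothness is proved by exhibiting a family of differentiable functions whose partial derivatives are
  finite sums of members; this replaces the Leibniz and chain rules of higher order.\<close>

inductive_set fsums :: "('n rspace \<Rightarrow> complex) set \<Rightarrow> ('n::finite rspace \<Rightarrow> complex) set" for S
  where
    fsums_base: "s \<in> S \<Longrightarrow> s \<in> fsums S"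
  | fsums_add: "u \<in> fsums S \<Longrightarrow> v \<in> fsums S \<Longrightarrow> (\<lambda>x. u x + v x) \<in> fsums S"

lemma fsums_partials:
  assumes diff: "\<And>s x. s \<in> S \<Longrightarrow> s differentiable at x"
    and pd: "\<And>s j. s \<in> S \<Longrightarrow> pd j s \<in> fsums S"
    and u: "u \<in> fsums S"
  shows "partials js u \<in> fsums S" and "smooth u"
proof -
  have d: "v differentiable at x" if "v \<in> fsums S" for v x
    using that by induction (auto intro: diff)
  have p: "pd j v \<in> fsums S" if "v \<in> fsums S" for v j
    using that
  proof induction
    case (fsums_add u v)
    then have "pd j (\<lambda>x. u x + v x) = (\<lambda>x. pd j u x + pd j v x)"
      by (auto intro!: pd_add d)
    then show ?case using fsums_add by (simp add: fsums.fsums_add)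
  qed (rule pd)
  have *: "partials js u \<in> fsums S" for js
    by (induction js) (use u p in \<open>auto simp: partials_Cons_pd simp del: partials.simps(2)\<close>)
  then show "partials js u \<in> fsums S" .
  show "smooth u"
    unfolding smooth_def using * d by blast
qed

lemma smooth_differentiable: "smooth \<phi> \<Longrightarrow> \<phi> differentiable at x"
  unfolding smooth_def by (metis partials.simps(1))

lemma smooth_pd: "smooth \<phi> \<Longrightarrow> smooth (pd j \<phi>)"
  unfolding smooth_def by (metis partials_snoc_pd)

lemma smooth_partials: "smooth \<phi> \<Longrightarrow> smooth (partials js \<phi>)"
  by (induction js) (auto simp: partials_Cons_pd smooth_pd simp del: partials.simps(2))

lemma smooth_continuous: "smooth \<phi> \<Longrightarrow> continuous_on A \<phi>"
  by (meson continuous_at_imp_continuous_on differentiable_imp_continuous_within smooth_differentiable)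

lemma smooth_const [simp]: "smooth (\<lambda>x. c)"
proof -
  have "\<exists>c'. partials js (\<lambda>x. c) = (\<lambda>x. c')" for js :: "'a list"
    by (induction js) (auto simp: partials_Cons_pd simp del: partials.simps(2))
  then show ?thesis unfolding smooth_def by (metis differentiable_const)
qed

lemma smooth_mult:
  assumes "smooth \<phi>" "smooth \<psi>"
  shows "smooth (\<lambda>x. \<phi> x * \<psi> x)"
proof -
  let ?S = "{(\<lambda>x. a x * b x) | a b. smooth a \<and> smooth b}"
  show ?thesis
  proof (rule fsums_partials(2)[where S = ?S])
    fix s j assume "s \<in> ?S"
    then obtain a b where s: "s = (\<lambda>x. a x * b x)" "smooth a" "smooth b" by blast
    have "pd j s = (\<lambda>x. a x * pd j b x + pd j a x * b x)"
      unfolding s(1) by (intro ext pd_mult smooth_differentiable s)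
    also have "\<dots> \<in> fsums ?S"
      by (intro fsums_add fsums_base) (use s smooth_pd in blast)+
    finally show "pd j s \<in> fsums ?S" .
  next
    fix s x assume "s \<in> ?S"
    then show "s differentiable at x"
      by (elim CollectE exE conjE) (simp add: smooth_differentiable)
  qed (use assms in \<open>auto intro: fsums_base\<close>)
qed

lemma smooth_add:
  assumes "smooth \<phi>" "smooth \<psi>"
  shows "smooth (\<lambda>x. \<phi> x + \<psi> x)"
  by (rule fsums_partials(2)[where S = "Collect smooth"])
     (use assms smooth_pd smooth_differentiable in \<open>auto intro: fsums.intros\<close>)

lemma smooth_cmult: "smooth \<phi> \<Longrightarrow> smooth (\<lambda>x. c * \<phi> x)"
  by (rule smooth_mult[OF smooth_const])

lemma smooth_minus: "smooth \<phi> \<Longrightarrow> smooth (\<lambda>x. - \<phi> x)"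
  using smooth_cmult[of \<phi> "-1"] by simp

lemma smooth_diff: "smooth \<phi> \<Longrightarrow> smooth \<psi> \<Longrightarrow> smooth (\<lambda>x. \<phi> x - \<psi> x)"
  using smooth_add[OF _ smooth_minus] by fastforce

lemma partials_add:
  assumes "smooth \<phi>" "smooth \<psi>"
  shows "partials js (\<lambda>x. \<phi> x + \<psi> x) = (\<lambda>x. partials js \<phi> x + partials js \<psi> x)"
proof (induction js)
  case (Cons j js)
  show ?case unfolding partials_Cons_pd Cons
    by (intro ext pd_add smooth_differentiable smooth_partials assms)
qed simp

lemma pd_cmult: "smooth \<phi> \<Longrightarrow> pd j (\<lambda>x. c * \<phi> x) = (\<lambda>x. c * pd j \<phi> x)"
  by (rule ext, subst pd_mult) (auto intro: smooth_differentiable)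

lemma partials_cmult:
  assumes "smooth \<phi>"
  shows "partials js (\<lambda>x. c * \<phi> x) = (\<lambda>x. c * partials js \<phi> x)"
proof (induction js)
  case (Cons j js)
  show ?case unfolding partials_Cons_pd Cons
    by (rule pd_cmult[OF smooth_partials[OF assms]])
qed simp

lemma has_derivative_coord:
  "((\<lambda>x::'n::finite rspace. complex_of_real (x $ k)) has_derivative (\<lambda>h. complex_of_real (h $ k))) (at x)"
  by (intro bounded_linear.has_derivative[OF bounded_linear_of_real]
       bounded_linear.has_derivative[OF bounded_linear_vec_nth] has_derivative_ident)

lemma pd_coord:
  "pd j (\<lambda>x::'n::finite rspace. complex_of_real (x $ k)) = (\<lambda>x. if j = k then 1 else 0)"
  by (rule ext, subst pd_eqI[OF has_derivative_coord]) (auto simp: axis_def)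

lemma smooth_coord [simp]: "smooth (\<lambda>x::'n::finite rspace. complex_of_real (x $ k))"
proof (rule fsums_partials(2)[where S = "insert (\<lambda>x. complex_of_real (x $ k)) (range (\<lambda>c x. c))"])
  fix s and x :: "'n rspace"
  assume "s \<in> insert (\<lambda>x. complex_of_real (x $ k)) (range (\<lambda>c x. c))"
  then show "s differentiable at x"
    using has_derivative_coord[of k x] has_derivative_const[of _ "at x"] unfolding differentiable_def by blast
next
  fix s and j :: 'n
  assume "s \<in> insert (\<lambda>x::'n rspace. complex_of_real (x $ k)) (range (\<lambda>c x. c))"
  then show "pd j s \<in> fsums (insert (\<lambda>x. complex_of_real (x $ k)) (range (\<lambda>c x. c)))"
    by (auto simp: pd_coord intro!: fsums_base)
qed (auto intro: fsums_base)

text \<open>The products of a smooth function and a power of 1/\<phi> are closed under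
  differentiation up to sums: a derivative either hits the smooth factor or raises the exponent by
  one and puts the derivative of \<phi> in front.\<close>

lemma smooth_inverse:
  assumes "smooth \<phi>" and nz: "\<And>x. \<phi> x \<noteq> 0"
  shows "smooth (\<lambda>x. inverse (\<phi> x))"
proof -
  let ?S = "{(\<lambda>x. b x * inverse (\<phi> x) ^ k) | b k. smooth b}"
  have d: "(\<lambda>x. inverse (\<phi> x) ^ k) differentiable at x" for k x
    by (intro differentiable_power derivative_intros differentiable_inverse smooth_differentiable assms)
  have i: "pd j (\<lambda>x. inverse (\<phi> x)) x = - (pd j \<phi> x * inverse (\<phi> x) ^ 2)" for j x
  proof -
    have "((\<lambda>x. inverse (\<phi> x)) has_derivative
        (\<lambda>h. - (inverse (\<phi> x) * frechet_derivative \<phi> (at x) h * inverse (\<phi> x)))) (at x)"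
      by (rule Deriv.has_derivative_inverse[OF nz has_derivative_frechet[OF smooth_differentiable[OF assms(1)]]])
    from pd_eqI[OF this] show ?thesis
      by (simp add: pd_def power2_eq_square)
  qed
  have p: "pd j (\<lambda>x. inverse (\<phi> x) ^ k) x = - (of_nat k * pd j \<phi> x) * inverse (\<phi> x) ^ Suc k" for j k x
  proof (induction k)
    case (Suc k)
    show ?case
      using pd_mult[of "\<lambda>x. inverse (\<phi> x)" x "\<lambda>x. inverse (\<phi> x) ^ k" j] d[of 1 x] d[of k x]
      by (simp add: Suc i power2_eq_square algebra_simps)
  qed simp
  have mem: "(\<lambda>x. b x * inverse (\<phi> x) ^ k) \<in> ?S" if "smooth b" for b k
    using that by blast
  have "(\<lambda>x. 1 * inverse (\<phi> x) ^ 1) \<in> fsums ?S"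
    by (intro fsums_base mem smooth_const)
  then have "smooth (\<lambda>x. 1 * inverse (\<phi> x) ^ 1)"
  proof (rule fsums_partials(2)[rotated -1])
    fix s x assume "s \<in> ?S"
    then show "s differentiable at x"
      using d by (elim CollectE exE conjE) (simp add: smooth_differentiable)
  next
    fix s j assume "s \<in> ?S"
    then obtain b k where s: "s = (\<lambda>x. b x * inverse (\<phi> x) ^ k)" "smooth b" by blast
    have "pd j s = (\<lambda>x. (b x * (- (of_nat k * pd j \<phi> x))) * inverse (\<phi> x) ^ Suc k
        + pd j b x * inverse (\<phi> x) ^ k)"
      unfolding s(1) by (rule ext, subst pd_mult)
        (use d s(2) in \<open>auto simp: p smooth_differentiable mult.assoc\<close>)
    also have "\<dots> \<in> fsums ?S"
      by (intro fsums_add fsums_base mem smooth_mult smooth_minus smooth_const smooth_pd s assms)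
    finally show "pd j s \<in> fsums ?S" .
  qed
  then show ?thesis by simp
qed

section \<open>Growth conditions\<close>

definition poly_bdd :: "('n::finite rspace \<Rightarrow> complex) \<Rightarrow> bool"
  where "poly_bdd \<phi> \<longleftrightarrow> (\<exists>m C. \<forall>x. norm (\<phi> x) \<le> C * (1 + norm x) ^ m)"

definition rapid :: "('n::finite rspace \<Rightarrow> complex) \<Rightarrow> bool"
  where "rapid \<phi> \<longleftrightarrow> (\<forall>m. \<exists>C. \<forall>x. (1 + norm x) ^ m * norm (\<phi> x) \<le> C)"

text \<open>The space O_M of multipliers of the Schwartz space.\<close>

definition slow :: "('n::finite rspace \<Rightarrow> complex) \<Rightarrow> bool"
  where "slow \<phi> \<longleftrightarrow> smooth \<phi> \<and> (\<forall>js. poly_bdd (partials js \<phi>))"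

lemma schwartz_iff: "schwartz \<phi> \<longleftrightarrow> smooth \<phi> \<and> (\<forall>js. rapid (partials js \<phi>))"
  unfolding schwartz_def rapid_def bounded_iff by (auto simp: abs_mult)

lemma poly_bdd_add:
  assumes "poly_bdd \<phi>" "poly_bdd \<psi>"
  shows "poly_bdd (\<lambda>x. \<phi> x + \<psi> x)"
proof -
  from assms obtain m C m' C' where
    1: "\<And>x. norm (\<phi> x) \<le> C * (1 + norm x) ^ m" and 2: "\<And>x. norm (\<psi> x) \<le> C' * (1 + norm x) ^ m'"
    unfolding poly_bdd_def by metis
  have "C \<ge> 0" "C' \<ge> 0"
    using order_trans[OF norm_ge_zero 1[of 0]] order_trans[OF norm_ge_zero 2[of 0]] by simp_all
  have "norm (\<phi> x + \<psi> x) \<le> (C + C') * (1 + norm x) ^ (m + m')" for x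
  proof -
    have "norm (\<phi> x + \<psi> x) \<le> C * (1 + norm x) ^ m + C' * (1 + norm x) ^ m'"
      using norm_triangle_ineq[of "\<phi> x" "\<psi> x"] 1[of x] 2[of x] by linarith
    also have "\<dots> \<le> C * (1 + norm x) ^ (m + m') + C' * (1 + norm x) ^ (m + m')"
      by (intro add_mono mult_left_mono power_increasing) (use \<open>C \<ge> 0\<close> \<open>C' \<ge> 0\<close> in auto)
    finally show ?thesis by (simp add: algebra_simps)
  qed
  then show ?thesis unfolding poly_bdd_def by blast
qed

lemma poly_bdd_mult:
  assumes "poly_bdd \<phi>" "poly_bdd \<psi>"
  shows "poly_bdd (\<lambda>x. \<phi> x * \<psi> x)"
proof -
  from assms obtain m C m' C' where
    1: "\<And>x. norm (\<phi> x) \<le> C * (1 + norm x) ^ m" and 2: "\<And>x. norm (\<psi> x) \<le> C' * (1 + norm x) ^ m'"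
    unfolding poly_bdd_def by metis
  have "norm (\<phi> x * \<psi> x) \<le> (C * C') * (1 + norm x) ^ (m + m')" for x
    using mult_mono'[OF 1[of x] 2[of x]] by (simp add: norm_mult power_add mult_ac)
  then show ?thesis unfolding poly_bdd_def by blast
qed

lemma rapid_add:
  assumes "rapid \<phi>" "rapid \<psi>"
  shows "rapid (\<lambda>x. \<phi> x + \<psi> x)"
  unfolding rapid_def
proof
  fix m
  from assms obtain C C' where
    1: "\<And>x. (1 + norm x) ^ m * norm (\<phi> x) \<le> C" and 2: "\<And>x. (1 + norm x) ^ m * norm (\<psi> x) \<le> C'"
    unfolding rapid_def by metis
  have "(1 + norm x) ^ m * norm (\<phi> x + \<psi> x) \<le> C + C'" for x
  proof -
    have "(1 + norm x) ^ m * norm (\<phi> x + \<psi> x) \<le> (1 + norm x) ^ m * (norm (\<phi> x) + norm (\<psi> x))"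
      by (intro mult_left_mono norm_triangle_ineq) auto
    then show ?thesis using 1[of x] 2[of x] by (simp add: algebra_simps)
  qed
  then show "\<exists>C. \<forall>x. (1 + norm x) ^ m * norm (\<phi> x + \<psi> x) \<le> C" by blast
qed

lemma rapid_mult:
  assumes "rapid \<phi>" "poly_bdd \<psi>"
  shows "rapid (\<lambda>x. \<phi> x * \<psi> x)"
  unfolding rapid_def
proof
  fix m
  from assms obtain k C' where 2: "\<And>x. norm (\<psi> x) \<le> C' * (1 + norm x) ^ k"
    unfolding poly_bdd_def by metis
  from assms obtain C where 1: "\<And>x. (1 + norm x) ^ (m + k) * norm (\<phi> x) \<le> C"
    unfolding rapid_def by metis
  have "C' \<ge> 0" using order_trans[OF norm_ge_zero 2[of 0]] by simp
  have "(1 + norm x) ^ m * norm (\<phi> x * \<psi> x) \<le> C * C'" for x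
  proof -
    have "(1 + norm x) ^ m * norm (\<phi> x * \<psi> x) \<le> (1 + norm x) ^ m * (norm (\<phi> x) * (C' * (1 + norm x) ^ k))"
      unfolding norm_mult by (intro mult_left_mono 2) auto
    also have "\<dots> = ((1 + norm x) ^ (m + k) * norm (\<phi> x)) * C'"
      by (simp add: power_add)
    also have "\<dots> \<le> C * C'"
      by (intro mult_right_mono 1 \<open>C' \<ge> 0\<close>)
    finally show ?thesis .
  qed
  then show "\<exists>C. \<forall>x. (1 + norm x) ^ m * norm (\<phi> x * \<psi> x) \<le> C" by blast
qed

lemma slow_smooth: "slow \<phi> \<Longrightarrow> smooth \<phi>" and slow_poly_bdd: "slow \<phi> \<Longrightarrow> poly_bdd \<phi>"
  and slow_pd: "slow \<phi> \<Longrightarrow> slow (pd j \<phi>)"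
  unfolding slow_def
  by (auto simp flip: partials_snoc_pd intro: smooth_pd) (metis partials.simps(1))

lemma schwartz_smooth: "schwartz \<phi> \<Longrightarrow> smooth \<phi>" and schwartz_rapid: "schwartz \<phi> \<Longrightarrow> rapid \<phi>"
  and schwartz_pd: "schwartz \<phi> \<Longrightarrow> schwartz (pd j \<phi>)"
  unfolding schwartz_iff
  by (auto simp flip: partials_snoc_pd intro: smooth_pd) (metis partials.simps(1))

lemma fsums_slow:
  assumes "\<And>s. s \<in> S \<Longrightarrow> smooth s \<and> poly_bdd s" "\<And>s j. s \<in> S \<Longrightarrow> pd j s \<in> fsums S" "u \<in> fsums S"
  shows "slow u"
proof -
  have "poly_bdd v" if "v \<in> fsums S" for v
    using that by induction (use assms(1) poly_bdd_add in auto)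
  then show ?thesis
    using fsums_partials[of S u] assms smooth_differentiable unfolding slow_def by metis
qed

lemma slow_add: "slow \<phi> \<Longrightarrow> slow \<psi> \<Longrightarrow> slow (\<lambda>x. \<phi> x + \<psi> x)"
  by (simp add: slow_def smooth_add partials_add poly_bdd_add)

lemma slow_mult:
  fixes \<phi> \<psi> :: "'n::finite rspace \<Rightarrow> complex"
  assumes "slow \<phi>" "slow \<psi>"
  shows "slow (\<lambda>x. \<phi> x * \<psi> x)"
proof -
  let ?S = "{(\<lambda>x. a x * b x) | a b. slow a \<and> slow b} :: ('n rspace \<Rightarrow> complex) set"
  have mem: "(\<lambda>x. a x * b x) \<in> ?S" if "slow a" "slow b" for a b
    using that by blast
  show ?thesis
  proof (rule fsums_slow[where S = ?S])
    fix s assume "s \<in> ?S"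
    then show "smooth s \<and> poly_bdd s"
      by (elim CollectE exE conjE) (simp add: smooth_mult poly_bdd_mult slow_smooth slow_poly_bdd)
  next
    fix s j assume "s \<in> ?S"
    then obtain a b where s: "s = (\<lambda>x. a x * b x)" "slow a" "slow b" by blast
    have "pd j s = (\<lambda>x. a x * pd j b x + pd j a x * b x)"
      unfolding s(1) by (intro ext pd_mult smooth_differentiable slow_smooth s)
    then show "pd j s \<in> fsums ?S"
      by (simp only:) (intro fsums_add fsums_base mem slow_pd s)
  qed (intro fsums_base mem assms)
qed

lemma schwartz_add: "schwartz \<phi> \<Longrightarrow> schwartz \<psi> \<Longrightarrow> schwartz (\<lambda>x. \<phi> x + \<psi> x)"
  by (simp add: schwartz_iff smooth_add partials_add rapid_add)

lemma schwartz_mult: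
  fixes \<phi> \<psi> :: "'n::finite rspace \<Rightarrow> complex"
  assumes "schwartz \<phi>" "slow \<psi>"
  shows "schwartz (\<lambda>x. \<phi> x * \<psi> x)"
proof -
  let ?S = "{(\<lambda>x. a x * b x) | a b. schwartz a \<and> slow b} :: ('n rspace \<Rightarrow> complex) set"
  have mem: "(\<lambda>x. a x * b x) \<in> ?S" if "schwartz a" "slow b" for a b
    using that by blast
  have d: "s differentiable at x" if "s \<in> ?S" for s x
    using that by (elim CollectE exE conjE) (simp add: smooth_differentiable slow_smooth schwartz_smooth)
  have p: "pd j s \<in> fsums ?S" if "s \<in> ?S" for s j
  proof -
    from that obtain a b where s: "s = (\<lambda>x. a x * b x)" "schwartz a" "slow b" by blast
    have "pd j s = (\<lambda>x. a x * pd j b x + pd j a x * b x)"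
      unfolding s(1) by (intro ext pd_mult smooth_differentiable slow_smooth schwartz_smooth s)
    then show "pd j s \<in> fsums ?S"
      by (simp only:) (intro fsums_add fsums_base mem slow_pd schwartz_pd s)
  qed
  have m: "(\<lambda>x. \<phi> x * \<psi> x) \<in> fsums ?S"
    by (intro fsums_base mem assms)
  have "rapid v" if "v \<in> fsums ?S" for v
    using that
  proof induction
    case (fsums_base s)
    then show ?case
      by (elim CollectE exE conjE) (simp add: rapid_mult slow_poly_bdd schwartz_rapid)
  qed (rule rapid_add)
  with fsums_partials[of ?S, OF d p m] show ?thesis
    unfolding schwartz_iff by blast
qed

lemma poly_bdd_const: "poly_bdd (\<lambda>x. c)"
  unfolding poly_bdd_def by (rule exI[of _ 0], rule exI[of _ "norm c"]) simp

lemma slow_const: "slow (\<lambda>x. c)"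
proof -
  have "\<exists>c'. partials js (\<lambda>x. c) = (\<lambda>x. c')" for js :: "'a list"
    by (induction js) (auto simp: partials_Cons_pd simp del: partials.simps(2))
  then show ?thesis unfolding slow_def using poly_bdd_const by (metis smooth_const)
qed

lemma slow_cmult: "slow \<phi> \<Longrightarrow> slow (\<lambda>x. c * \<phi> x)"
  by (rule slow_mult[OF slow_const])

lemma slow_diff: "slow \<phi> \<Longrightarrow> slow \<psi> \<Longrightarrow> slow (\<lambda>x. \<phi> x - \<psi> x)"
  using slow_add[OF _ slow_cmult[of \<psi> "-1"]] by fastforce

lemma schwartz_cmult: "schwartz \<phi> \<Longrightarrow> schwartz (\<lambda>x. c * \<phi> x)"
  using schwartz_mult[OF _ slow_const, of \<phi> c] by (simp add: mult.commute)

lemma slow_coord: "slow (\<lambda>x::'n::finite rspace. complex_of_real (x $ k))"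
proof -
  have "poly_bdd (\<lambda>x::'n rspace. complex_of_real (x $ k))"
    unfolding poly_bdd_def
  proof (intro exI allI)
    fix x :: "'n rspace"
    show "norm (complex_of_real (x $ k)) \<le> 1 * (1 + norm x) ^ 1"
      using component_le_norm_cart[of x k] by simp
  qed
  then show ?thesis
    by (intro fsums_slow[where S = "insert (\<lambda>x. complex_of_real (x $ k)) (range (\<lambda>c x. c))"])
       (auto simp: pd_coord poly_bdd_const intro!: fsums_base)
qed

lemma smooth_vanish_bounded:
  fixes \<phi> :: "'n::finite rspace \<Rightarrow> complex"
  assumes "smooth \<phi>" "\<And>x. norm x > M \<Longrightarrow> \<phi> x = 0"
  shows "\<exists>C. \<forall>x. norm (partials js \<phi> x) \<le> C"
proof -
  have "bounded (partials js \<phi> ` cball 0 M)"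
    by (intro compact_imp_bounded compact_continuous_image smooth_continuous smooth_partials assms) simp
  then obtain C where C: "\<And>x. norm x \<le> M \<Longrightarrow> norm (partials js \<phi> x) \<le> C"
    unfolding bounded_iff by (metis imageI mem_cball_0)
  have "norm (partials js \<phi> x) \<le> max C 0" for x
  proof (cases "norm x \<le> M")
    case False
    have "open (- cball 0 M :: 'n rspace set)" by (simp add: open_Compl)
    from partials_eq_0_open[OF this, of \<phi> x] have "partials js \<phi> x = 0"
      using False assms(2) by auto
    then show ?thesis by simp
  qed (use C[of x] in auto)
  then show ?thesis by blast
qed

lemma schwartz_vanish:
  fixes \<phi> :: "'n::finite rspace \<Rightarrow> complex"
  assumes "smooth \<phi>" "\<And>x. norm x > M \<Longrightarrow> \<phi> x = 0"
  shows "schwartz \<phi>"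
  unfolding schwartz_iff rapid_def
proof (intro conjI allI)
  fix js and m :: nat
  obtain C where C: "\<And>x. norm (partials js \<phi> x) \<le> C"
    using smooth_vanish_bounded[of \<phi> M js, OF assms] by blast
  have "open (- cball 0 M :: 'n rspace set)" by (simp add: open_Compl)
  note z = partials_eq_0_open[OF this, of \<phi>]
  have "C \<ge> 0" using order_trans[OF norm_ge_zero C[of 0]] by simp
  have "(1 + norm x) ^ m * norm (partials js \<phi> x) \<le> (1 + \<bar>M\<bar>) ^ m * C" for x
  proof (cases "norm x \<le> M")
    case True
    then show ?thesis using C[of x] by (intro mult_mono power_mono) auto
  next
    case False
    then have "partials js \<phi> x = 0"
      using assms(2) by (intro z) auto
    then show ?thesis using \<open>C \<ge> 0\<close> by simp
  qed
  then show "\<exists>D. \<forall>x. (1 + norm x) ^ m * norm (partials js \<phi> x) \<le> D" by blast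
qed (fact assms)

lemma slow_vanish:
  fixes \<phi> :: "'n::finite rspace \<Rightarrow> complex"
  assumes "smooth \<phi>" "\<And>x. norm x > M \<Longrightarrow> \<phi> x = 0"
  shows "slow \<phi>"
proof -
  have "poly_bdd (partials js \<phi>)" for js
    unfolding poly_bdd_def
    by (rule exI[of _ 0]) (use smooth_vanish_bounded[of \<phi> M js, OF assms] in simp)
  then show ?thesis using assms by (simp add: slow_def)
qed

section \<open>Powers of the norm away from the origin\<close>

text \<open>Vanishing near the origin is what makes products with arbitrary real powers of the norm
  smooth.\<close>

definition slow_off :: "real \<Rightarrow> ('n::finite rspace \<Rightarrow> complex) \<Rightarrow> bool"
  where "slow_off \<epsilon> \<phi> \<longleftrightarrow> slow \<phi> \<and> (\<forall>x. norm x < \<epsilon> \<longrightarrow> \<phi> x = 0)"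

lemma pd_vanish: "(\<And>x. norm x < \<epsilon> \<Longrightarrow> \<phi> x = 0) \<Longrightarrow> norm x < \<epsilon> \<Longrightarrow> pd j \<phi> x = 0"
  using partials_eq_0_open[of "ball 0 \<epsilon>" \<phi> x "[j]"] by (simp add: pd_def)

lemma pd_vanish_out: "(\<And>x. norm x > M \<Longrightarrow> \<phi> x = 0) \<Longrightarrow> norm x > M \<Longrightarrow> pd j \<phi> x = 0"
  using partials_eq_0_open[of "- cball 0 M" \<phi> x "[j]"] by (simp add: pd_def open_Compl)

lemma slow_off_pd: "slow_off \<epsilon> \<phi> \<Longrightarrow> slow_off \<epsilon> (pd j \<phi>)"
  unfolding slow_off_def by (auto intro: slow_pd pd_vanish)

text \<open>Written with the exponent \<open>t - 2\<close> and the polynomial factor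
  \<open>x \<bullet> h\<close> instead of a unit vector, so that multiples of powers of the norm are
  closed under differentiation.\<close>

lemma has_derivative_norm_powr:
  fixes x :: "'n::finite rspace"
  assumes "x \<noteq> 0"
  shows "((\<lambda>x. complex_of_real (norm x powr t)) has_derivative
           (\<lambda>h. complex_of_real (t * norm x powr (t - 2) * (x \<bullet> h)))) (at x)"
proof -
  have "((\<lambda>x. norm x powr t) has_derivative (\<lambda>h. t * norm x powr (t - 2) * (x \<bullet> h))) (at x)"
    by (rule has_derivative_eq_rhs, rule derivative_intros has_derivative_norm assms | simp add: assms)+
       (use assms in \<open>auto simp: fun_eq_iff inner_commute sgn_div_norm powr_diff powr_numeral power2_eq_square field_simps\<close>)
  then show ?thesis
    by (rule bounded_linear.has_derivative[OF bounded_linear_of_real])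
qed

lemma slow_off_powr_differentiable:
  fixes \<phi> :: "'n::finite rspace \<Rightarrow> complex"
  assumes "slow_off \<epsilon> \<phi>" "\<epsilon> > 0"
  shows "(\<lambda>x. \<phi> x * complex_of_real (norm x powr t)) differentiable at x" (is ?D)
    and "pd j (\<lambda>x. \<phi> x * complex_of_real (norm x powr t)) x
      = (complex_of_real t * (\<phi> x * complex_of_real (x $ j))) * complex_of_real (norm x powr (t - 2))
        + pd j \<phi> x * complex_of_real (norm x powr t)" (is ?P)
proof -
  have d: "\<phi> differentiable at x"
    using assms by (simp add: slow_off_def slow_smooth smooth_differentiable)
  have "?D \<and> ?P"
  proof (cases "x = 0")
    case False
    note h = has_derivative_norm_powr[OF False, of t]
    have "(\<lambda>x. complex_of_real (norm x powr t)) differentiable at x"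
      using h by (auto simp: differentiable_def)
    with d show ?thesis
      by (auto simp: pd_mult pd_eqI[OF h] inner_axis algebra_simps)
  \<comment> \<open>At the origin the product is locally zero, and the right-hand side vanishes too,
    because \<open>0 powr t = 0\<close> for every \<open>t\<close>.\<close>
  next
    case True
    have z: "\<phi> y * complex_of_real (norm y powr t) = 0" if "y \<in> ball 0 \<epsilon>" for y
      using that assms by (simp add: slow_off_def)
    have "((\<lambda>x. \<phi> x * complex_of_real (norm x powr t)) has_derivative (\<lambda>h. 0)) (at x)"
      by (rule has_derivative_transform_within_open[of "\<lambda>x. 0" _ _ _ "ball 0 \<epsilon>"])
         (use z True assms in auto)
    then show ?thesis
      using pd_eqI True by (auto simp: differentiable_def)
  qed
  then show ?D ?P by auto
qed

text \<open>These are the coefficients that differentiating a power of the norm puts in front of the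
  power lowered by two.\<close>

lemma slow_off_coord: "slow_off \<epsilon> \<phi> \<Longrightarrow> slow_off \<epsilon> (\<lambda>x. c * (\<phi> x * complex_of_real (x $ j)))"
  unfolding slow_off_def by (simp add: slow_mult slow_coord slow_cmult)

lemma slow_off_powr:
  fixes \<phi> :: "'n::finite rspace \<Rightarrow> complex"
  assumes "slow_off \<epsilon> \<phi>" and e: "\<epsilon> > 0"
  shows "slow_off \<epsilon> (\<lambda>x. \<phi> x * complex_of_real (norm x powr t))"
proof -
  let ?S = "{(\<lambda>x. \<phi> x * complex_of_real (norm x powr t)) | \<phi> t. slow_off \<epsilon> \<phi>} :: ('n rspace \<Rightarrow> complex) set"
  have mem: "(\<lambda>x. \<phi> x * complex_of_real (norm x powr t)) \<in> ?S" if "slow_off \<epsilon> \<phi>" for \<phi> t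
    using that by blast
  have d: "s differentiable at x" if "s \<in> ?S" for s x
    using that by (elim CollectE exE conjE) (simp add: slow_off_powr_differentiable e)
  have p: "pd j s \<in> fsums ?S" if "s \<in> ?S" for s j
  proof -
    from that obtain \<phi> t where s: "s = (\<lambda>x. \<phi> x * complex_of_real (norm x powr t))" "slow_off \<epsilon> \<phi>" by blast
    show "pd j s \<in> fsums ?S"
      unfolding s(1) slow_off_powr_differentiable(2)[OF s(2) e, abs_def]
      by (intro fsums_add fsums_base mem slow_off_coord slow_off_pd s)
  qed
  have "slow (\<lambda>x. \<phi> x * complex_of_real (norm x powr t))"
  proof (rule fsums_slow[of ?S])
    fix s assume s: "s \<in> ?S"
    then obtain \<phi> t where s': "s = (\<lambda>x. \<phi> x * complex_of_real (norm x powr t))" "slow_off \<epsilon> \<phi>" by blast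
    obtain m C where C: "\<And>x. norm (\<phi> x) \<le> C * (1 + norm x) ^ m"
      using s'(2) slow_poly_bdd unfolding slow_off_def poly_bdd_def by metis
    have "C \<ge> 0" using order_trans[OF norm_ge_zero C[of 0]] by simp
    obtain k :: nat where k: "real k \<ge> \<bar>t\<bar>" using real_arch_simple by blast
    have "norm (s x) \<le> (C * max 1 (1 / \<epsilon>) ^ k) * (1 + norm x) ^ (m + k)" for x
    proof (cases "norm x < \<epsilon>")
      case True
      then show ?thesis using s' \<open>C \<ge> 0\<close> by (simp add: slow_off_def)
    next
      case False
      \<comment> \<open>Off the ball of radius \<epsilon> this quantity dominates 1,
        \<open>norm x\<close> and \<open>1 / norm x\<close>, so its powers bound
        \<open>norm x powr t\<close> for either sign of \<open>t\<close>.\<close>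
      let ?b = "max 1 (1 / \<epsilon>) * (1 + norm x)"
      have b: "?b \<ge> 1" "?b \<ge> norm x" "?b \<ge> 1 / norm x" "norm x > 0"
      proof -
        show "?b \<ge> 1" using mult_mono[of 1 "max 1 (1 / \<epsilon>)" 1 "1 + norm x"] by simp
        show "?b \<ge> norm x" using mult_mono[of 1 "max 1 (1 / \<epsilon>)" "norm x" "1 + norm x"] by simp
        show "norm x > 0" using False e by linarith
        have "1 / norm x \<le> 1 / \<epsilon>" using False e by (simp add: frac_le)
        also have "\<dots> \<le> max 1 (1/\<epsilon>) * 1" by simp
        also have "\<dots> \<le> ?b" by (rule mult_left_mono) auto
        finally show "?b \<ge> 1 / norm x" .
      qed
      have "norm x powr t \<le> ?b powr \<bar>t\<bar>"
      proof (cases "t \<ge> 0")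
        case True
        then show ?thesis using b by (simp add: powr_mono2)
      next
        case False
        then have "norm x powr t = (1 / norm x) powr \<bar>t\<bar>"
          using b by (simp add: powr_minus_divide powr_divide)
        also have "\<dots> \<le> ?b powr \<bar>t\<bar>"
          using b by (intro powr_mono2) auto
        finally show ?thesis .
      qed
      also have "\<dots> \<le> ?b powr real k"
        using b k by (intro powr_mono) auto
      also have "\<dots> = ?b ^ k" using b by (simp add: powr_realpow)
      finally have r: "norm x powr t \<le> ?b ^ k" .
      have "norm (s x) = norm (\<phi> x) * norm x powr t" by (simp add: s' norm_mult)
      also have "\<dots> \<le> (C * (1 + norm x) ^ m) * ?b ^ k"
        by (intro mult_mono C r) (use \<open>C \<ge> 0\<close> in auto)
      finally show ?thesis by (simp add: power_add power_mult_distrib mult_ac)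
    qed
    then have "poly_bdd s" unfolding poly_bdd_def by blast
    moreover have "smooth s" using fsums_partials(2)[of ?S s, OF d p fsums_base[OF s]] .
    ultimately show "smooth s \<and> poly_bdd s" by blast
  qed (use p assms mem fsums_base in blast)+
  then show ?thesis using assms by (simp add: slow_off_def)
qed

section \<open>Powers of the norm on an annulus, with bounds uniform in the exponent\<close>

definition annular :: "real \<Rightarrow> real \<Rightarrow> ('n::finite rspace \<Rightarrow> complex) \<Rightarrow> bool"
  where "annular \<epsilon> M \<phi> \<longleftrightarrow> smooth \<phi> \<and> (\<forall>x. norm x < \<epsilon> \<longrightarrow> \<phi> x = 0) \<and> (\<forall>x. norm x > M \<longrightarrow> \<phi> x = 0)"

lemma annular_slow_off: "annular \<epsilon> M \<phi> \<Longrightarrow> slow_off \<epsilon> \<phi>"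
  unfolding annular_def slow_off_def using slow_vanish by metis

lemma annular_powr:
  "annular \<epsilon> M \<phi> \<Longrightarrow> \<epsilon> > 0 \<Longrightarrow> annular \<epsilon> M (\<lambda>x. \<phi> x * complex_of_real (norm x powr t))"
  using slow_off_powr[OF annular_slow_off, of \<epsilon> M \<phi> t]
  by (auto simp: annular_def slow_off_def intro: slow_smooth)

text \<open>The constant does not depend on \<open>s\<close>. Every derivative either hits the
  annular factor or brings down one factor \<open>s\<close>, hence a polynomial in \<open>s\<close>
  whose degree is the order of the derivative. This polynomial is what disappears when roots are
  taken.\<close>

lemma annular_powr_bound:
  assumes "annular \<epsilon> M \<phi>" "\<epsilon> > 0"
  shows "\<exists>C\<ge>0. \<forall>s x. norm (partials js (\<lambda>x. \<phi> x * complex_of_real (norm x powr s)) x)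
           \<le> C * (1 + \<bar>s\<bar>) ^ length js * norm x powr s"
  using assms(1)
proof (induction js arbitrary: \<phi> rule: rev_induct)
  case Nil
  then obtain C where C: "\<And>x. norm (\<phi> x) \<le> C"
    using smooth_vanish_bounded[of \<phi> M "[]"] unfolding annular_def by auto
  moreover have "C \<ge> 0" using order_trans[OF norm_ge_zero C[of 0]] by simp
  ultimately show ?case
    by (intro exI[of _ C]) (auto simp: norm_mult intro!: mult_right_mono)
next
  case (snoc j js)
  \<comment> \<open>Absorbing the coordinate and the power \<open>- 2\<close> into the annular
    factor leaves the exponent \<open>s\<close> unchanged, so the induction hypothesis applies with
    constants independent of \<open>s\<close>.\<close>
  let ?\<psi> = "\<lambda>x. \<phi> x * complex_of_real (x $ j) * complex_of_real (norm x powr (- 2))"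
  have c: "annular \<epsilon> M (\<lambda>x. \<phi> x * complex_of_real (x $ j))"
    using snoc.prems by (simp add: annular_def smooth_mult)
  have a: "annular \<epsilon> M ?\<psi>" "annular \<epsilon> M (pd j \<phi>)"
    using annular_powr[OF c assms(2)] snoc.prems
    by (auto simp: annular_def intro: smooth_pd pd_vanish pd_vanish_out)
  obtain C1 where C1: "C1 \<ge> 0" "\<And>s x. norm (partials js (\<lambda>x. ?\<psi> x * complex_of_real (norm x powr s)) x)
           \<le> C1 * (1 + \<bar>s\<bar>) ^ length js * norm x powr s"
    using snoc.IH[OF a(1)] by auto
  obtain C2 where C2: "C2 \<ge> 0" "\<And>s x. norm (partials js (\<lambda>x. pd j \<phi> x * complex_of_real (norm x powr s)) x)
           \<le> C2 * (1 + \<bar>s\<bar>) ^ length js * norm x powr s"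
    using snoc.IH[OF a(2)] by auto
  have "norm (partials (js @ [j]) (\<lambda>x. \<phi> x * complex_of_real (norm x powr s)) x)
      \<le> (C1 + C2) * (1 + \<bar>s\<bar>) ^ length (js @ [j]) * norm x powr s" for s x
  proof -
    have sm: "smooth (\<lambda>x. ?\<psi> x * complex_of_real (norm x powr s))"
      "smooth (\<lambda>x. pd j \<phi> x * complex_of_real (norm x powr s))"
      using annular_powr[OF a(1) assms(2), of s] annular_powr[OF a(2) assms(2), of s]
      by (auto simp: annular_def)
    have "partials (js @ [j]) (\<lambda>x. \<phi> x * complex_of_real (norm x powr s))
      = partials js (\<lambda>x. complex_of_real s * (?\<psi> x * complex_of_real (norm x powr s))
          + pd j \<phi> x * complex_of_real (norm x powr s))"
      unfolding partials_snoc_pd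
      by (rule arg_cong[where f = "partials js"], rule ext,
          subst slow_off_powr_differentiable(2)[OF annular_slow_off[OF snoc.prems] assms(2)])
         (simp add: algebra_simps flip: of_real_mult powr_add)
    also have "\<dots> = (\<lambda>x. complex_of_real s * partials js (\<lambda>x. ?\<psi> x * complex_of_real (norm x powr s)) x
          + partials js (\<lambda>x. pd j \<phi> x * complex_of_real (norm x powr s)) x)"
      by (subst partials_add, intro smooth_cmult sm, rule sm, subst partials_cmult, rule sm, rule refl)
    finally have "norm (partials (js @ [j]) (\<lambda>x. \<phi> x * complex_of_real (norm x powr s)) x)
       \<le> \<bar>s\<bar> * (C1 * (1 + \<bar>s\<bar>) ^ length js * norm x powr s) + 1 * (C2 * (1 + \<bar>s\<bar>) ^ length js * norm x powr s)"
      using norm_triangle_ineq mult_left_mono[OF C1(2)[of s x], of "\<bar>s\<bar>"] C2(2)[of s x]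
      by (smt (verit) abs_ge_zero norm_mult norm_of_real)
    also have "\<dots> \<le> (1 + \<bar>s\<bar>) * (C1 * (1 + \<bar>s\<bar>) ^ length js * norm x powr s)
        + (1 + \<bar>s\<bar>) * (C2 * (1 + \<bar>s\<bar>) ^ length js * norm x powr s)"
      by (intro add_mono mult_right_mono) (use C1 C2 in auto)
    finally show ?thesis by (simp add: algebra_simps)
  qed
  then show ?case using C1(1) C2(1) by (intro exI[of _ "C1 + C2"]) auto
qed

section \<open>Smooth cutoff functions\<close>

text \<open>\<open>k = 0\<close> is the classical function exp(-1/t), flat at the origin. The powers
  of 1/t are included because its derivatives are linear combinations of members of this
  family.\<close>

definition hbump :: "nat \<Rightarrow> real \<Rightarrow> real"
  where "hbump k t = (if t > 0 then inverse t ^ k * exp (- inverse t) else 0)"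

lemma hbump_tendsto_0: "(hbump k \<longlongrightarrow> 0) (at 0)"
proof (rule filterlim_split_at)
  show "(hbump k \<longlongrightarrow> 0) (at_left 0)"
    by (rule tendsto_eventually) (auto simp: hbump_def eventually_at_left_field intro: exI[of _ "-1"])
  have "((\<lambda>t. inverse t ^ k / exp (inverse t)) \<longlongrightarrow> 0) (at_right (0::real))"
    by (rule filterlim_compose[OF tendsto_power_div_exp_0 filterlim_inverse_at_top_right])
  then show "(hbump k \<longlongrightarrow> 0) (at_right 0)"
    by (rule Lim_transform_eventually)
       (auto simp: hbump_def eventually_at_right_field exp_minus field_simps intro!: exI[of _ 1])
qed

lemma hbump_deriv:
  "(hbump k has_real_derivative (hbump (k + 2) t - real k * hbump (k + 1) t)) (at t)"
proof (cases t "0::real" rule: linorder_cases)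
  case less
  have "((\<lambda>t. 0) has_real_derivative 0) (at t)" by simp
  then have "(hbump k has_real_derivative 0) (at t)"
    by (rule has_field_derivative_transform_within_open[where S = "{..<0}"]) (use less in \<open>auto simp: hbump_def\<close>)
  then show ?thesis using less by (simp add: hbump_def)
next
  case greater
  have i: "(inverse has_real_derivative - (inverse t ^ Suc (Suc 0))) (at t)"
    using greater by (intro DERIV_inverse) simp
  have "((\<lambda>t. inverse t ^ k * exp (- inverse t)) has_real_derivative
     (real k * (- (inverse t ^ Suc (Suc 0)) * inverse t ^ (k - Suc 0))) * exp (- inverse t)
       + (exp (- inverse t) * (- (- (inverse t ^ Suc (Suc 0))))) * inverse t ^ k) (at t)"
    by (intro DERIV_mult DERIV_power DERIV_fun_exp DERIV_minus i)
  also have "(real k * (- (inverse t ^ Suc (Suc 0)) * inverse t ^ (k - Suc 0))) * exp (- inverse t)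
       + (exp (- inverse t) * (- (- (inverse t ^ Suc (Suc 0))))) * inverse t ^ k
     = hbump (k + 2) t - real k * hbump (k + 1) t"
    using greater by (cases k) (simp_all add: hbump_def algebra_simps power2_eq_square)
  finally have "((\<lambda>t. inverse t ^ k * exp (- inverse t)) has_real_derivative
     (hbump (k + 2) t - real k * hbump (k + 1) t)) (at t)" .
  then show ?thesis
    by (rule has_field_derivative_transform_within_open[where S = "{0<..}"]) (use greater in \<open>auto simp: hbump_def\<close>)
\<comment> \<open>The difference quotient of \<open>hbump k\<close> at the origin is
  \<open>hbump (k + 1)\<close>, which tends to 0.\<close>
next
  case equal
  have "((\<lambda>h. (hbump k (0 + h) - hbump k 0) / h) \<longlongrightarrow> 0) (at 0)"
    using hbump_tendsto_0[of "k + 1"]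
    by (rule Lim_transform_eventually) (auto simp: hbump_def eventually_at_filter divide_inverse mult_ac)
  then show ?thesis by (simp add: equal hbump_def DERIV_def)
qed

lemma smooth_hbump:
  fixes a :: "'n::finite rspace"
  shows "smooth (\<lambda>x. complex_of_real (hbump k (c + d * (norm (x - a))\<^sup>2)))"
proof -
  let ?q = "\<lambda>x. c + d * (norm (x - a))\<^sup>2"
  let ?S = "{(\<lambda>x. b x * complex_of_real (hbump k (?q x))) | b k. smooth b} :: ('n rspace \<Rightarrow> complex) set"
  have mem: "(\<lambda>x. b x * complex_of_real (hbump k (?q x))) \<in> ?S" if "smooth b" for b k
    using that by blast
  have h: "((\<lambda>x. complex_of_real (hbump k (?q x))) has_derivative
     (\<lambda>h. complex_of_real ((2 * d * ((x - a) \<bullet> h)) * (hbump (k + 2) (?q x) - real k * hbump (k + 1) (?q x)))))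
     (at x)" for k x
  proof -
    have "(?q has_derivative (\<lambda>h. 2 * d * ((x - a) \<bullet> h))) (at x)"
      unfolding power2_norm_eq_inner
      by (rule derivative_eq_intros refl | simp add: inner_commute algebra_simps)+
    from DERIV_compose_FDERIV[OF hbump_deriv this] show ?thesis
      by (rule bounded_linear.has_derivative[OF bounded_linear_of_real])
  qed
  have dh: "(\<lambda>x. complex_of_real (hbump k (?q x))) differentiable at x" for k x
    using h unfolding differentiable_def by blast
  have "(\<lambda>x. 1 * complex_of_real (hbump k (?q x))) \<in> fsums ?S"
    by (intro fsums_base mem smooth_const)
  then have "smooth (\<lambda>x. 1 * complex_of_real (hbump k (?q x)))"
  proof (rule fsums_partials(2)[rotated -1])
    fix s x assume "s \<in> ?S"
    then show "s differentiable at x"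
      using dh by (elim CollectE exE conjE) (simp add: smooth_differentiable)
  next
    fix s j assume "s \<in> ?S"
    then obtain b k where s: "s = (\<lambda>x. b x * complex_of_real (hbump k (?q x)))" "smooth b" by blast
    have "pd j s = (\<lambda>x. (b x * (complex_of_real (2 * d) * (complex_of_real (x $ j) - complex_of_real (a $ j))))
            * complex_of_real (hbump (k + 2) (?q x))
          + ((b x * (complex_of_real (- 2 * d * real k) * (complex_of_real (x $ j) - complex_of_real (a $ j))))
            * complex_of_real (hbump (k + 1) (?q x))
          + pd j b x * complex_of_real (hbump k (?q x))))"
      unfolding s(1)
      by (rule ext, subst pd_mult, rule smooth_differentiable[OF s(2)], rule dh, subst pd_eqI[OF h])
         (simp add: inner_axis algebra_simps)
    also have "\<dots> \<in> fsums ?S"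
      by (intro fsums_add fsums_base mem smooth_mult smooth_diff smooth_const smooth_coord smooth_pd s)
    finally show "pd j s \<in> fsums ?S" .
  qed
  then show ?thesis by simp
qed

text \<open>The quotient A/(A + B), where A is positive exactly inside the larger ball and B exactly
  outside the closed smaller one. As the radii differ, A + B has no zero.\<close>

lemma exists_cutoff:
  fixes a :: "'n::finite rspace"
  assumes "0 < r" "r < r'"
  shows "\<exists>\<zeta>. smooth \<zeta> \<and> (\<forall>x. norm (x - a) \<le> r \<longrightarrow> \<zeta> x = 1) \<and> (\<forall>x. norm (x - a) \<ge> r' \<longrightarrow> \<zeta> x = 0)"
proof -
  define A where "A x = hbump 0 (r'\<^sup>2 + (- 1) * (norm (x - a))\<^sup>2)" for x
  define B where "B x = hbump 0 (- r\<^sup>2 + 1 * (norm (x - a))\<^sup>2)" for x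
  have sq: "r\<^sup>2 < r'\<^sup>2" using assms by (simp add: power_strict_mono)
  have AB: "A x \<ge> 0" "B x \<ge> 0" "A x + B x > 0" for x
    using sq unfolding A_def B_def hbump_def by (auto simp: add_nonneg_pos)
  have "smooth (\<lambda>x. complex_of_real (A x) * inverse (complex_of_real (A x) + complex_of_real (B x)))"
  proof (intro smooth_mult smooth_inverse smooth_add)
    show "smooth (\<lambda>x. complex_of_real (A x))" "smooth (\<lambda>x. complex_of_real (B x))"
      unfolding A_def B_def by (rule smooth_hbump)+
    then show "smooth (\<lambda>x. complex_of_real (A x))" by simp
    show "complex_of_real (A x) + complex_of_real (B x) \<noteq> 0" for x
      using AB(3)[of x] by (metis of_real_add of_real_eq_0_iff less_irrefl)
  qed
  moreover have "complex_of_real (A x) * inverse (complex_of_real (A x) + complex_of_real (B x)) = 1"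
    if "norm (x - a) \<le> r" for x
  proof -
    have "(norm (x - a))\<^sup>2 \<le> r\<^sup>2" using that by (simp add: power_mono)
    then have "B x = 0" by (simp add: B_def hbump_def)
    then show ?thesis using AB(3)[of x] by simp
  qed
  moreover have "complex_of_real (A x) * inverse (complex_of_real (A x) + complex_of_real (B x)) = 0"
    if "norm (x - a) \<ge> r'" for x
  proof -
    have "(norm (x - a))\<^sup>2 \<ge> r'\<^sup>2" using that assms by (simp add: power_mono)
    then show ?thesis by (simp add: A_def hbump_def)
  qed
  ultimately show ?thesis
    by (intro exI[of _ "\<lambda>x. complex_of_real (A x) * inverse (complex_of_real (A x) + complex_of_real (B x))"]) blast
qed

section \<open>Integration on Euclidean space\<close>

lemma nn_integral_affine:
  fixes t :: "'a::euclidean_space"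
  assumes [measurable]: "f \<in> borel_measurable borel" and c: "c \<noteq> 0"
  shows "(\<integral>\<^sup>+x. f x \<partial>lborel) = \<bar>c\<bar> ^ DIM('a) * (\<integral>\<^sup>+x. f (t + c *\<^sub>R x) \<partial>lborel)"
  by (subst lborel_affine[OF c, of t])
     (simp add: nn_integral_density nn_integral_distr nn_integral_cmult ennreal_power)

lemma integrable_affine_imp:
  fixes f :: "'a::euclidean_space \<Rightarrow> 'b :: {banach, second_countable_topology}"
  assumes f: "integrable lborel f" and c: "c \<noteq> 0"
  shows "integrable lborel (\<lambda>x. f (t + c *\<^sub>R x))"
  using f f[THEN borel_measurable_integrable] c unfolding integrable_iff_bounded
  by (subst (asm) nn_integral_affine[where c=c and t=t]) (auto simp: ennreal_mult_less_top)

lemma integrable_affine_iff: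
  fixes f :: "'a::euclidean_space \<Rightarrow> 'b :: {banach, second_countable_topology}"
  assumes c: "c \<noteq> 0"
  shows "integrable lborel (\<lambda>x. f (t + c *\<^sub>R x)) \<longleftrightarrow> integrable lborel f"
  using integrable_affine_imp[of f c t] c
    integrable_affine_imp[of "\<lambda>x. f (t + c *\<^sub>R x)" "1/c" "- (1/c) *\<^sub>R t"]
  by (auto simp: algebra_simps)

lemma integral_affine:
  fixes f :: "'a::euclidean_space \<Rightarrow> 'b :: {banach, second_countable_topology}"
  assumes c: "c \<noteq> 0"
  shows "(LINT x|lborel. f x) = \<bar>c\<bar> ^ DIM('a) *\<^sub>R (LINT x|lborel. f (t + c *\<^sub>R x))"
proof cases
  assume f[measurable]: "integrable lborel f" then show ?thesis
    using c f f[THEN borel_measurable_integrable] integrable_affine_imp[OF f c, of t]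
    by (subst lborel_affine[OF c, of t])
       (simp add: integral_density integral_distr)
next
  assume "\<not> integrable lborel f" with c show ?thesis
    by (simp add: integrable_affine_iff not_integrable_integral_eq)
qed

lemma integrable_reflect:
  fixes f :: "'a::euclidean_space \<Rightarrow> 'b :: {banach, second_countable_topology}"
  shows "integrable lborel (\<lambda>x. f (t - x)) \<longleftrightarrow> integrable lborel f"
  using integrable_affine_iff[of "-1" f t] by simp

lemma integral_reflect:
  fixes f :: "'a::euclidean_space \<Rightarrow> 'b :: {banach, second_countable_topology}"
  shows "(LINT x|lborel. f (t - x)) = (LINT x|lborel. f x)"
  using integral_affine[of "-1" f t] by simp

lemma integrable_translate:
  fixes f :: "'a::euclidean_space \<Rightarrow> 'b :: {banach, second_countable_topology}"
  shows "integrable lborel (\<lambda>x. f (x + t)) \<longleftrightarrow> integrable lborel f"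
  using integrable_affine_iff[of 1 f t] by (simp add: add.commute)

lemma integral_translate:
  fixes f :: "'a::euclidean_space \<Rightarrow> 'b :: {banach, second_countable_topology}"
  shows "(LINT x|lborel. f (x + t)) = (LINT x|lborel. f x)"
  using integral_affine[of 1 f t] by (simp add: add.commute)

text \<open>Lebesgue measure is the image of a product measure indexed by \<open>Basis\<close>. The
  map \<open>idx\<close> translates basis vectors back into coordinate indices, after which the
  product rules for finite product measures apply.\<close>

lemma product_integral_vec:
  fixes h :: "'n::finite \<Rightarrow> real \<Rightarrow> 'b::{real_normed_field,banach,second_countable_topology}"
  assumes h: "\<And>j. integrable lborel (h j)"
  shows "integrable lborel (\<lambda>x::'n rspace. \<Prod>j\<in>UNIV. h j (x $ j))"
    and "(LINT x|lborel. (\<Prod>j\<in>UNIV. h j ((x::'n rspace) $ j))) = (\<Prod>j\<in>UNIV. LINT t|lborel. h j t)"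
proof -
  interpret P: product_sigma_finite "\<lambda>b::'n rspace. lborel :: real measure" ..
  define idx where "idx = inv_into UNIV (\<lambda>j::'n. axis j (1::real))"
  have inj: "inj (\<lambda>j::'n. axis j (1::real))"
    by (auto simp: inj_on_def axis_eq_axis)
  have idx: "idx (axis j 1) = j" for j
    unfolding idx_def by (rule inv_into_f_f[OF inj]) simp
  have B: "(Basis :: 'n rspace set) = range (\<lambda>j. axis j 1)"
    by (auto simp: Basis_vec_def)
  have coord: "(\<Sum>b\<in>Basis. f b *\<^sub>R b) $ j = f (axis j 1)" for f and j :: 'n
  proof -
    have "(\<Sum>b\<in>Basis. f b *\<^sub>R b) $ j = (\<Sum>b\<in>Basis. f b *\<^sub>R b) \<bullet> axis j 1"
      by (simp add: inner_axis)
    also have "\<dots> = f (axis j 1)"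
      by (subst inner_sum_left_Basis) (auto simp: B)
    finally show ?thesis .
  qed
  have prod: "(\<Prod>j\<in>UNIV. h j ((\<Sum>b\<in>Basis. f b *\<^sub>R b) $ j)) = (\<Prod>b\<in>Basis. h (idx b) (f b))" for f
    unfolding coord unfolding B by (subst prod.reindex[OF inj]) (simp add: idx)
  have prod': "(\<Prod>j\<in>UNIV. integral\<^sup>L lborel (h j)) = (\<Prod>b\<in>(Basis::'n rspace set). integral\<^sup>L lborel (h (idx b)))"
    unfolding B by (subst prod.reindex[OF inj]) (simp add: idx)
  have [measurable]: "h j \<in> borel_measurable borel" for j
    using borel_measurable_integrable[OF h[of j]] by simp
  have m: "(\<lambda>x::'n rspace. \<Prod>j\<in>UNIV. h j (x $ j)) \<in> borel_measurable borel"
    by measurable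
  have m': "(\<lambda>f. \<Sum>b\<in>(Basis::'n rspace set). f b *\<^sub>R b) \<in> (\<Pi>\<^sub>M b\<in>Basis. lborel) \<rightarrow>\<^sub>M borel"
    by measurable
  show "integrable lborel (\<lambda>x::'n rspace. \<Prod>j\<in>UNIV. h j (x $ j))"
    by (subst lborel_eq, subst integrable_distr_eq[OF m' m], subst prod)
       (intro P.product_integrable_prod h finite_Basis)
  show "(LINT x|lborel. (\<Prod>j\<in>UNIV. h j ((x::'n rspace) $ j))) = (\<Prod>j\<in>UNIV. LINT t|lborel. h j t)"
    by (subst lborel_eq, subst integral_distr[OF m' m], subst prod, subst prod')
       (intro P.product_integral_prod h finite_Basis)
qed

text \<open>The exponent 2n makes the weight integrable by comparison with the product of the
  functions 1/(1 + x_j^2). It fixes the number of derivatives spent on every L^1 bound for a Fourier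
  transform of an annular function.\<close>

definition wgt :: "'n::finite rspace \<Rightarrow> real"
  where "wgt x = inverse ((1 + norm x) ^ (2 * CARD('n)))"

lemma wgt_pos: "wgt x > 0"
  unfolding wgt_def by (simp add: add_pos_nonneg)

lemma wgt_measurable [measurable]: "wgt \<in> borel_measurable borel"
  unfolding wgt_def by measurable

lemma integrable_wgt: "integrable lborel (wgt :: 'n::finite rspace \<Rightarrow> real)"
proof (rule Bochner_Integration.integrable_bound)
  have "integrable lborel (\<lambda>x::real. inverse (1 + x\<^sup>2))"
    using integrable_inverse_1_plus_square by (simp add: set_integrable_def einterval_def)
  then show "integrable lborel (\<lambda>x::'n rspace. \<Prod>j\<in>UNIV. inverse (1 + (x $ j)\<^sup>2))"
    by (intro product_integral_vec(1))
  show "AE x in lborel. norm (wgt (x::'n rspace)) \<le> norm (\<Prod>j\<in>UNIV. inverse (1 + (x $ j)\<^sup>2))"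
  proof (intro AE_I2)
    fix x :: "'n rspace"
    have "(\<Prod>j\<in>UNIV. 1 + (x $ j)\<^sup>2) \<le> (\<Prod>j\<in>(UNIV::'n set). (1 + norm x)\<^sup>2)"
    proof (intro prod_mono conjI)
      fix j
      have "(x $ j)\<^sup>2 \<le> (norm x)\<^sup>2"
        using component_le_norm_cart[of x j] by (metis abs_ge_zero power2_abs power_mono)
      then show "1 + (x $ j)\<^sup>2 \<le> (1 + norm x)\<^sup>2"
        by (simp add: power2_sum) (smt (verit) norm_ge_zero)
    qed simp
    also have "\<dots> = (1 + norm x) ^ (2 * CARD('n))" by (simp add: power_mult)
    finally have "inverse ((1 + norm x) ^ (2 * CARD('n))) \<le> inverse (\<Prod>j\<in>UNIV. 1 + (x $ j)\<^sup>2)"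
      by (rule le_imp_inverse_le) (auto intro!: prod_pos add_pos_nonneg)
    then show "norm (wgt x) \<le> norm (\<Prod>j\<in>UNIV. inverse (1 + (x $ j)\<^sup>2))"
      using wgt_pos[of x] by (simp add: wgt_def prod_inversef[unfolded comp_def] abs_prod)
  qed
qed simp

lemma integrable_wgt_bound:
  fixes f :: "'n::finite rspace \<Rightarrow> 'b::{banach,second_countable_topology}"
  assumes "f \<in> borel_measurable borel" "\<And>x. norm (f x) \<le> C * wgt x"
  shows "integrable lborel f" and "(LINT x|lborel. norm (f x)) \<le> C * (LINT x|lborel. wgt (x::'n rspace))"
proof -
  show *: "integrable lborel f"
    by (rule Bochner_Integration.integrable_bound[where f = "\<lambda>x. C * wgt x"])
       (use assms integrable_wgt in \<open>auto intro!: AE_I2 order_trans[OF _ abs_ge_self]\<close>)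
  show "(LINT x|lborel. norm (f x)) \<le> C * (LINT x|lborel. wgt (x::'n rspace))"
    by (subst integral_mult_right_zero[symmetric], rule integral_mono)
       (use * assms integrable_wgt in auto)
qed

lemma rapid_wgt:
  fixes \<phi> :: "'n::finite rspace \<Rightarrow> complex"
  assumes "rapid \<phi>"
  shows "\<exists>C. \<forall>x. norm (\<phi> x) \<le> C * wgt x"
proof -
  obtain C where "\<And>x. (1 + norm x) ^ (2 * CARD('n)) * norm (\<phi> x) \<le> C"
    using assms unfolding rapid_def by metis
  then have "norm (\<phi> x) \<le> C * wgt x" for x
    by (simp add: wgt_def divide_simps add_nonneg_eq_0_iff mult.commute zero_less_power add_pos_nonneg)
  then show ?thesis by blast
qed

lemma smooth_measurable [measurable_dest]: "smooth \<phi> \<Longrightarrow> \<phi> \<in> borel_measurable borel"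
  by (intro borel_measurable_continuous_onI smooth_continuous)

lemma schwartz_integrable: "schwartz \<phi> \<Longrightarrow> integrable lborel \<phi>"
  using rapid_wgt[OF schwartz_rapid] integrable_wgt_bound(1) smooth_measurable schwartz_smooth by metis

text \<open>The integral of a partial derivative is the limit of integrals of difference quotients, all of
  which vanish because Lebesgue measure is invariant under translations.\<close>

lemma integral_pd_eq_0:
  fixes \<phi> :: "'n::finite rspace \<Rightarrow> complex"
  assumes "schwartz \<phi>"
  shows "(LINT x|lborel. pd j \<phi> x) = 0"
proof -
  let ?e = "axis j 1 :: 'n rspace"
  let ?t = "\<lambda>N::nat. inverse (real (Suc N))"
  let ?q = "\<lambda>N x. (\<phi> (x + ?t N *\<^sub>R ?e) - \<phi> x) /\<^sub>R ?t N"
  obtain C where C: "\<And>x. norm (pd j \<phi> x) \<le> C * wgt x"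
    using rapid_wgt[OF schwartz_rapid[OF schwartz_pd[OF assms]]] by blast
  have "C \<ge> 0" using order_trans[OF norm_ge_zero C[of 0]] wgt_pos[of "0::'n rspace"]
    by (simp add: zero_le_mult_iff)
  let ?D = "C * 2 ^ (2 * CARD('n))"
  have hd: "((\<lambda>s. \<phi> (x + s *\<^sub>R ?e)) has_derivative (\<lambda>h. h *\<^sub>R pd j \<phi> (x + s *\<^sub>R ?e))) (at s)" for x s
  proof -
    have "((\<lambda>s. \<phi> (x + s *\<^sub>R ?e)) has_derivative
        (\<lambda>h. frechet_derivative \<phi> (at (x + s *\<^sub>R ?e)) (h *\<^sub>R ?e))) (at s)"
      by (rule has_derivative_compose[where g = \<phi>],
          (rule derivative_eq_intros refl | simp)+,
          rule has_derivative_frechet[OF smooth_differentiable[OF schwartz_smooth[OF assms]]])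
    moreover have "frechet_derivative \<phi> (at y) (h *\<^sub>R ?e) = h *\<^sub>R pd j \<phi> y" for h y
      unfolding pd_def
      using linear_frechet_derivative[OF smooth_differentiable[OF schwartz_smooth[OF assms]], of y]
      by (simp add: linear_scale)
    ultimately show ?thesis by simp
  qed
  \<comment> \<open>A shift of length at most 1 changes \<open>1 + norm x\<close> by a factor of at
    most 2.\<close>
  have w: "wgt (x + s *\<^sub>R ?e) \<le> 2 ^ (2 * CARD('n)) * wgt x" if "s \<in> {0..1}" for x s
  proof -
    have "norm x \<le> norm (x + s *\<^sub>R ?e) + norm (s *\<^sub>R ?e)"
      by (metis add_diff_cancel norm_triangle_ineq4)
    then have "1 + norm x \<le> 2 * (1 + norm (x + s *\<^sub>R ?e))"
    proof -
      have *: "1 + a \<le> 2 * (1 + b)" if "a \<le> b + c" "c \<le> 1" "0 \<le> b" for a b c :: real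
        using that by (simp add: algebra_simps)
      show ?thesis
        by (rule *[OF \<open>norm x \<le> _\<close>]) (use that in simp_all)
    qed

    then have "(1 + norm x) ^ (2 * CARD('n)) \<le> (2 * (1 + norm (x + s *\<^sub>R ?e))) ^ (2 * CARD('n))"
      by (intro power_mono) auto
    then show ?thesis
      unfolding wgt_def power_mult_distrib
      by (simp add: divide_simps add_nonneg_eq_0_iff zero_less_power add_pos_nonneg mult.commute)
  qed
  have lim: "(\<lambda>N. LINT x|lborel. ?q N x) \<longlonglongrightarrow> (LINT x|lborel. pd j \<phi> x)"
  proof (rule integral_dominated_convergence[where w = "\<lambda>x. ?D * wgt x"])
    show "pd j \<phi> \<in> borel_measurable lborel"
      using smooth_measurable[OF schwartz_smooth[OF schwartz_pd[OF assms]], of j] by simp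
    have [measurable]: "\<phi> \<in> borel_measurable borel" 
      by (rule smooth_measurable[OF schwartz_smooth[OF assms]])
    show "?q N \<in> borel_measurable lborel" for N by measurable
    show "integrable lborel (\<lambda>x. ?D * wgt (x::'n rspace))"
      by (intro integrable_mult_right integrable_wgt)
    show "AE x in lborel. (\<lambda>N. ?q N x) \<longlonglongrightarrow> pd j \<phi> x"
    proof (intro AE_I2)
      fix x
      have l1: "((\<lambda>h. norm (\<phi> (x + h *\<^sub>R ?e) - \<phi> x - h *\<^sub>R pd j \<phi> x) / norm h) \<longlongrightarrow> 0) (at 0)"
        using hd[of x 0] by (simp add: has_derivative_at)
      have l2: "norm (\<phi> (x + h *\<^sub>R ?e) - \<phi> x - h *\<^sub>R pd j \<phi> x) / norm h
          = norm ((\<phi> (x + h *\<^sub>R ?e) - \<phi> x) /\<^sub>R h - pd j \<phi> x)" if "h \<noteq> 0" for h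
      proof -
        have "(\<phi> (x + h *\<^sub>R ?e) - \<phi> x) /\<^sub>R h - pd j \<phi> x
            = (\<phi> (x + h *\<^sub>R ?e) - \<phi> x - h *\<^sub>R pd j \<phi> x) /\<^sub>R h"
          using that by (simp add: scaleR_diff_right)
        then show ?thesis by (simp add: divide_inverse mult.commute)
      qed
      have "((\<lambda>h. norm ((\<phi> (x + h *\<^sub>R ?e) - \<phi> x) /\<^sub>R h - pd j \<phi> x)) \<longlongrightarrow> 0) (at 0)"
        by (rule Lim_transform_eventually[OF l1]) (unfold eventually_at_filter, rule always_eventually, intro allI impI, rule l2)
      then have l: "((\<lambda>h. (\<phi> (x + h *\<^sub>R ?e) - \<phi> x) /\<^sub>R h) \<longlongrightarrow> pd j \<phi> x) (at 0)"
        by (rule LIM_zero_cancel[OF tendsto_norm_zero_cancel])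
      have "filterlim ?t (at 0) sequentially"
        by (intro filterlim_atI LIMSEQ_inverse_real_of_nat) auto
      from filterlim_compose[OF l this] show "(\<lambda>N. ?q N x) \<longlonglongrightarrow> pd j \<phi> x" .
    qed
    show "AE x in lborel. norm (?q N x) \<le> ?D * wgt x" for N
    proof (intro AE_I2)
      fix x :: "'n rspace"
      have tN: "0 < ?t N" "?t N \<le> 1" by (auto simp: inverse_le_1_iff)
      \<comment> \<open>The mean value inequality on \<open>{0..1}\<close>, an interval that
        contains every step \<open>?t N\<close>, gives a majorant that does not depend on
        \<open>N\<close>.\<close>
      have "norm (\<phi> (x + ?t N *\<^sub>R ?e) - \<phi> (x + 0 *\<^sub>R ?e)) \<le> (?D * wgt x) * norm (?t N - 0)"
      proof (rule differentiable_bound[where S = "{0..1}" and f = "\<lambda>s. \<phi> (x + s *\<^sub>R ?e)"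
            and f' = "\<lambda>s h. h *\<^sub>R pd j \<phi> (x + s *\<^sub>R ?e)"])
        fix s :: real assume s: "s \<in> {0..1}"
        show "((\<lambda>s. \<phi> (x + s *\<^sub>R ?e)) has_derivative (\<lambda>h. h *\<^sub>R pd j \<phi> (x + s *\<^sub>R ?e))) (at s within {0..1})"
          by (rule has_derivative_at_withinI[OF hd])
        have "norm (pd j \<phi> (x + s *\<^sub>R ?e)) \<le> C * wgt (x + s *\<^sub>R ?e)" by (rule C)
        also have "\<dots> \<le> C * (2 ^ (2 * CARD('n)) * wgt x)"
          by (rule mult_left_mono[OF w[OF s] \<open>C \<ge> 0\<close>])
        finally have "norm (pd j \<phi> (x + s *\<^sub>R ?e)) \<le> ?D * wgt x" by simp
        then have *: "norm (pd j \<phi> (x + s *\<^sub>R ?e)) \<le> ?D * wgt x" .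
        show "onorm (\<lambda>h. h *\<^sub>R pd j \<phi> (x + s *\<^sub>R ?e)) \<le> ?D * wgt x"
        proof (rule onorm_bound)
          show "0 \<le> ?D * wgt x" by (rule order_trans[OF norm_ge_zero *])
          fix h :: real
          show "norm (h *\<^sub>R pd j \<phi> (x + s *\<^sub>R ?e)) \<le> ?D * wgt x * norm h"
            using mult_left_mono[OF *, of "\<bar>h\<bar>"] by (simp only: norm_scaleR real_norm_def abs_ge_zero) (simp only: mult.commute)
        qed
      qed (use tN in auto)
      then show "norm (?q N x) \<le> ?D * wgt x"
        using tN by (simp add: divide_simps mult.commute)
    qed
  qed
  have int: "integrable lborel \<phi>" by (rule schwartz_integrable[OF assms])
  have "(LINT x|lborel. ?q N x) = 0" for N
    by (simp add: integrable_translate integral_translate int)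
  with lim have "(\<lambda>N. 0) \<longlonglongrightarrow> (LINT x|lborel. pd j \<phi> x)" by (simp only:)
  then show ?thesis
    using LIMSEQ_unique tendsto_const by blast
qed

section \<open>The scalar Fourier transform\<close>

text \<open>The scalar transform is taken with respect to \<open>lborel\<close>, where Fubini's
  theorem is available. The coordinates of \<open>fourier\<close> and \<open>inv_fourier\<close> of
  integrable functions reduce to \<open>ft\<close> and \<open>ift\<close>.\<close>

definition ft :: "('n::finite rspace \<Rightarrow> complex) \<Rightarrow> 'n rspace \<Rightarrow> complex"
  where "ft g \<xi> = (LINT x|lborel. exp (- \<i> * complex_of_real (x \<bullet> \<xi>)) * g x)"

definition ift :: "('n::finite rspace \<Rightarrow> complex) \<Rightarrow> 'n rspace \<Rightarrow> complex"
  where "ift g x = complex_of_real (1 / (2 * pi) ^ CARD('n)) *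
           (LINT \<xi>|lborel. exp (\<i> * complex_of_real (x \<bullet> \<xi>)) * g \<xi>)"

lemma norm_exp_minus_i [simp]: "norm (exp (- \<i> * complex_of_real t)) = 1"
  by simp

lemma ft_integrand_integrable:
  assumes "integrable lborel g"
  shows "integrable lborel (\<lambda>x. exp (- \<i> * complex_of_real (x \<bullet> \<xi>)) * g x)"
  by (rule Bochner_Integration.integrable_bound[OF assms])
     (use borel_measurable_integrable[OF assms] in \<open>auto simp: norm_mult\<close>)

lemma ift_eq_ft: "ift (g::'n::finite rspace \<Rightarrow> complex) x = complex_of_real (1 / (2 * pi) ^ CARD('n)) * ft g (- x)"
  by (simp add: ift_def ft_def inner_commute)

lemma ft_norm_le:
  assumes "integrable lborel g"
  shows "norm (ft g \<xi>) \<le> (LINT x|lborel. norm (g x))"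
proof -
  have "norm (ft g \<xi>) \<le> (LINT x|lborel. norm (exp (- \<i> * complex_of_real (x \<bullet> \<xi>)) * g x))"
    unfolding ft_def by (rule integral_norm_bound)
  then show ?thesis by (simp add: norm_mult)
qed

lemma ft_continuous:
  assumes "integrable lborel g"
  shows "continuous_on UNIV (ft g)"
proof (rule continuous_on_sequentiallyI)
  fix u :: "nat \<Rightarrow> 'a rspace" and a
  assume u: "u \<longlonglongrightarrow> a"
  show "(\<lambda>n. ft g (u n)) \<longlonglongrightarrow> ft g a"
    unfolding ft_def
    by (rule integral_dominated_convergence[where w = "\<lambda>x. norm (g x)"])
       (use assms borel_measurable_integrable[OF assms] u in
        \<open>auto simp: norm_mult intro!: tendsto_intros AE_I2\<close>)
qed

lemma ft_measurable [measurable]: "integrable lborel g \<Longrightarrow> ft g \<in> borel_measurable borel"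
  by (intro borel_measurable_continuous_onI ft_continuous)

lemma ft_add:
  assumes "integrable lborel g" "integrable lborel h"
  shows "ft (\<lambda>x. g x + h x) \<xi> = ft g \<xi> + ft h \<xi>"
  using ft_integrand_integrable[OF assms(1), of \<xi>] ft_integrand_integrable[OF assms(2), of \<xi>]
  by (simp add: ft_def distrib_left)

lemma ft_cmult: "ft (\<lambda>x. c * g x) \<xi> = c * ft g \<xi>"
proof -
  have "(\<lambda>x. exp (- \<i> * complex_of_real (x \<bullet> \<xi>)) * (c * g x))
      = (\<lambda>x. c * (exp (- \<i> * complex_of_real (x \<bullet> \<xi>)) * g x))"
    by (simp add: mult_ac)
  then show ?thesis
    unfolding ft_def by (simp only: integral_mult_right_zero)
qed

lemma ft_diff:
  assumes "integrable lborel g" "integrable lborel h"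
  shows "ft (\<lambda>x. g x - h x) \<xi> = ft g \<xi> - ft h \<xi>"
  using ft_integrand_integrable[OF assms(1), of \<xi>] ft_integrand_integrable[OF assms(2), of \<xi>]
  by (simp add: ft_def right_diff_distrib)

lemma has_derivative_character:
  "((\<lambda>x. exp (- \<i> * complex_of_real (x \<bullet> \<xi>))) has_derivative
     (\<lambda>h. (- \<i> * complex_of_real (h \<bullet> \<xi>)) * exp (- \<i> * complex_of_real (x \<bullet> \<xi>)))) (at x)"
proof -
  have "((\<lambda>x. - \<i> * complex_of_real (x \<bullet> \<xi>)) has_derivative (\<lambda>h. - \<i> * complex_of_real (h \<bullet> \<xi>))) (at x)"
    by (intro has_derivative_mult_right bounded_linear.has_derivative[OF bounded_linear_of_real]
        has_derivative_inner_left has_derivative_ident)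
  from has_derivative_compose[OF this DERIV_exp[unfolded has_field_derivative_def]]
  show ?thesis by (simp add: mult.commute)
qed

lemma slow_character: "slow (\<lambda>x::'n::finite rspace. exp (- \<i> * complex_of_real (x \<bullet> \<xi>)))"
proof (rule fsums_slow)
  let ?S = "range (\<lambda>c (x::'n rspace). c * exp (- \<i> * complex_of_real (x \<bullet> \<xi>)))"
  have mem: "(\<lambda>x. c * exp (- \<i> * complex_of_real (x \<bullet> \<xi>))) \<in> ?S" for c by blast
  have d: "(\<lambda>x. c * exp (- \<i> * complex_of_real (x \<bullet> \<xi>))) differentiable at x" for c x
    using has_derivative_mult_right[OF has_derivative_character] unfolding differentiable_def by blast
  have p: "pd j (\<lambda>x. c * exp (- \<i> * complex_of_real (x \<bullet> \<xi>)))
      = (\<lambda>x. (c * (- \<i> * complex_of_real (\<xi> $ j))) * exp (- \<i> * complex_of_real (x \<bullet> \<xi>)))" for c and j :: 'n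
    by (rule ext, subst pd_eqI[OF has_derivative_mult_right[OF has_derivative_character]])
       (simp add: inner_axis' )
  show pS: "pd j s \<in> fsums ?S" if "s \<in> ?S" for s j
    using that by (elim rangeE) (simp only: p, intro fsums_base mem)
  show "smooth s \<and> poly_bdd s" if s: "s \<in> ?S" for s
  proof
    show "smooth s"
      by (rule fsums_partials(2)[of ?S, OF _ pS fsums_base[OF s]]) (use d in blast)
    show "poly_bdd s"
      using s slow_poly_bdd[OF slow_const] unfolding poly_bdd_def
      by (elim rangeE) (auto simp: norm_mult)
  qed
  show "(\<lambda>x. exp (- \<i> * complex_of_real (x \<bullet> \<xi>))) \<in> fsums ?S"
    by (rule fsums_base) (use mem[of 1] in simp)
qed

text \<open>Integration by parts: the product of the character and \<phi> is a Schwartz function, so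
  the integral of its derivative vanishes.\<close>

lemma ft_pd:
  assumes "schwartz \<phi>"
  shows "ft (pd j \<phi>) \<xi> = (\<i> * complex_of_real (\<xi> $ j)) * ft \<phi> \<xi>"
proof -
  let ?e = "\<lambda>x. exp (- \<i> * complex_of_real (x \<bullet> \<xi>))"
  have s: "schwartz (\<lambda>x. ?e x * \<phi> x)"
    using schwartz_mult[OF assms slow_character] by (simp add: mult.commute)
  have "pd j (\<lambda>x. ?e x * \<phi> x) x = ?e x * pd j \<phi> x + (- (\<i> * complex_of_real (\<xi> $ j))) * (?e x * \<phi> x)" for x
  proof -
    have "pd j ?e x = - (\<i> * complex_of_real (\<xi> $ j)) * ?e x"
      by (subst pd_eqI[OF has_derivative_character]) (simp add: inner_axis')
    moreover have "pd j (\<lambda>x. ?e x * \<phi> x) x = ?e x * pd j \<phi> x + pd j ?e x * \<phi> x"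
      by (intro pd_mult smooth_differentiable schwartz_smooth assms slow_smooth slow_character)
    ultimately show ?thesis by simp
  qed
  then have "pd j (\<lambda>x. ?e x * \<phi> x) = (\<lambda>x. ?e x * pd j \<phi> x + (- (\<i> * complex_of_real (\<xi> $ j))) * (?e x * \<phi> x))"
    by (rule ext)
  with integral_pd_eq_0[OF s, of j]
  have "0 = (LINT x|lborel. ?e x * pd j \<phi> x + (- (\<i> * complex_of_real (\<xi> $ j))) * (?e x * \<phi> x))"
    by (simp only:)
  also have "\<dots> = (LINT x|lborel. ?e x * pd j \<phi> x) + (LINT x|lborel. (- (\<i> * complex_of_real (\<xi> $ j))) * (?e x * \<phi> x))"
    by (intro Bochner_Integration.integral_add integrable_mult_right ft_integrand_integrable
        schwartz_integrable schwartz_pd assms)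
  also have "\<dots> = ft (pd j \<phi>) \<xi> - (\<i> * complex_of_real (\<xi> $ j)) * ft \<phi> \<xi>"
    unfolding integral_mult_right_zero ft_def by simp
  finally show ?thesis by simp
qed

lemma ft_partials_replicate:
  assumes "schwartz \<phi>"
  shows "ft (partials (replicate m j) \<phi>) \<xi> = (\<i> * complex_of_real (\<xi> $ j)) ^ m * ft \<phi> \<xi>"
  using assms
proof (induction m arbitrary: \<phi>)
  case (Suc m)
  have "replicate (Suc m) j = replicate m j @ [j]" by (simp add: replicate_append_same)
  then show ?case
    using Suc.IH[OF schwartz_pd[OF Suc.prems]] Suc.prems by (simp add: partials_snoc_pd ft_pd del: replicate_Suc)
qed simp

lemma schwartz_partials: "schwartz \<phi> \<Longrightarrow> schwartz (partials js \<phi>)"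
  by (induction js) (auto simp: partials_Cons_pd schwartz_pd simp del: partials.simps(2))

lemma has_derivative_quadratic:
  fixes f :: "'a::real_normed_vector \<Rightarrow> 'b::real_normed_vector"
  assumes "bounded_linear D" and b: "\<And>h. norm (f (x + h) - f x - D h) \<le> K * (norm h)\<^sup>2"
  shows "(f has_derivative D) (at x)"
  unfolding has_derivative_at
proof (intro conjI assms(1))
  show "(\<lambda>h. norm (f (x + h) - f x - D h) / norm h) \<midarrow>0\<rightarrow> 0"
  proof (rule tendsto_sandwich[of "\<lambda>h. 0" _ _ "\<lambda>h. K * norm h"])
    show "\<forall>\<^sub>F h in at 0. norm (f (x + h) - f x - D h) / norm h \<le> K * norm h"
      using b by (intro always_eventually allI) (simp add: divide_simps power2_eq_square mult_ac)
    show "(\<lambda>h. K * norm h) \<midarrow>0\<rightarrow> 0"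
      by (auto intro!: tendsto_eq_intros)
  qed auto
qed

text \<open>Differentiation under the integral sign with an explicit remainder. As exp(-it) differs
  from 1 - it by at most t^2/2, the error is at most |h|^2 times the second absolute moment of
  \<phi>.\<close>

lemma ft_has_derivative:
  assumes "schwartz \<phi>"
  shows "(ft \<phi> has_derivative
    (\<lambda>h. \<Sum>j\<in>UNIV. complex_of_real (h $ j) * ft (\<lambda>x. - \<i> * (\<phi> x * complex_of_real (x $ j))) \<xi>)) (at \<xi>)"
proof (rule has_derivative_quadratic)
  let ?D = "\<lambda>h. \<Sum>j\<in>UNIV. complex_of_real (h $ j) * ft (\<lambda>x. - \<i> * (\<phi> x * complex_of_real (x $ j))) \<xi>"
  show "bounded_linear ?D"
    by (intro linear_conv_bounded_linear[THEN iffD1] linearI)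
       (simp_all add: sum.distrib sum_distrib_left algebra_simps scaleR_conv_of_real[of _ "_::complex"])
  fix h
  have m[measurable]: "\<phi> \<in> borel_measurable borel"
    by (rule smooth_measurable[OF schwartz_smooth[OF assms]])
  \<comment> \<open>The two powers beyond 2n pay for the factor |x|^2 in the remainder.\<close>
  obtain C where C: "\<And>x. (1 + norm x) ^ (2 * CARD('a) + 2) * norm (\<phi> x) \<le> C"
    using schwartz_rapid[OF assms] unfolding rapid_def by metis
  have w: "norm (complex_of_real ((norm x)\<^sup>2) * \<phi> x) \<le> C * wgt x" for x
  proof -
    have "(norm x)\<^sup>2 * norm (\<phi> x) \<le> (1 + norm x)\<^sup>2 * norm (\<phi> x)"
      by (intro mult_right_mono power_mono) auto
    also have "\<dots> \<le> C * wgt x"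
      using C[of x] unfolding wgt_def power_add
      by (simp add: divide_simps add_nonneg_eq_0_iff zero_less_power add_pos_nonneg mult_ac)
    finally show ?thesis by (simp add: norm_mult norm_power)
  qed
  have int2: "integrable lborel (\<lambda>x. complex_of_real ((norm x)\<^sup>2) * \<phi> x)"
    by (rule integrable_wgt_bound(1)[OF _ w]) measurable
  let ?e = "\<lambda>\<xi> x. exp (- \<i> * complex_of_real (x \<bullet> \<xi>))"
  have ij: "integrable lborel (\<lambda>x. - \<i> * (\<phi> x * complex_of_real (x $ j)))" for j
    by (intro schwartz_integrable schwartz_cmult schwartz_mult assms slow_coord)
  have int: "integrable lborel (\<lambda>x. ?e \<xi> x * \<phi> x)" for \<xi>
    by (intro ft_integrand_integrable schwartz_integrable assms)
  have D: "?D h = (LINT x|lborel. ?e \<xi> x * ((- \<i> * complex_of_real (x \<bullet> h)) * \<phi> x))"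
  proof -
    have "?D h = (LINT x|lborel. (\<Sum>j\<in>UNIV. complex_of_real (h $ j) * (?e \<xi> x * (- \<i> * (\<phi> x * complex_of_real (x $ j))))))"
      unfolding ft_def
      by (subst Bochner_Integration.integral_sum)
         (intro integrable_mult_right ft_integrand_integrable ij, simp only: integral_mult_right_zero)
    also have "(\<lambda>x. \<Sum>j\<in>UNIV. complex_of_real (h $ j) * (?e \<xi> x * (- \<i> * (\<phi> x * complex_of_real (x $ j)))))
        = (\<lambda>x. ?e \<xi> x * ((- \<i> * complex_of_real (x \<bullet> h)) * \<phi> x))"
      by (rule ext) (simp add: inner_vec_def sum_distrib_left sum_distrib_right mult_ac sum_negf)
    finally show ?thesis .
  qed
  have intD: "integrable lborel (\<lambda>x. ?e \<xi> x * ((- \<i> * complex_of_real (x \<bullet> h)) * \<phi> x))"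
  proof -
    have "(\<lambda>x. ?e \<xi> x * ((- \<i> * complex_of_real (x \<bullet> h)) * \<phi> x))
       = (\<lambda>x. \<Sum>j\<in>UNIV. complex_of_real (h $ j) * (?e \<xi> x * (- \<i> * (\<phi> x * complex_of_real (x $ j)))))"
      by (rule ext) (simp add: inner_vec_def sum_distrib_left sum_distrib_right mult_ac sum_negf)
    then show ?thesis
      by (simp only:) (intro Bochner_Integration.integrable_sum integrable_mult_right ft_integrand_integrable ij)
  qed
  have "ft \<phi> (\<xi> + h) - ft \<phi> \<xi> - ?D h
     = (LINT x|lborel. ?e (\<xi> + h) x * \<phi> x - ?e \<xi> x * \<phi> x - ?e \<xi> x * ((- \<i> * complex_of_real (x \<bullet> h)) * \<phi> x))"
    unfolding D unfolding ft_def
    by (subst Bochner_Integration.integral_diff, intro Bochner_Integration.integrable_diff int, rule intD,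
        subst Bochner_Integration.integral_diff, rule int, rule int, rule refl)
  also have "norm \<dots> \<le> (LINT x|lborel. (norm h)\<^sup>2 * norm (complex_of_real ((norm x)\<^sup>2) * \<phi> x))"
  proof (rule Bochner_Integration.integral_norm_bound_integral)
    show "integrable lborel (\<lambda>x. (norm h)\<^sup>2 * norm (complex_of_real ((norm x)\<^sup>2) * \<phi> x))"
      by (intro integrable_mult_right integrable_norm int2)
    show "integrable lborel (\<lambda>x. ?e (\<xi> + h) x * \<phi> x - ?e \<xi> x * \<phi> x - ?e \<xi> x * ((- \<i> * complex_of_real (x \<bullet> h)) * \<phi> x))"
      by (intro Bochner_Integration.integrable_diff int intD)
    fix x
    have "?e (\<xi> + h) x = ?e \<xi> x * iexp (- (x \<bullet> h))"
      by (simp add: inner_add_right exp_diff exp_minus field_simps flip: exp_add)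
    then have "?e (\<xi> + h) x * \<phi> x - ?e \<xi> x * \<phi> x - ?e \<xi> x * ((- \<i> * complex_of_real (x \<bullet> h)) * \<phi> x)
       = ?e \<xi> x * (iexp (- (x \<bullet> h)) - (1 + \<i> * complex_of_real (- (x \<bullet> h)))) * \<phi> x"
      by (simp add: algebra_simps)
    also have "norm \<dots> = norm (iexp (- (x \<bullet> h)) - (1 + \<i> * complex_of_real (- (x \<bullet> h)))) * norm (\<phi> x)"
      by (simp only: norm_mult norm_exp_minus_i mult_1_left)
    also have "\<dots> \<le> (norm x * norm h)\<^sup>2 * norm (\<phi> x)"
    proof (rule mult_right_mono)
      have "norm (iexp (- (x \<bullet> h)) - (1 + \<i> * complex_of_real (- (x \<bullet> h)))) \<le> \<bar>x \<bullet> h\<bar>\<^sup>2 / 2"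
        using iexp_approx1[of "- (x \<bullet> h)" 1] by (simp add: power2_eq_square)
      also have "\<dots> \<le> \<bar>x \<bullet> h\<bar>\<^sup>2" by simp
      also have "\<dots> \<le> (norm x * norm h)\<^sup>2"
        by (intro power_mono Cauchy_Schwarz_ineq2) auto
      finally show "norm (iexp (- (x \<bullet> h)) - (1 + \<i> * complex_of_real (- (x \<bullet> h)))) \<le> (norm x * norm h)\<^sup>2" .
    qed simp
    finally show "norm (?e (\<xi> + h) x * \<phi> x - ?e \<xi> x * \<phi> x - ?e \<xi> x * ((- \<i> * complex_of_real (x \<bullet> h)) * \<phi> x))
       \<le> (norm h)\<^sup>2 * norm (complex_of_real ((norm x)\<^sup>2) * \<phi> x)"
      by (simp add: norm_mult norm_power power_mult_distrib mult_ac)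
  qed
  also have "\<dots> = (LINT x|lborel. norm (complex_of_real ((norm x)\<^sup>2) * \<phi> x)) * (norm h)\<^sup>2"
    unfolding integral_mult_right_zero by (rule mult.commute)
  finally show "norm (ft \<phi> (\<xi> + h) - ft \<phi> \<xi> - ?D h)
      \<le> (LINT x|lborel. norm (complex_of_real ((norm x)\<^sup>2) * \<phi> x)) * (norm h)\<^sup>2" .
qed

lemma pd_ft:
  assumes "schwartz \<phi>"
  shows "pd j (ft \<phi>) = ft (\<lambda>x. - \<i> * (\<phi> x * complex_of_real (x $ j)))"
proof
  fix \<xi>
  have "(\<Sum>i\<in>UNIV. complex_of_real (axis j 1 $ i) * ft (\<lambda>x. - \<i> * (\<phi> x * complex_of_real (x $ i))) \<xi>)
    = (\<Sum>i\<in>UNIV. if i = j then ft (\<lambda>x. - \<i> * (\<phi> x * complex_of_real (x $ i))) \<xi> else 0)"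
    by (rule sum.cong) (auto simp: axis_def)
  then show "pd j (ft \<phi>) \<xi> = ft (\<lambda>x. - \<i> * (\<phi> x * complex_of_real (x $ j))) \<xi>"
    by (subst pd_eqI[OF ft_has_derivative[OF assms]]) simp
qed

text \<open>1 + |x| is at most 1 + n times the largest of 1 and the |x_j|, and the power of that
  maximum is one of the summands. With this form, decay of a Fourier transform needs only the pure
  derivatives \<open>replicate m j\<close> and no mixed ones.\<close>

lemma one_plus_norm_power_le:
  fixes x :: "'n::finite rspace"
  shows "(1 + norm x) ^ m \<le> (1 + real CARD('n)) ^ m * (1 + (\<Sum>j\<in>UNIV. \<bar>x $ j\<bar> ^ m))"
proof -
  define M where "M = Max (insert 1 (range (\<lambda>j. \<bar>x $ j\<bar>)))"
  have M1: "M \<ge> 1" and Mj: "\<bar>x $ j\<bar> \<le> M" for j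
    unfolding M_def by (auto intro!: Max_ge simp del: Max_insert)
  have "1 + norm x \<le> 1 + (\<Sum>j\<in>UNIV. \<bar>x $ j\<bar>)" using norm_le_l1_cart by auto
  also have "\<dots> \<le> M + (\<Sum>j\<in>(UNIV::'n set). M)" by (intro add_mono sum_mono M1 Mj)
  also have "\<dots> = (1 + real CARD('n)) * M" by (simp add: algebra_simps)
  finally have "(1 + norm x) ^ m \<le> ((1 + real CARD('n)) * M) ^ m" by (intro power_mono) auto
  also have "\<dots> = (1 + real CARD('n)) ^ m * M ^ m" by (rule power_mult_distrib)
  also have "M ^ m \<le> 1 + (\<Sum>j\<in>UNIV. \<bar>x $ j\<bar> ^ m)"
  proof -
    have "M \<in> insert 1 (range (\<lambda>j. \<bar>x $ j\<bar>))" unfolding M_def by (rule Max_in) auto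
    then show ?thesis
    proof
      assume "M = 1"
      then show ?thesis by (simp add: sum_nonneg)
    next
      assume "M \<in> range (\<lambda>j. \<bar>x $ j\<bar>)"
      then obtain j where "M = \<bar>x $ j\<bar>" by blast
      then have "M ^ m \<le> (\<Sum>j\<in>UNIV. \<bar>x $ j\<bar> ^ m)"
        using member_le_sum[of j UNIV "\<lambda>j. \<bar>x $ j\<bar> ^ m"] by simp
      then show ?thesis by simp
    qed
  qed
  finally show ?thesis by (simp add: mult_left_mono)
qed

lemma ft_weighted_bound:
  fixes \<phi> :: "'n::finite rspace \<Rightarrow> complex"
  assumes "schwartz \<phi>"
  shows "(1 + norm \<xi>) ^ m * norm (ft \<phi> \<xi>) \<le> (1 + real CARD('n)) ^ m *
    ((LINT x|lborel. norm (\<phi> x)) + (\<Sum>j\<in>UNIV. LINT x|lborel. norm (partials (replicate m j) \<phi> x)))"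
proof -
  have 1: "\<bar>\<xi> $ j\<bar> ^ m * norm (ft \<phi> \<xi>) \<le> (LINT x|lborel. norm (partials (replicate m j) \<phi> x))" for j
    using ft_norm_le[OF schwartz_integrable[OF schwartz_partials[OF assms, of "replicate m j"]], of \<xi>]
    by (simp add: ft_partials_replicate[OF assms] norm_mult norm_power)
  have "(1 + norm \<xi>) ^ m * norm (ft \<phi> \<xi>)
     \<le> ((1 + real CARD('n)) ^ m * (1 + (\<Sum>j\<in>UNIV. \<bar>\<xi> $ j\<bar> ^ m))) * norm (ft \<phi> \<xi>)"
    by (intro mult_right_mono one_plus_norm_power_le) auto
  also have "\<dots> = (1 + real CARD('n)) ^ m * (norm (ft \<phi> \<xi>) + (\<Sum>j\<in>UNIV. \<bar>\<xi> $ j\<bar> ^ m * norm (ft \<phi> \<xi>)))"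
    by (simp add: algebra_simps sum_distrib_left sum_distrib_right)
  also have "\<dots> \<le> (1 + real CARD('n)) ^ m *
    ((LINT x|lborel. norm (\<phi> x)) + (\<Sum>j\<in>UNIV. LINT x|lborel. norm (partials (replicate m j) \<phi> x)))"
    by (intro mult_left_mono add_mono sum_mono 1 ft_norm_le schwartz_integrable assms) auto
  finally show ?thesis .
qed

lemma ft_schwartz:
  assumes "schwartz \<phi>"
  shows "schwartz (ft \<phi>)"
proof -
  let ?S = "ft ` Collect schwartz"
  have d: "s differentiable at x" if "s \<in> ?S" for s x
    using that ft_has_derivative unfolding differentiable_def by blast
  have p: "pd j s \<in> fsums ?S" if "s \<in> ?S" for s j
    using that
    by (elim imageE) (simp only: pd_ft mem_Collect_eq, intro fsums_base imageI CollectI schwartz_cmult schwartz_mult slow_coord)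
  have r: "rapid s" if "s \<in> fsums ?S" for s
    using that
  proof induction
    case (fsums_base s)
    then show ?case unfolding rapid_def using ft_weighted_bound by blast
  qed (rule rapid_add)
  have m: "ft \<phi> \<in> fsums ?S" using assms by (intro fsums_base) simp
  then show ?thesis
    unfolding schwartz_iff using fsums_partials[of ?S, OF d p m] r by blast
qed

lemma schwartz_uminus_arg:
  fixes \<phi> :: "'n::finite rspace \<Rightarrow> complex"
  assumes "schwartz \<phi>"
  shows "schwartz (\<lambda>x. \<phi> (- x))"
proof -
  let ?S = "(\<lambda>\<phi> x. \<phi> (- x)) ` {\<phi> :: 'n rspace \<Rightarrow> complex. schwartz \<phi>}"
  have h: "((\<lambda>x. \<phi> (- x)) has_derivative (\<lambda>h. frechet_derivative \<phi> (at (- x)) (- h))) (at x)"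
    if "schwartz \<phi>" for \<phi> :: "'n rspace \<Rightarrow> complex" and x
    by (rule has_derivative_compose[where g = \<phi>], (rule derivative_intros)+,
        rule has_derivative_frechet[OF smooth_differentiable[OF schwartz_smooth[OF that]]])
  have p': "pd j (\<lambda>x. \<phi> (- x)) = (\<lambda>x. - 1 * pd j \<phi> (- x))" if "schwartz \<phi>" for \<phi> :: "'n rspace \<Rightarrow> complex" and j
    by (rule ext, subst pd_eqI[OF h[OF that]])
       (use linear_frechet_derivative[OF smooth_differentiable[OF schwartz_smooth[OF that]]] in
         \<open>simp add: pd_def linear_neg\<close>)
  have d: "s differentiable at x" if "s \<in> ?S" for s x
    using that h unfolding differentiable_def by blast
  have p: "pd j s \<in> fsums ?S" if "s \<in> ?S" for s j
  proof -
    from that obtain \<phi> where s: "s = (\<lambda>x. \<phi> (- x))" "schwartz \<phi>" by blast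
    have "pd j s = (\<lambda>x. (\<lambda>y. - 1 * pd j \<phi> y) (- x))" unfolding s(1) p'[OF s(2)] ..
    also have "\<dots> \<in> fsums ?S"
      by (intro fsums_base imageI CollectI schwartz_cmult schwartz_pd s)
    finally show ?thesis .
  qed
  have r: "rapid s" if "s \<in> fsums ?S" for s
    using that
  proof induction
    case (fsums_base s)
    then obtain \<phi> where s: "s = (\<lambda>x. \<phi> (- x))" "schwartz \<phi>" by blast
    show ?case using schwartz_rapid[OF s(2)] unfolding s(1) rapid_def by (metis norm_minus_cancel)
  qed (rule rapid_add)
  have m: "(\<lambda>x. \<phi> (- x)) \<in> fsums ?S" using assms by (intro fsums_base) blast
  then show ?thesis
    unfolding schwartz_iff using fsums_partials[of ?S, OF d p m] r by blast
qed

lemma ift_schwartz: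
  assumes "schwartz \<phi>"
  shows "schwartz (ift \<phi>)"
  unfolding ift_eq_ft[abs_def] by (intro schwartz_cmult schwartz_uminus_arg ft_schwartz assms)

section \<open>Fourier inversion\<close>

text \<open>Read off from the characteristic function of the standard normal distribution, whose
  density differs from the Gaussian by the factor sqrt(2 pi).\<close>

lemma gaussian_integral_real:
  "integrable lborel (\<lambda>t. iexp (x * t) * complex_of_real (exp (- t\<^sup>2 / 2)))"
  "(LINT t|lborel. iexp (x * t) * complex_of_real (exp (- t\<^sup>2 / 2)))
     = complex_of_real (sqrt (2 * pi) * exp (- x\<^sup>2 / 2))"
proof -
  have e: "exp (- t\<^sup>2 / 2) = sqrt (2 * pi) * std_normal_density t" for t
    by (simp add: std_normal_density_def)
  have i0: "integrable lborel (\<lambda>t::real. exp (- t\<^sup>2 / 2))"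
    unfolding e using integrable_std_normal_moment[of 0] by (intro integrable_mult_right) simp
  show "integrable lborel (\<lambda>t. iexp (x * t) * complex_of_real (exp (- t\<^sup>2 / 2)))"
    by (rule Bochner_Integration.integrable_bound[OF i0]) (auto simp: norm_mult)
  have "complex_of_real (exp (- x\<^sup>2 / 2)) = char std_normal_distribution x"
    by (simp add: char_std_normal_distribution)
  also have "\<dots> = (LINT t|lborel. std_normal_density t *\<^sub>R iexp (x * t))"
    unfolding char_def by (subst integral_density) auto
  also have "complex_of_real (sqrt (2 * pi)) * \<dots> = (LINT t|lborel. complex_of_real (sqrt (2 * pi)) * (std_normal_density t *\<^sub>R iexp (x * t)))"
    by (rule integral_mult_right_zero[symmetric])
  also have "\<dots> = (LINT t|lborel. iexp (x * t) * complex_of_real (exp (- t\<^sup>2 / 2)))"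
    by (rule Bochner_Integration.integral_cong, rule refl)
       (simp only: e of_real_mult scaleR_conv_of_real mult_ac)
  finally show "(LINT t|lborel. iexp (x * t) * complex_of_real (exp (- t\<^sup>2 / 2)))
     = complex_of_real (sqrt (2 * pi) * exp (- x\<^sup>2 / 2))" by simp
qed

definition gauss :: "'n::finite rspace \<Rightarrow> real"
  where "gauss x = exp (- (x \<bullet> x) / 2)"

lemma gauss_measurable [measurable]: "gauss \<in> borel_measurable borel"
  unfolding gauss_def by measurable

lemma gaussian_integral_vec:
  fixes x :: "'n::finite rspace"
  shows "integrable lborel (\<lambda>\<xi>. exp (\<i> * complex_of_real (x \<bullet> \<xi>)) * complex_of_real (gauss \<xi>))"
    and "(LINT \<xi>|lborel. exp (\<i> * complex_of_real (x \<bullet> \<xi>)) * complex_of_real (gauss \<xi>))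
       = complex_of_real (sqrt (2 * pi) ^ CARD('n) * gauss x)"
proof -
  have gp: "gauss y = (\<Prod>j\<in>UNIV. exp (- (y $ j)\<^sup>2 / 2))" for y :: "'n rspace"
  proof -
    have "- (y \<bullet> y) / 2 = (\<Sum>j\<in>UNIV. - (y $ j)\<^sup>2 / 2)"
      by (simp add: inner_vec_def power2_eq_square sum_negf sum_divide_distrib)
    then show ?thesis by (simp add: gauss_def exp_sum)
  qed
  let ?h = "\<lambda>j t. iexp (x $ j * t) * complex_of_real (exp (- t\<^sup>2 / 2))"
  have p: "(\<lambda>\<xi>::'n rspace. exp (\<i> * complex_of_real (x \<bullet> \<xi>)) * complex_of_real (gauss \<xi>))
    = (\<lambda>\<xi>. \<Prod>j\<in>UNIV. ?h j (\<xi> $ j))"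
  proof
    fix \<xi> :: "'n rspace"
    have "exp (\<i> * complex_of_real (x \<bullet> \<xi>)) = (\<Prod>j\<in>UNIV. iexp (x $ j * \<xi> $ j))"
      by (simp add: inner_vec_def sum_distrib_left exp_sum)
    then show "exp (\<i> * complex_of_real (x \<bullet> \<xi>)) * complex_of_real (gauss \<xi>) = (\<Prod>j\<in>UNIV. ?h j (\<xi> $ j))"
      by (simp add: prod.distrib gp)
  qed
  show "integrable lborel (\<lambda>\<xi>. exp (\<i> * complex_of_real (x \<bullet> \<xi>)) * complex_of_real (gauss \<xi>))"
    unfolding p by (intro product_integral_vec(1) gaussian_integral_real)
  have "(LINT \<xi>|lborel. exp (\<i> * complex_of_real (x \<bullet> \<xi>)) * complex_of_real (gauss \<xi>))
     = (\<Prod>j\<in>UNIV. complex_of_real (sqrt (2 * pi) * exp (- (x $ j)\<^sup>2 / 2)))"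
    unfolding p by (subst product_integral_vec(2)) (intro gaussian_integral_real, simp only: gaussian_integral_real(2))
  also have "\<dots> = complex_of_real (sqrt (2 * pi) ^ CARD('n) * (\<Prod>j\<in>UNIV. exp (- (x $ j)\<^sup>2 / 2)))"
    by (simp add: prod.distrib)
  also have "(\<Prod>j\<in>UNIV. exp (- (x $ j)\<^sup>2 / 2)) = gauss x"
    by (rule gp[symmetric])
  finally show "(LINT \<xi>|lborel. exp (\<i> * complex_of_real (x \<bullet> \<xi>)) * complex_of_real (gauss \<xi>))
       = complex_of_real (sqrt (2 * pi) ^ CARD('n) * gauss x)" .
qed

lemma integrable_gauss: "integrable lborel (gauss :: 'n::finite rspace \<Rightarrow> real)"
proof -
  have "integrable lborel (\<lambda>\<xi>::'n rspace. complex_of_real (gauss \<xi>))"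
    using gaussian_integral_vec(1)[of "0::'n rspace"] by simp
  then show ?thesis
    using complex_of_real_integrable_eq by blast
qed

lemma fubini_dominated:
  fixes f :: "'a::euclidean_space \<Rightarrow> 'b::euclidean_space \<Rightarrow> 'c::{banach,second_countable_topology}"
  assumes m: "case_prod f \<in> borel_measurable (borel \<Otimes>\<^sub>M borel)"
    and a: "integrable lborel a" and b: "integrable lborel b"
    and le: "\<And>x y. norm (f x y) \<le> a x * b y"
  shows "(LINT x|lborel. LINT y|lborel. f x y) = (LINT y|lborel. LINT x|lborel. f x y)"
proof -
  have m'[measurable]: "case_prod f \<in> borel_measurable (lborel \<Otimes>\<^sub>M lborel)"
    using m by (simp cong: measurable_cong_sets sets_pair_measure_cong)
  have i: "integrable lborel (f x)" for x
    by (rule Bochner_Integration.integrable_bound[where f = "\<lambda>y. a x * b y"])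
       (use b le in \<open>auto intro: order_trans[OF le abs_ge_self]\<close>)
  have "integrable (lborel \<Otimes>\<^sub>M lborel) (case_prod f)"
  proof (rule lborel_pair.Fubini_integrable)
    show "integrable lborel (\<lambda>x. LINT y|lborel. norm (case (x, y) of (x, xa) \<Rightarrow> f x xa))"
    proof (rule Bochner_Integration.integrable_bound[where f = "\<lambda>x. a x * (LINT y|lborel. b y)"])
      show "AE x in lborel. norm (LINT y|lborel. norm (case (x, y) of (x, xa) \<Rightarrow> f x xa))
          \<le> norm (a x * (LINT y|lborel. b y))"
      proof (intro AE_I2)
        fix x
        have "(LINT y|lborel. norm (f x y)) \<le> (LINT y|lborel. a x * b y)"
          by (rule integral_mono) (use i b le in auto)
        then show "norm (LINT y|lborel. norm (case (x, y) of (x, xa) \<Rightarrow> f x xa)) \<le> norm (a x * (LINT y|lborel. b y))"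
          by (simp add: integral_nonneg_AE)
      qed
      next
      have "(\<lambda>(x, y). norm (f x y)) \<in> borel_measurable (lborel \<Otimes>\<^sub>M lborel)"
        using measurable_compose[OF m' borel_measurable_norm] by (simp add: case_prod_unfold)
      then show "(\<lambda>x. LINT y|lborel. norm (case (x, y) of (x, xa) \<Rightarrow> f x xa)) \<in> borel_measurable lborel"
        using lborel.borel_measurable_lebesgue_integral by simp
    qed (use a in simp)
  qed (use i in auto)
  from lborel_pair.Fubini_integral[OF this] show ?thesis by simp
qed

text \<open>Large enough to contain Schwartz functions multiplied by homogeneous symbols of positive
  degree, which need not be smooth at the origin, and small enough for pointwise Fourier
  inversion.\<close>

definition wiener :: "('n::finite rspace \<Rightarrow> complex) \<Rightarrow> bool"
  where "wiener g \<longleftrightarrow> continuous_on UNIV g \<and> bounded (range g) \<and> integrable lborel g \<and> integrable lborel (ft g)"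

text \<open>Gaussian summation: a Gaussian factor of width 1/\<open>e N\<close> makes the double
  integral absolutely convergent. The damped integral has two limits, one by domination with
  \<open>ft g\<close>, the other by continuity and boundedness of \<open>g\<close>, and these must
  agree.\<close>

theorem fourier_inversion:
  fixes g :: "'n::finite rspace \<Rightarrow> complex"
  assumes "wiener g"
  shows "ift (ft g) x = g x"
proof -
  have cont: "continuous_on UNIV g" and g: "integrable lborel g" and fg: "integrable lborel (ft g)"
    using assms unfolding wiener_def by auto
  obtain B where B: "\<And>x. norm (g x) \<le> B"
    using assms unfolding wiener_def bounded_iff by blast
  have [measurable]: "g \<in> borel_measurable borel" "ft g \<in> borel_measurable borel"
    using g by auto
  define e where "e N = inverse (real (Suc N))" for N
  have e0: "e N > 0" for N unfolding e_def by simp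
  have elim: "e \<longlonglongrightarrow> 0" unfolding e_def by (rule LIMSEQ_inverse_real_of_nat)
  let ?c = "sqrt (2 * pi) ^ CARD('n)"
  define A where "A N = (LINT \<xi>|lborel. exp (\<i> * complex_of_real (x \<bullet> \<xi>)) * ft g \<xi> * complex_of_real (gauss (e N *\<^sub>R \<xi>)))" for N
  have gauss1: "(\<lambda>N. gauss (e N *\<^sub>R \<xi>)) \<longlonglongrightarrow> 1" for \<xi> :: "'n rspace"
  proof -
    have "(\<lambda>N. gauss (e N *\<^sub>R \<xi>)) \<longlonglongrightarrow> exp (- ((0 *\<^sub>R \<xi>) \<bullet> (0 *\<^sub>R \<xi>)) / 2)"
      unfolding gauss_def by (intro tendsto_intros elim) simp
    then show ?thesis by simp
  qed
  have gle: "0 \<le> gauss y" "gauss y \<le> 1" for y :: "'n rspace"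
    unfolding gauss_def by auto
  have lim1: "A \<longlonglongrightarrow> (LINT \<xi>|lborel. exp (\<i> * complex_of_real (x \<bullet> \<xi>)) * ft g \<xi>)"
    unfolding A_def
  proof (rule integral_dominated_convergence[where w = "\<lambda>\<xi>. norm (ft g \<xi>)"])
    show "AE \<xi> in lborel. (\<lambda>N. exp (\<i> * complex_of_real (x \<bullet> \<xi>)) * ft g \<xi> * complex_of_real (gauss (e N *\<^sub>R \<xi>)))
        \<longlonglongrightarrow> exp (\<i> * complex_of_real (x \<bullet> \<xi>)) * ft g \<xi>"
    proof (intro AE_I2)
      fix \<xi>
      show "(\<lambda>N. exp (\<i> * complex_of_real (x \<bullet> \<xi>)) * ft g \<xi> * complex_of_real (gauss (e N *\<^sub>R \<xi>)))
        \<longlonglongrightarrow> exp (\<i> * complex_of_real (x \<bullet> \<xi>)) * ft g \<xi>"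
        using tendsto_mult[OF tendsto_const tendsto_of_real[OF gauss1[of \<xi>]]] by simp
    qed
    show "AE \<xi> in lborel. norm (exp (\<i> * complex_of_real (x \<bullet> \<xi>)) * ft g \<xi> * complex_of_real (gauss (e N *\<^sub>R \<xi>)))
        \<le> norm (ft g \<xi>)" for N
      by (intro AE_I2) (simp add: norm_mult mult_left_le gle)
  qed (use fg in auto)
  \<comment> \<open>By Fubini and the self-duality of the Gaussian, the damped integral is, up to a
    constant, a Gaussian average of \<open>g\<close> around \<open>x\<close> at scale
    \<open>e N\<close>.\<close>
  have A: "A N = complex_of_real ?c * (LINT z|lborel. g (x - e N *\<^sub>R z) * complex_of_real (gauss z))" for N
  proof -
    have "A N = (LINT \<xi>|lborel. LINT y|lborel. exp (\<i> * complex_of_real ((x - y) \<bullet> \<xi>)) * complex_of_real (gauss (e N *\<^sub>R \<xi>)) * g y)"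
      unfolding A_def
    proof (rule Bochner_Integration.integral_cong[OF refl])
      fix \<xi>
      have "exp (\<i> * complex_of_real (x \<bullet> \<xi>)) * ft g \<xi> * complex_of_real (gauss (e N *\<^sub>R \<xi>))
        = (LINT y|lborel. (exp (\<i> * complex_of_real (x \<bullet> \<xi>)) * complex_of_real (gauss (e N *\<^sub>R \<xi>))) *
              (exp (- \<i> * complex_of_real (y \<bullet> \<xi>)) * g y))"
        unfolding integral_mult_right_zero ft_def by (simp add: mult_ac)
      also have "\<dots> = (LINT y|lborel. exp (\<i> * complex_of_real ((x - y) \<bullet> \<xi>)) * complex_of_real (gauss (e N *\<^sub>R \<xi>)) * g y)"
        by (rule Bochner_Integration.integral_cong) (simp_all add: inner_diff_left algebra_simps exp_diff exp_minus divide_inverse)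
      finally show "exp (\<i> * complex_of_real (x \<bullet> \<xi>)) * ft g \<xi> * complex_of_real (gauss (e N *\<^sub>R \<xi>)) = \<dots>" .
    qed
    also have "\<dots> = (LINT y|lborel. LINT \<xi>|lborel. exp (\<i> * complex_of_real ((x - y) \<bullet> \<xi>)) * complex_of_real (gauss (e N *\<^sub>R \<xi>)) * g y)"
    proof (rule fubini_dominated)
      show "integrable lborel (\<lambda>\<xi>::'n rspace. gauss (e N *\<^sub>R \<xi>))"
        using integrable_affine_imp[OF integrable_gauss, of "e N" 0] e0[of N] by simp
      show "integrable lborel (\<lambda>y. norm (g y))" using g by (rule integrable_norm)
    qed (use gle in \<open>auto simp: norm_mult\<close>)
    also have "\<dots> = (LINT y|lborel. complex_of_real (inverse (e N ^ CARD('n)) * ?c) * (complex_of_real (gauss ((1 / e N) *\<^sub>R (x - y))) * g y))"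
    proof (rule Bochner_Integration.integral_cong[OF refl])
      fix y
      have "(LINT \<xi>|lborel. exp (\<i> * complex_of_real ((x - y) \<bullet> \<xi>)) * complex_of_real (gauss (e N *\<^sub>R \<xi>)) * g y)
          = (LINT \<xi>|lborel. exp (\<i> * complex_of_real (((1 / e N) *\<^sub>R (x - y)) \<bullet> (e N *\<^sub>R \<xi>))) * complex_of_real (gauss (e N *\<^sub>R \<xi>))) * g y"
        unfolding integral_mult_left_zero using e0[of N] by simp
      also have "(LINT \<xi>|lborel. exp (\<i> * complex_of_real (((1 / e N) *\<^sub>R (x - y)) \<bullet> (e N *\<^sub>R \<xi>))) * complex_of_real (gauss (e N *\<^sub>R \<xi>)))
         = inverse (e N ^ CARD('n)) *\<^sub>R (LINT \<xi>|lborel. exp (\<i> * complex_of_real (((1 / e N) *\<^sub>R (x - y)) \<bullet> \<xi>)) * complex_of_real (gauss \<xi>))"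
        using integral_affine[of "e N" "\<lambda>\<xi>. exp (\<i> * complex_of_real (((1 / e N) *\<^sub>R (x - y)) \<bullet> \<xi>)) * complex_of_real (gauss \<xi>)" 0] e0[of N]
        by simp
      also have "\<dots> = complex_of_real (inverse (e N ^ CARD('n)) * ?c * gauss ((1 / e N) *\<^sub>R (x - y)))"
        unfolding gaussian_integral_vec(2) by (simp add: scaleR_conv_of_real)
      finally show "(LINT \<xi>|lborel. exp (\<i> * complex_of_real ((x - y) \<bullet> \<xi>)) * complex_of_real (gauss (e N *\<^sub>R \<xi>)) * g y)
         = complex_of_real (inverse (e N ^ CARD('n)) * ?c) * (complex_of_real (gauss ((1 / e N) *\<^sub>R (x - y))) * g y)"
        by (simp add: mult.assoc)
    qed
    also have "\<dots> = complex_of_real (inverse (e N ^ CARD('n)) * ?c) * (LINT y|lborel. complex_of_real (gauss ((1 / e N) *\<^sub>R (x - y))) * g y)"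
      by (rule integral_mult_right_zero)
    also have "(LINT y|lborel. complex_of_real (gauss ((1 / e N) *\<^sub>R (x - y))) * g y)
        = e N ^ CARD('n) *\<^sub>R (LINT z|lborel. complex_of_real (gauss z) * g (x - e N *\<^sub>R z))"
      using integral_affine[of "- e N" "\<lambda>y. complex_of_real (gauss ((1 / e N) *\<^sub>R (x - y))) * g y" x] e0[of N]
      by simp
    also have "complex_of_real (inverse (e N ^ CARD('n)) * ?c) * \<dots> = complex_of_real ?c * (LINT z|lborel. g (x - e N *\<^sub>R z) * complex_of_real (gauss z))"
      using e0[of N] by (simp add: scaleR_conv_of_real mult.commute)
    finally show ?thesis .
  qed
  have lim2: "(\<lambda>N. LINT z|lborel. g (x - e N *\<^sub>R z) * complex_of_real (gauss z)) \<longlonglongrightarrow> (LINT z|lborel. g x * complex_of_real (gauss (z::'n rspace)))"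
  proof (rule integral_dominated_convergence[where w = "\<lambda>z::'n rspace. B * gauss z"])
    show "AE z in lborel. (\<lambda>N. g (x - e N *\<^sub>R z) * complex_of_real (gauss z)) \<longlonglongrightarrow> g x * complex_of_real (gauss z)"
    proof (intro AE_I2 tendsto_mult tendsto_const)
      fix z
      have "(\<lambda>N. x - e N *\<^sub>R z) \<longlonglongrightarrow> x - 0 *\<^sub>R z" by (intro tendsto_intros elim)
      then have "(\<lambda>N. g (x - e N *\<^sub>R z)) \<longlonglongrightarrow> g (x - 0 *\<^sub>R z)"
        using cont by (intro continuous_on_tendsto_compose[OF cont]) auto
      then show "(\<lambda>N. g (x - e N *\<^sub>R z)) \<longlonglongrightarrow> g x" by simp
    qed
    show "AE z in lborel. norm (g (x - e N *\<^sub>R z) * complex_of_real (gauss z)) \<le> B * gauss z" for N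
      using B gle by (intro AE_I2) (simp add: norm_mult mult_right_mono)
  qed (use integrable_gauss in auto)
  have "(LINT z|lborel. g x * complex_of_real (gauss (z::'n rspace))) = g x * complex_of_real ?c"
    using gaussian_integral_vec(2)[of "0::'n rspace"] by (simp add: gauss_def)
  with lim2 have "A \<longlonglongrightarrow> complex_of_real ?c * (g x * complex_of_real ?c)"
    unfolding A by (intro tendsto_mult tendsto_const) (simp only:)
  with lim1 have "(LINT \<xi>|lborel. exp (\<i> * complex_of_real (x \<bullet> \<xi>)) * ft g \<xi>) = complex_of_real ?c * (g x * complex_of_real ?c)"
    by (rule LIMSEQ_unique)
  \<comment> \<open>One factor \<open>?c\<close> is the constant in the transform of the Gaussian,
    the other is its total mass. Their product cancels the normalisation of
    \<open>ift\<close>.\<close>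
  also have "\<dots> = complex_of_real ((2 * pi) ^ CARD('n)) * g x"
  proof -
    have "?c * ?c = (2 * pi) ^ CARD('n)"
      unfolding power_mult_distrib[symmetric] by simp
    then have "complex_of_real ?c * complex_of_real ?c = complex_of_real ((2 * pi) ^ CARD('n))"
      by (metis of_real_mult)
    then show ?thesis by (metis mult.assoc mult.commute)
  qed
  finally show ?thesis
    unfolding ift_def by simp
qed

lemma schwartz_bounded: "schwartz \<phi> \<Longrightarrow> bounded (range \<phi>)"
  using spec[OF schwartz_rapid[unfolded rapid_def], of \<phi> 0] unfolding bounded_iff by simp

lemma schwartz_wiener: "schwartz \<phi> \<Longrightarrow> wiener \<phi>"
  unfolding wiener_def
  by (intro conjI smooth_continuous schwartz_smooth schwartz_bounded schwartz_integrable ft_schwartz)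

lemma wiener_add:
  assumes "wiener g" "wiener h"
  shows "wiener (\<lambda>x. g x + h x)"
proof -
  have "ft (\<lambda>x. g x + h x) = (\<lambda>\<xi>. ft g \<xi> + ft h \<xi>)"
    using assms by (auto simp: wiener_def ft_add)
  then show ?thesis
    using assms bounded_plus_comp[of g UNIV h]
    by (auto simp: wiener_def intro: continuous_on_add)
qed

lemma wiener_cmult:
  assumes "wiener g"
  shows "wiener (\<lambda>x. c * g x)"
proof -
  have "ft (\<lambda>x. c * g x) = (\<lambda>\<xi>. c * ft g \<xi>)"
    by (simp add: ft_cmult fun_eq_iff)
  then show ?thesis
    using assms by (auto simp: wiener_def norm_mult bounded_iff
        intro!: continuous_on_mult_left) (metis mult_left_mono norm_ge_zero)
qed

section \<open>Convolution\<close>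

lemma convolution_pair_integrable:
  fixes \<phi> K :: "'n::finite rspace \<Rightarrow> 'b::{real_normed_field,banach,second_countable_topology}"
  assumes \<phi>: "integrable lborel \<phi>" and K: "integrable lborel K"
  shows "integrable (lborel \<Otimes>\<^sub>M lborel) (\<lambda>(x, y). \<phi> x * K (x - y))"
proof (rule lborel_pair.Fubini_integrable)
  have [measurable]: "\<phi> \<in> borel_measurable borel" "K \<in> borel_measurable borel"
    using \<phi> K by auto
  show "(\<lambda>(x, y). \<phi> x * K (x - y)) \<in> borel_measurable (lborel \<Otimes>\<^sub>M lborel)"
    by measurable
  show "AE x in lborel. integrable lborel (\<lambda>y. case (x, y) of (x, y) \<Rightarrow> \<phi> x * K (x - y))"
    using K by (auto simp: integrable_reflect)
  have "(LINT y|lborel. norm (\<phi> x * K (x - y))) = norm (\<phi> x) * (LINT y|lborel. norm (K y))" for x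
    using integral_reflect[of "\<lambda>y. norm (K y)" x] by (simp add: norm_mult)
  then show "integrable lborel (\<lambda>x. LINT y|lborel. norm (case (x, y) of (x, y) \<Rightarrow> \<phi> x * K (x - y)))"
    using \<phi> by simp
qed

lemma convolution_L1:
  fixes \<phi> K :: "'n::finite rspace \<Rightarrow> complex"
  assumes \<phi>: "integrable lborel \<phi>" and K: "integrable lborel K"
  shows "integrable lborel (\<lambda>y. LINT x|lborel. \<phi> x * K (x - y))"
    and "(LINT y|lborel. norm (LINT x|lborel. \<phi> x * K (x - y)))
      \<le> (LINT x|lborel. norm (\<phi> x)) * (LINT x|lborel. norm (K x))"
proof -
  note i = convolution_pair_integrable[OF assms]
  show a: "integrable lborel (\<lambda>y. LINT x|lborel. \<phi> x * K (x - y))"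
    using lborel_pair.integrable_snd[OF i] .
  have n: "integrable (lborel \<Otimes>\<^sub>M lborel) (\<lambda>(x, y). norm (\<phi> x * K (x - y)))"
    using integrable_norm[OF i] by (simp add: case_prod_unfold)
  have "(LINT y|lborel. norm (LINT x|lborel. \<phi> x * K (x - y))) \<le> (LINT y|lborel. LINT x|lborel. norm (\<phi> x * K (x - y)))"
    by (intro integral_mono integrable_norm a lborel_pair.integrable_snd[OF n] integral_norm_bound)
  also have "\<dots> = (LINT x|lborel. LINT y|lborel. norm (\<phi> x * K (x - y)))"
    by (rule lborel_pair.Fubini_integral[OF n])
  also have "\<dots> = (LINT x|lborel. norm (\<phi> x) * (LINT y|lborel. norm (K y)))"
    using integral_reflect[of "\<lambda>y. norm (K y)"] by (simp add: norm_mult)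
  finally show "(LINT y|lborel. norm (LINT x|lborel. \<phi> x * K (x - y)))
      \<le> (LINT x|lborel. norm (\<phi> x)) * (LINT x|lborel. norm (K x))" by simp
qed

text \<open>The convolution theorem in transposed form: multiplying by \<open>h\<close> on the
  Fourier side moves to the test function as integration against the kernel \<open>ift h\<close> at
  \<open>x - y\<close>, with \<open>x\<close> the integration variable. Pairing the result with a
  function of \<open>y\<close> then convolves that function with \<open>ift h\<close>.\<close>

lemma ft_ift_mult:
  fixes \<phi> h :: "'n::finite rspace \<Rightarrow> complex"
  assumes \<phi>: "integrable lborel \<phi>" and h: "integrable lborel h"
  shows "ft (\<lambda>\<xi>. ift \<phi> \<xi> * h \<xi>) y = (LINT x|lborel. \<phi> x * ift h (x - y))"
proof -
  let ?c = "complex_of_real (1 / (2 * pi) ^ CARD('n))"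
  have [measurable]: "\<phi> \<in> borel_measurable borel" "h \<in> borel_measurable borel"
    using \<phi> h by auto
  let ?F = "\<lambda>\<xi> x. ?c * (exp (\<i> * complex_of_real ((x - y) \<bullet> \<xi>)) * \<phi> x * h \<xi>)"
  have "ft (\<lambda>\<xi>. ift \<phi> \<xi> * h \<xi>) y = (LINT \<xi>|lborel. LINT x|lborel. ?F \<xi> x)"
    unfolding ft_def
  proof (rule Bochner_Integration.integral_cong[OF refl])
    fix \<xi>
    have "exp (- \<i> * complex_of_real (\<xi> \<bullet> y)) * (ift \<phi> \<xi> * h \<xi>)
      = (LINT x|lborel. (?c * exp (- \<i> * complex_of_real (\<xi> \<bullet> y)) * h \<xi>) * (exp (\<i> * complex_of_real (\<xi> \<bullet> x)) * \<phi> x))"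
      unfolding integral_mult_right_zero ift_def by (simp add: mult_ac)
    also have "\<dots> = (LINT x|lborel. ?F \<xi> x)"
      by (rule Bochner_Integration.integral_cong[OF refl])
         (simp add: inner_diff_left inner_commute algebra_simps exp_diff exp_minus divide_inverse)
    finally show "exp (- \<i> * complex_of_real (\<xi> \<bullet> y)) * (ift \<phi> \<xi> * h \<xi>) = \<dots>" .
  qed
  also have "\<dots> = (LINT x|lborel. LINT \<xi>|lborel. ?F \<xi> x)"
  proof (rule fubini_dominated)
    show "integrable lborel (\<lambda>\<xi>. norm ?c * norm (h \<xi>))" "integrable lborel (\<lambda>x. norm (\<phi> x))"
      using \<phi> h by auto
    show "norm (?F \<xi> x) \<le> norm ?c * norm (h \<xi>) * norm (\<phi> x)" for \<xi> x
      by (simp only: norm_mult norm_exp_i_times) simp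
  qed measurable
  also have "\<dots> = (LINT x|lborel. \<phi> x * ift h (x - y))"
  proof (rule Bochner_Integration.integral_cong[OF refl])
    fix x
    have "(LINT \<xi>|lborel. ?F \<xi> x) = (LINT \<xi>|lborel. (?c * \<phi> x) * (exp (\<i> * complex_of_real ((x - y) \<bullet> \<xi>)) * h \<xi>))"
      by (simp add: mult_ac)
    then show "(LINT \<xi>|lborel. ?F \<xi> x) = \<phi> x * ift h (x - y)"
      unfolding integral_mult_right_zero ift_def by (simp add: mult_ac)
  qed
  finally show ?thesis .
qed

section \<open>Fourier transforms of homogeneous symbols\<close>

lemma integral_norm_le_cball:
  fixes u :: "'n::finite rspace \<Rightarrow> complex"
  assumes "u \<in> borel_measurable borel" "\<And>x. norm (u x) \<le> K" "\<And>x. norm x > M \<Longrightarrow> u x = 0"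
  shows "integrable lborel u"
    and "(LINT x|lborel. norm (u x)) \<le> K * measure lborel (cball (0::'n rspace) M)"
proof -
  have i: "integrable lborel (\<lambda>x. K * indicator (cball (0::'n rspace) M) x)"
    by (intro integrable_mult_right integrable_real_indicator) (simp_all add: emeasure_lborel_cball_finite[unfolded infinity_ennreal_def])
  have le: "norm (u x) \<le> K * indicator (cball 0 M) x" for x
  proof (cases "norm x \<le> M")
    case True
    then show ?thesis using assms(2)[of x] by simp
  next
    case False
    then show ?thesis using assms(3)[of x] by simp
  qed
  show 1: "integrable lborel u"
    by (rule Bochner_Integration.integrable_bound[OF i])
       (use assms(1) in simp, intro AE_I2, unfold real_norm_def, rule order_trans[OF le abs_ge_self])
  have "(LINT x|lborel. norm (u x)) \<le> (LINT x|lborel. K * indicator (cball (0::'n rspace) M) x)"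
    by (intro integral_mono integrable_norm 1 i le)
  then show "(LINT x|lborel. norm (u x)) \<le> K * measure lborel (cball (0::'n rspace) M)"
    by simp
qed

lemma annular_schwartz: "annular \<epsilon> M \<phi> \<Longrightarrow> schwartz \<phi>"
  unfolding annular_def using schwartz_vanish by metis

text \<open>2n derivatives, each costing a factor \<open>1 + \<bar>s\<bar>\<close>, are integrated
  over a ball of fixed radius. The supremum \<open>B\<close> of the power on the annulus is kept as
  a parameter, so that the same estimate serves positive exponents (governed by the outer radius)
  and negative ones (governed by the inner radius).\<close>

lemma annular_ft_bound:
  fixes \<phi> :: "'n::finite rspace \<Rightarrow> complex"
  assumes a: "annular \<epsilon> M \<phi>" and e: "\<epsilon> > 0"
  shows "\<exists>C\<ge>0. \<forall>s B \<xi>. 0 \<le> B \<longrightarrow> (\<forall>x::'n rspace. \<epsilon> \<le> norm x \<longrightarrow> norm x \<le> M \<longrightarrow> norm x powr s \<le> B) \<longrightarrow>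
     norm (ft (\<lambda>x. \<phi> x * complex_of_real (norm x powr s)) \<xi>) \<le> C * (1 + \<bar>s\<bar>) ^ (2 * CARD('n)) * B * wgt \<xi>"
proof -
  let ?m = "2 * CARD('n)"
  let ?V = "measure lborel (cball (0::'n rspace) M)"
  obtain C0 where C0: "C0 \<ge> 0" "\<And>s x. norm (\<phi> x * complex_of_real (norm x powr s)) \<le> C0 * norm x powr s"
    using annular_powr_bound[OF a e, of "[]"] by auto
  have "\<forall>j. \<exists>C\<ge>0. \<forall>s x. norm (partials (replicate ?m j) (\<lambda>x. \<phi> x * complex_of_real (norm x powr s)) x)
           \<le> C * (1 + \<bar>s\<bar>) ^ ?m * norm x powr s"
    using annular_powr_bound[OF a e, of "replicate ?m j" for j] by simp
  from choice[OF this] obtain D where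
    "\<forall>j. D j \<ge> 0 \<and> (\<forall>s x. norm (partials (replicate ?m j) (\<lambda>x. \<phi> x * complex_of_real (norm x powr s)) x)
           \<le> D j * (1 + \<bar>s\<bar>) ^ ?m * norm x powr s)" by (rule exE)
  then have D: "D j \<ge> 0"
    "norm (partials (replicate ?m j) (\<lambda>x. \<phi> x * complex_of_real (norm x powr s)) x)
           \<le> D j * (1 + \<bar>s\<bar>) ^ ?m * norm x powr s" for j s x by simp_all
  let ?C = "(1 + real CARD('n)) ^ ?m * ((C0 + (\<Sum>j\<in>UNIV. D j)) * ?V)"
  have "norm (ft (\<lambda>x. \<phi> x * complex_of_real (norm x powr s)) \<xi>) \<le> ?C * (1 + \<bar>s\<bar>) ^ ?m * B * wgt \<xi>"
    if B0: "0 \<le> B" and B: "\<And>x::'n rspace. \<epsilon> \<le> norm x \<Longrightarrow> norm x \<le> M \<Longrightarrow> norm x powr s \<le> B" for s B \<xi>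
  proof -
    let ?g = "\<lambda>x. \<phi> x * complex_of_real (norm x powr s)"
    have ann: "annular \<epsilon> M ?g" by (rule annular_powr[OF a e])
    have sch: "schwartz ?g" by (rule annular_schwartz[OF ann])
    have s1: "1 \<le> (1 + \<bar>s\<bar>) ^ ?m" by (rule one_le_power) simp
    have vo: "partials js ?g x = 0" if "norm x > M" for js x
      using partials_eq_0_open[of "- cball 0 M" ?g x js] ann that
      by (auto simp: annular_def open_Compl)
    have vi: "partials js ?g x = 0" if "norm x < \<epsilon>" for js x
      using partials_eq_0_open[of "ball 0 \<epsilon>" ?g x js] ann that
      by (auto simp: annular_def)
    have I: "(LINT x|lborel. norm (partials js ?g x)) \<le> (K * (1 + \<bar>s\<bar>) ^ ?m * B) * ?V"
      if K: "K \<ge> 0" "\<And>x. norm (partials js ?g x) \<le> K * (1 + \<bar>s\<bar>) ^ ?m * norm x powr s" for js K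
    proof (rule integral_norm_le_cball(2)[OF _ _ vo])
      show "partials js ?g \<in> borel_measurable borel"
        by (intro smooth_measurable smooth_partials schwartz_smooth sch)
      fix x
      show "norm (partials js ?g x) \<le> K * (1 + \<bar>s\<bar>) ^ ?m * B"
      proof (cases "\<epsilon> \<le> norm x \<and> norm x \<le> M")
        case True
        then show ?thesis
          using order_trans[OF K(2) mult_left_mono[OF B]] K(1) by simp
      next
        case False
        then have "partials js ?g x = 0" using vi vo by force
        then show ?thesis using K B0 by simp
      qed
    qed
    have I0: "(LINT x|lborel. norm (?g x)) \<le> (C0 * (1 + \<bar>s\<bar>) ^ ?m * B) * ?V"
    proof -
      have "norm (partials [] ?g x) \<le> C0 * (1 + \<bar>s\<bar>) ^ ?m * norm x powr s" for x
      proof -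
        have "C0 * norm x powr s * 1 \<le> C0 * norm x powr s * (1 + \<bar>s\<bar>) ^ ?m"
          by (rule mult_left_mono[OF s1]) (use C0 in simp)
        with C0(2)[of x s] show ?thesis by (simp add: mult_ac)
      qed
      from I[of C0 "[]", OF C0(1) this] show ?thesis by simp
    qed
    have "(1 + norm \<xi>) ^ ?m * norm (ft ?g \<xi>) \<le> (1 + real CARD('n)) ^ ?m *
      ((LINT x|lborel. norm (?g x)) + (\<Sum>j\<in>UNIV. LINT x|lborel. norm (partials (replicate ?m j) ?g x)))"
      by (rule ft_weighted_bound[OF sch])
    also have "\<dots> \<le> (1 + real CARD('n)) ^ ?m *
      ((C0 * (1 + \<bar>s\<bar>) ^ ?m * B) * ?V + (\<Sum>j\<in>UNIV. (D j * (1 + \<bar>s\<bar>) ^ ?m * B) * ?V))"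
      by (intro mult_left_mono add_mono sum_mono I0 I D) auto
    also have "\<dots> = ?C * (1 + \<bar>s\<bar>) ^ ?m * B"
      by (simp add: algebra_simps sum_distrib_left sum_distrib_right)
    finally have *: "(1 + norm \<xi>) ^ ?m * norm (ft ?g \<xi>) \<le> ?C * (1 + \<bar>s\<bar>) ^ ?m * B" .
    have "norm (ft ?g \<xi>) = ((1 + norm \<xi>) ^ ?m * norm (ft ?g \<xi>)) * wgt \<xi>"
      unfolding wgt_def by (simp add: add_nonneg_eq_0_iff)
    also have "\<dots> \<le> (?C * (1 + \<bar>s\<bar>) ^ ?m * B) * wgt \<xi>"
      by (rule mult_right_mono[OF *]) (use wgt_pos[of \<xi>] in simp)
    finally show ?thesis .
  qed
  moreover have "?C \<ge> 0" using C0 D by (simp add: sum_nonneg)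
  ultimately show ?thesis by blast
qed

section \<open>Dilations, cutoffs and the dyadic estimate near the origin\<close>

lemma ft_scale:
  fixes g :: "'n::finite rspace \<Rightarrow> complex"
  assumes "c > 0"
  shows "ft (\<lambda>x. g (c *\<^sub>R x)) \<xi> = complex_of_real (inverse (c ^ CARD('n))) * ft g ((1 / c) *\<^sub>R \<xi>)"
  using integral_affine[of c "\<lambda>x. exp (- \<i> * complex_of_real (x \<bullet> ((1 / c) *\<^sub>R \<xi>))) * g x" 0] assms
  by (simp add: ft_def scaleR_conv_of_real[of _ "_::complex"])

lemma ft_scale_L1:
  fixes g :: "'n::finite rspace \<Rightarrow> complex"
  assumes "c > 0"
  shows "(LINT \<xi>|lborel. norm (ft (\<lambda>x. g (c *\<^sub>R x)) \<xi>)) = (LINT \<xi>|lborel. norm (ft g \<xi>))"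
    and "integrable lborel (ft (\<lambda>x. g (c *\<^sub>R x))) \<longleftrightarrow> integrable lborel (ft g)"
proof -
  have "(LINT \<xi>|lborel. norm (ft g \<xi>)) = (1 / c) ^ CARD('n) * (LINT \<xi>|lborel. norm (ft g ((1 / c) *\<^sub>R \<xi>)))"
    using integral_affine[of "1 / c" "\<lambda>\<xi>. norm (ft g \<xi>)" 0] assms by simp
  also have "\<dots> = (LINT \<xi>|lborel. (1 / c) ^ CARD('n) * norm (ft g ((1 / c) *\<^sub>R \<xi>)))"
    by simp
  also have "\<dots> = (LINT \<xi>|lborel. norm (ft (\<lambda>x. g (c *\<^sub>R x)) \<xi>))"
    using assms by (simp add: ft_scale norm_mult norm_power norm_inverse norm_divide power_divide inverse_eq_divide)
  finally show "(LINT \<xi>|lborel. norm (ft (\<lambda>x. g (c *\<^sub>R x)) \<xi>)) = (LINT \<xi>|lborel. norm (ft g \<xi>))" ..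
  have "integrable lborel (ft (\<lambda>x. g (c *\<^sub>R x))) \<longleftrightarrow> integrable lborel (\<lambda>\<xi>. ft g ((1 / c) *\<^sub>R \<xi>))"
  proof
    assume "integrable lborel (ft (\<lambda>x. g (c *\<^sub>R x)))"
    then have "integrable lborel (\<lambda>\<xi>. complex_of_real (c ^ CARD('n)) * ft (\<lambda>x. g (c *\<^sub>R x)) \<xi>)"
      by (rule integrable_mult_right)
    then show "integrable lborel (\<lambda>\<xi>. ft g ((1 / c) *\<^sub>R \<xi>))"
      unfolding ft_scale[OF assms] using assms by (simp add: mult.assoc[symmetric])
  next
    assume "integrable lborel (\<lambda>\<xi>. ft g ((1 / c) *\<^sub>R \<xi>))"
    then show "integrable lborel (ft (\<lambda>x. g (c *\<^sub>R x)))"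
      unfolding ft_scale[OF assms, abs_def] by (rule integrable_mult_right)
  qed
  also have "\<dots> \<longleftrightarrow> integrable lborel (ft g)"
    using integrable_affine_iff[of "1 / c" "ft g" 0] assms by simp
  finally show "integrable lborel (ft (\<lambda>x. g (c *\<^sub>R x))) \<longleftrightarrow> integrable lborel (ft g)" .
qed

definition cutoff :: "real \<Rightarrow> real \<Rightarrow> ('n::finite rspace \<Rightarrow> complex) \<Rightarrow> bool"
  where "cutoff a b \<zeta> \<longleftrightarrow> 0 < a \<and> a < b \<and> smooth \<zeta> \<and> (\<forall>x. norm x \<le> a \<longrightarrow> \<zeta> x = 1) \<and> (\<forall>x. norm x \<ge> b \<longrightarrow> \<zeta> x = 0)"

lemma cutoff_exists: "0 < a \<Longrightarrow> a < b \<Longrightarrow> \<exists>\<zeta>. cutoff a b \<zeta>"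
  using exists_cutoff[of a b 0] by (auto simp: cutoff_def)

lemma cutoff_smooth_vanish:
  assumes "cutoff a b \<zeta>"
  shows "smooth \<zeta>" "norm x > b \<Longrightarrow> \<zeta> x = 0"
  using assms by (auto simp: cutoff_def)

lemma cutoff_schwartz: "cutoff a b \<zeta> \<Longrightarrow> schwartz \<zeta>"
  using schwartz_vanish cutoff_smooth_vanish by metis

lemma cutoff_slow: "cutoff a b \<zeta> \<Longrightarrow> slow \<zeta>"
  using slow_vanish cutoff_smooth_vanish by metis

lemma smooth_scale:
  fixes \<phi> :: "'n::finite rspace \<Rightarrow> complex"
  assumes "smooth \<phi>"
  shows "smooth (\<lambda>x. \<phi> (c *\<^sub>R x))"
proof -
  let ?S = "{(\<lambda>x. d * \<phi> (c *\<^sub>R x)) | d \<phi>. smooth (\<phi> :: 'n rspace \<Rightarrow> complex)}"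
  have mem: "(\<lambda>x. d * \<phi> (c *\<^sub>R x)) \<in> ?S" if "smooth \<phi>" for d and \<phi> :: "'n rspace \<Rightarrow> complex"
    using that by blast
  have h: "((\<lambda>x. d * \<phi> (c *\<^sub>R x)) has_derivative (\<lambda>h. d * frechet_derivative \<phi> (at (c *\<^sub>R x)) (c *\<^sub>R h))) (at x)"
    if "smooth \<phi>" for d and \<phi> :: "'n rspace \<Rightarrow> complex" and x
    by (rule has_derivative_mult_right, rule has_derivative_compose[where g = \<phi>], (rule derivative_intros)+,
        rule has_derivative_frechet[OF smooth_differentiable[OF that]])
  have p: "pd j (\<lambda>x. d * \<phi> (c *\<^sub>R x)) = (\<lambda>x. (d * complex_of_real c) * pd j \<phi> (c *\<^sub>R x))"
    if "smooth \<phi>" for d j and \<phi> :: "'n rspace \<Rightarrow> complex"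
  proof
    fix x
    have "frechet_derivative \<phi> (at (c *\<^sub>R x)) (c *\<^sub>R axis j 1) = c *\<^sub>R pd j \<phi> (c *\<^sub>R x)"
      unfolding pd_def by (rule linear_scale[OF linear_frechet_derivative[OF smooth_differentiable[OF that]]])
    then show "pd j (\<lambda>x. d * \<phi> (c *\<^sub>R x)) x = (d * complex_of_real c) * pd j \<phi> (c *\<^sub>R x)"
      unfolding pd_eqI[OF h[OF that]] by (simp only: scaleR_conv_of_real mult.assoc)
  qed
  have "smooth (\<lambda>x. 1 * \<phi> (c *\<^sub>R x))"
  proof (rule fsums_partials(2)[of ?S])
    fix s and x :: "'n rspace" assume "s \<in> ?S"
    then show "s differentiable at x"
      using h unfolding differentiable_def by blast
  next
    fix s j assume "s \<in> ?S"
    then show "pd j s \<in> fsums ?S"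
      by (elim CollectE exE conjE) (simp only: p, intro fsums_base mem smooth_pd)
  qed (intro fsums_base mem assms)
  then show ?thesis by simp
qed

lemma cutoff_annular:
  assumes "cutoff a b \<zeta>"
  shows "annular (a / 2) b (\<lambda>x. \<zeta> x - \<zeta> (2 *\<^sub>R x))"
  using assms by (auto simp: annular_def cutoff_def intro!: smooth_diff smooth_scale)

text \<open>Dyadic decomposition: \<open>\<zeta> h\<close> is the sum of the dilates \<open>2\<^sup>-\<^sup>j\<^sup>s g (2\<^sup>j \<xi>)\<close> of its annular part \<open>g\<close>,
  and dilations preserve the \<open>L\<^sup>1\<close> norm of the Fourier transform.\<close>

lemma dyadic_ft_L1:
  fixes h \<zeta> :: "'n::finite rspace \<Rightarrow> complex"
  assumes s: "s > 0" and \<zeta>: "cutoff a b \<zeta>"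
    and hm: "h \<in> borel_measurable borel"
    and hom: "\<And>c x. c > 0 \<Longrightarrow> h (c *\<^sub>R x) = complex_of_real (c powr s) * h x"
    and hb: "\<And>x. norm (h x) \<le> norm x powr s"
    and K: "\<And>\<xi>. norm (ft (\<lambda>x. (\<zeta> x - \<zeta> (2 *\<^sub>R x)) * h x) \<xi>) \<le> K * wgt \<xi>"
  shows "integrable lborel (\<lambda>x. \<zeta> x * h x)"
    and "integrable lborel (ft (\<lambda>x. \<zeta> x * h x))"
    and "(LINT \<xi>|lborel. norm (ft (\<lambda>x. \<zeta> x * h x) \<xi>)) \<le> K * (LINT x|lborel. wgt (x::'n rspace)) / (1 - 2 powr (- s))"
proof -
  let ?W = "LINT x|lborel. wgt (x::'n rspace)"
  let ?g = "\<lambda>x. (\<zeta> x - \<zeta> (2 *\<^sub>R x)) * h x"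
  let ?H = "\<lambda>x. \<zeta> x * h x"
  have [measurable]: "\<zeta> \<in> borel_measurable borel" "h \<in> borel_measurable borel"
    using \<zeta> hm smooth_measurable by (auto simp: cutoff_def)
  obtain Z where Z: "\<And>x. norm (\<zeta> x) \<le> Z"
    using smooth_vanish_bounded[of \<zeta> b "[]"] cutoff_smooth_vanish[OF \<zeta>] by auto
  have Z0: "Z \<ge> 0" using order_trans[OF norm_ge_zero Z[of 0]] by simp
  have b0: "b > 0" using \<zeta> by (auto simp: cutoff_def)
  have Hb: "norm (?H x) \<le> Z * b powr s" for x
  proof (cases "norm x < b")
    case True
    then have "norm (h x) \<le> b powr s"
      using order_trans[OF hb powr_mono2[of s "norm x" b]] s by simp
    then show ?thesis using Z[of x] Z0 by (simp add: norm_mult mult_mono)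
  next
    case False
    then show ?thesis using \<zeta> Z0 by (auto simp: cutoff_def)
  qed
  have H0: "?H x = 0" if "norm x > b" for x
    using cutoff_smooth_vanish(2)[OF \<zeta> that] by simp
  show Hint: "integrable lborel ?H"
    by (rule integral_norm_le_cball(1)[OF _ Hb H0]) measurable
  define I where "I = (LINT x|lborel. norm (?H x))"
  have Hint2: "integrable lborel (\<lambda>x. \<zeta> (c *\<^sub>R x) * h x)"
    and I2: "(LINT x|lborel. norm (\<zeta> (c *\<^sub>R x) * h x)) = c powr (- s) * inverse (c ^ CARD('n)) * I" if "c > 0" for c
  proof -
    have e: "\<zeta> (c *\<^sub>R x) * h x = complex_of_real (c powr (- s)) * ?H (c *\<^sub>R x)" for x
      using that by (simp add: hom powr_minus field_simps)
    show "integrable lborel (\<lambda>x. \<zeta> (c *\<^sub>R x) * h x)"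
      unfolding e using integrable_affine_imp[OF Hint, of c 0] that by (intro integrable_mult_right) simp
    show "(LINT x|lborel. norm (\<zeta> (c *\<^sub>R x) * h x)) = c powr (- s) * inverse (c ^ CARD('n)) * I"
      unfolding e I_def using integral_affine[of c "\<lambda>x. norm (?H x)" 0] that
      by (simp add: norm_mult divide_simps)
  qed
  have gint: "integrable lborel ?g"
    using Bochner_Integration.integrable_diff[OF Hint Hint2[of 2]] by (simp add: algebra_simps)
  have Fg: "integrable lborel (ft ?g)" "(LINT \<xi>|lborel. norm (ft ?g \<xi>)) \<le> K * ?W"
    using integrable_wgt_bound[OF _ K] ft_measurable[OF gint] by auto
  \<comment> \<open>The transform of the j-th dyadic piece. By homogeneity the factor 2^(-js) turns
    \<open>h\<close> at 2^j x back into \<open>h\<close> at x, so the piece is a multiple of a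
    dilate of \<open>?g\<close>.\<close>
  define u where "u j \<xi> = complex_of_real ((2 powr (- s)) ^ j) * ft (\<lambda>x. ?g (2 ^ j *\<^sub>R x)) \<xi>" for j \<xi>
  have ui: "integrable lborel (u j)" for j
    unfolding u_def using Fg(1) by (intro integrable_mult_right) (subst ft_scale_L1(2), auto)
  have uI: "(LINT \<xi>|lborel. norm (u j \<xi>)) \<le> K * ?W * (2 powr (- s)) ^ j" for j
    unfolding u_def using ft_scale_L1(1)[of "2 ^ j" ?g] Fg(2)
    by (simp add: norm_mult norm_power mult_left_mono mult.commute)
  have q: "0 < 2 powr (- s)" "2 powr (- s) < 1"
    using s by (auto simp: powr_less_one)
  \<comment> \<open>The pieces telescope, because each is the difference of two consecutive dilated
    cutoffs multiplied by the same \<open>h\<close>.\<close>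
  have part: "(\<Sum>j<N. u j \<xi>) = ft ?H \<xi> - ft (\<lambda>x. \<zeta> (2 ^ N *\<^sub>R x) * h x) \<xi>" for N \<xi>
  proof (induction N)
    case (Suc N)
    have gi: "integrable lborel (\<lambda>x. \<zeta> (2 ^ N *\<^sub>R x) * h x)" for N by (rule Hint2) simp
    have "u N \<xi> = ft (\<lambda>x. complex_of_real ((2 powr (- s)) ^ N) * ?g (2 ^ N *\<^sub>R x)) \<xi>"
      unfolding u_def by (rule ft_cmult[symmetric])
    also have "(\<lambda>x. complex_of_real ((2 powr (- s)) ^ N) * ?g (2 ^ N *\<^sub>R x))
       = (\<lambda>x. \<zeta> (2 ^ N *\<^sub>R x) * h x - \<zeta> (2 ^ Suc N *\<^sub>R x) * h x)"
    proof
      fix x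
      have "(2 powr (- s)) ^ N * (2 ^ N) powr s = 1"
        by (simp add: powr_minus power_inverse powr_powr powr_realpow[symmetric] mult.commute)
      then have "complex_of_real ((2 powr (- s)) ^ N) * h (2 ^ N *\<^sub>R x) = h x"
        unfolding hom[of "2 ^ N", simplified] by (metis (no_types) mult.assoc mult_1 of_real_1 of_real_mult)
      then show "complex_of_real ((2 powr (- s)) ^ N) * ?g (2 ^ N *\<^sub>R x)
         = \<zeta> (2 ^ N *\<^sub>R x) * h x - \<zeta> (2 ^ Suc N *\<^sub>R x) * h x"
        by (metis (no_types, lifting) left_diff_distrib mult.left_commute power_Suc scaleR_scaleR)
    qed
    also have "ft \<dots> \<xi> = ft (\<lambda>x. \<zeta> (2 ^ N *\<^sub>R x) * h x) \<xi> - ft (\<lambda>x. \<zeta> (2 ^ Suc N *\<^sub>R x) * h x) \<xi>"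
      by (rule ft_diff[OF gi gi])
    finally show ?case using Suc by simp
  qed simp
  have sums: "(\<lambda>j. u j \<xi>) sums ft ?H \<xi>" for \<xi>
    unfolding sums_def
  proof (rule LIM_zero_cancel, rule Lim_null_comparison)
    \<comment> \<open>The remainder lives on a ball shrinking to the origin. Its L^1 norm, hence its
      transform, is at most 2^(-Ns) times that of \<open>?H\<close>, and \<open>s > 0\<close> makes
      this tend to 0.\<close>
    show "\<forall>\<^sub>F N in sequentially. norm ((\<Sum>j<N. u j \<xi>) - ft ?H \<xi>) \<le> (2 powr (- s)) ^ N * I"
    proof (intro always_eventually allI)
      fix N
      have I0: "I \<ge> 0" unfolding I_def by (simp add: integral_nonneg_AE)
      have "norm ((\<Sum>j<N. u j \<xi>) - ft ?H \<xi>) = norm (ft (\<lambda>x. \<zeta> (2 ^ N *\<^sub>R x) * h x) \<xi>)"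
        unfolding part by simp
      also have "\<dots> \<le> (2 ^ N) powr (- s) * inverse ((2 ^ N) ^ CARD('n)) * I"
        using ft_norm_le[OF Hint2[of "2 ^ N"]] I2[of "2 ^ N"] by simp
      also have "\<dots> \<le> (2 ^ N) powr (- s) * 1 * I"
        by (intro mult_right_mono mult_left_mono I0) (auto simp: inverse_le_1_iff)
      also have "(2 ^ N) powr (- s) = (2 powr (- s)) ^ N"
        by (simp add: powr_minus power_inverse powr_powr powr_realpow[symmetric] mult.commute)
      finally show "norm ((\<Sum>j<N. u j \<xi>) - ft ?H \<xi>) \<le> (2 powr (- s)) ^ N * I" by simp
    qed
    show "(\<lambda>N. (2 powr (- s)) ^ N * I) \<longlonglongrightarrow> 0"
      using tendsto_mult_left_zero[OF LIMSEQ_power_zero[of "2 powr (- s)"]] q by simp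
  qed
  have KW: "K * ?W \<ge> 0" using order_trans[OF _ Fg(2), of 0] by (simp add: integral_nonneg_AE)
  have geo: "(\<lambda>j. K * ?W * (2 powr (- s)) ^ j) sums (K * ?W / (1 - 2 powr (- s)))"
    using sums_mult[OF geometric_sums[of "2 powr (- s)"], of "K * ?W"] q by simp
  \<comment> \<open>Nonnegative integrals are used because integrability of \<open>ft ?H\<close> is
    a consequence of this estimate and cannot enter it.\<close>
  have nn: "(\<integral>\<^sup>+ \<xi>. norm (ft ?H \<xi>) \<partial>lborel) \<le> ennreal (K * ?W / (1 - 2 powr (- s)))"
  proof -
    have "(\<integral>\<^sup>+ \<xi>. norm (ft ?H \<xi>) \<partial>lborel) \<le> (\<integral>\<^sup>+ \<xi>. (\<Sum>j. ennreal (norm (u j \<xi>))) \<partial>lborel)"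
    proof (rule nn_integral_mono)
      fix \<xi>
      show "ennreal (norm (ft ?H \<xi>)) \<le> (\<Sum>j. ennreal (norm (u j \<xi>)))"
      proof (rule LIMSEQ_le_const2)
        show "(\<lambda>N. ennreal (norm (\<Sum>j<N. u j \<xi>))) \<longlonglongrightarrow> ennreal (norm (ft ?H \<xi>))"
          by (intro tendsto_ennrealI tendsto_norm) (use sums[of \<xi>] in \<open>simp add: sums_def\<close>)
        show "\<exists>N. \<forall>n\<ge>N. ennreal (norm (\<Sum>j<n. u j \<xi>)) \<le> (\<Sum>j. ennreal (norm (u j \<xi>)))"
        proof (intro exI allI impI)
          fix n
          have "ennreal (norm (\<Sum>j<n. u j \<xi>)) \<le> ennreal (\<Sum>j<n. norm (u j \<xi>))"
            by (intro ennreal_leI norm_sum)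
          also have "\<dots> = (\<Sum>j<n. ennreal (norm (u j \<xi>)))" by (simp add: sum_ennreal)
          also have "\<dots> \<le> (\<Sum>j. ennreal (norm (u j \<xi>)))" by (intro sum_le_suminf) auto
          finally show "ennreal (norm (\<Sum>j<n. u j \<xi>)) \<le> (\<Sum>j. ennreal (norm (u j \<xi>)))" .
        qed
      qed
    qed
    also have "\<dots> = (\<Sum>j. \<integral>\<^sup>+ \<xi>. norm (u j \<xi>) \<partial>lborel)"
      using borel_measurable_integrable[OF ui] by (intro nn_integral_suminf) simp
    also have "\<dots> \<le> (\<Sum>j. ennreal (K * ?W * (2 powr (- s)) ^ j))"
      by (intro suminf_le summableI) (simp add: nn_integral_eq_integral[OF integrable_norm[OF ui]] ennreal_leI uI)
    also have "\<dots> = ennreal (K * ?W / (1 - 2 powr (- s)))"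
      using geo KW q by (subst suminf_ennreal_eq[OF _ geo]) auto
    finally show ?thesis .
  qed
  show FH: "integrable lborel (ft ?H)"
    using nn ft_measurable[OF Hint] by (intro integrableI_bounded) (auto intro: le_less_trans)
  have "ennreal (LINT \<xi>|lborel. norm (ft ?H \<xi>)) \<le> ennreal (K * ?W / (1 - 2 powr (- s)))"
    using nn nn_integral_eq_integral[OF integrable_norm[OF FH]] by simp
  then show "(LINT \<xi>|lborel. norm (ft ?H \<xi>)) \<le> K * ?W / (1 - 2 powr (- s))"
    using KW q by (simp add: ennreal_le_iff)
qed

text \<open>The scalar coordinates of \<open>|\<xi>|\<^sup>s\<close> (index \<open>None\<close>) and of \<open>|\<xi>|\<^sup>s\<^sup>-\<^sup>1 \<xi>\<close> (index \<open>Some j\<close>).\<close>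

definition hsym :: "'n option \<Rightarrow> real \<Rightarrow> 'n::finite rspace \<Rightarrow> complex"
  where "hsym i s x = (case i of None \<Rightarrow> complex_of_real (norm x powr s)
     | Some j \<Rightarrow> complex_of_real (x $ j) * complex_of_real (norm x powr (s - 1)))"

lemma hsym_measurable [measurable]: "hsym i s \<in> borel_measurable borel"
  unfolding hsym_def[abs_def] by (cases i) simp_all

lemma hsym_scale: "c > 0 \<Longrightarrow> hsym i s (c *\<^sub>R x) = complex_of_real (c powr s) * hsym i s x"
  by (cases i) (simp_all add: hsym_def powr_mult powr_diff divide_simps)

lemma hsym_norm_le: "norm (hsym i s x) \<le> norm x powr s"
proof (cases i)
  case (Some j)
  have "\<bar>x $ j\<bar> * norm x powr (s - 1) \<le> norm x * norm x powr (s - 1)"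
    by (intro mult_right_mono component_le_norm_cart) auto
  also have "\<dots> = norm x powr s" by (simp add: powr_diff)
  finally show ?thesis by (simp add: hsym_def Some norm_mult)
qed (simp add: hsym_def)

lemma hsym_continuous:
  fixes x :: "'n::finite rspace"
  assumes "s > 0"
  shows "continuous_on UNIV (hsym i s :: 'n rspace \<Rightarrow> complex)"
proof (rule continuous_at_imp_continuous_on, intro ballI)
  fix x :: "'n rspace"
  show "isCont (hsym i s) x"
  proof (cases "x = 0")
    case False
    then show ?thesis
      unfolding hsym_def[abs_def] by (cases i) (auto intro!: continuous_intros)
  next
    case True
    have "((\<lambda>y::'n rspace. norm y powr s) \<longlongrightarrow> 0) (at 0)"
    proof -
      have "((\<lambda>y::'n rspace. norm y powr s) \<longlongrightarrow> norm (0::'n rspace) powr s) (at 0)"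
        by (rule tendsto_powr') (use assms tendsto_norm[OF tendsto_ident_at[of "0::'n rspace" UNIV]] in auto)
      then show ?thesis by simp
    qed
    then have "(hsym i s \<longlongrightarrow> 0) (at (0::'n rspace))"
      by (rule Lim_null_comparison[rotated]) (intro always_eventually allI hsym_norm_le)
    moreover have "hsym i s (0::'n rspace) = 0" by (cases i) (simp_all add: hsym_def)
    ultimately show ?thesis using True by (simp add: isCont_def)
  qed
qed

section \<open>Coordinate symbols on annuli and near the origin\<close>

lemma slow_off_hsym:
  assumes "slow_off \<epsilon> \<psi>" "\<epsilon> > 0"
  shows "slow_off \<epsilon> (\<lambda>x. \<psi> x * hsym i s x)"
proof (cases i)
  case None
  then show ?thesis using slow_off_powr[OF assms] by (simp add: hsym_def)
next
  case (Some j)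
  have "slow_off \<epsilon> (\<lambda>x. \<psi> x * complex_of_real (x $ j))"
    using slow_off_coord[OF assms(1), of 1 j] by simp
  from slow_off_powr[OF this assms(2), of "s - 1"] show ?thesis
    by (simp add: hsym_def Some mult.assoc)
qed

lemma annular_coord: "annular \<epsilon> M \<phi> \<Longrightarrow> annular \<epsilon> M (\<lambda>x. \<phi> x * complex_of_real (x $ j))"
  by (simp add: annular_def smooth_mult)

lemma annular_hsym:
  assumes "annular \<epsilon> M \<phi>" "\<epsilon> > 0"
  shows "annular \<epsilon> M (\<lambda>x. \<phi> x * hsym i s x)"
proof (cases i)
  case None
  then show ?thesis using annular_powr[OF assms] by (simp add: hsym_def)
next
  case (Some j)
  from annular_powr[OF annular_coord[OF assms(1)] assms(2), of j "s - 1"] show ?thesis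
    by (simp add: hsym_def Some mult.assoc)
qed

text \<open>For a vector coordinate the coordinate function joins the annular factor and the
  exponent drops to \<open>s - 1\<close>. This changes \<open>B\<close> to
  \<open>B / \<epsilon>\<close>, because \<open>norm x\<close> is at least \<epsilon>, and is the
  reason for \<open>2 + \<bar>s\<bar>\<close>, which dominates
  \<open>1 + \<bar>s - 1\<bar>\<close>.\<close>

lemma annular_hsym_bound:
  fixes \<phi> :: "'n::finite rspace \<Rightarrow> complex"
  assumes a: "annular \<epsilon> M \<phi>" and e: "\<epsilon> > 0"
  shows "\<exists>C\<ge>0. \<forall>s B \<xi>. 0 \<le> B \<longrightarrow> (\<forall>x::'n rspace. \<epsilon> \<le> norm x \<longrightarrow> norm x \<le> M \<longrightarrow> norm x powr s \<le> B) \<longrightarrow>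
     norm (ft (\<lambda>x. \<phi> x * hsym i s x) \<xi>) \<le> C * (2 + \<bar>s\<bar>) ^ (2 * CARD('n)) * B * wgt \<xi>"
proof (cases i)
  case None
  obtain C where C: "C \<ge> 0" "\<And>s B \<xi>. 0 \<le> B \<Longrightarrow> (\<And>x::'n rspace. \<epsilon> \<le> norm x \<Longrightarrow> norm x \<le> M \<Longrightarrow> norm x powr s \<le> B) \<Longrightarrow>
     norm (ft (\<lambda>x. \<phi> x * complex_of_real (norm x powr s)) \<xi>) \<le> C * (1 + \<bar>s\<bar>) ^ (2 * CARD('n)) * B * wgt \<xi>"
    using annular_ft_bound[OF a e] by blast
  have "norm (ft (\<lambda>x. \<phi> x * hsym i s x) \<xi>) \<le> C * (2 + \<bar>s\<bar>) ^ (2 * CARD('n)) * B * wgt \<xi>"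
    if "0 \<le> B" "\<And>x::'n rspace. \<epsilon> \<le> norm x \<Longrightarrow> norm x \<le> M \<Longrightarrow> norm x powr s \<le> B" for s B \<xi>
  proof -
    have "norm (ft (\<lambda>x. \<phi> x * hsym i s x) \<xi>) \<le> C * (1 + \<bar>s\<bar>) ^ (2 * CARD('n)) * B * wgt \<xi>"
      using C(2)[OF that] by (simp add: hsym_def None)
    also have "\<dots> \<le> C * (2 + \<bar>s\<bar>) ^ (2 * CARD('n)) * B * wgt \<xi>"
      by (intro mult_right_mono mult_left_mono power_mono) (use C(1) that wgt_pos[of \<xi>] in auto)
    finally show ?thesis .
  qed
  then show ?thesis using C(1) by blast
next
  case (Some j)
  obtain C where C: "C \<ge> 0" "\<And>s B \<xi>. 0 \<le> B \<Longrightarrow> (\<And>x::'n rspace. \<epsilon> \<le> norm x \<Longrightarrow> norm x \<le> M \<Longrightarrow> norm x powr s \<le> B) \<Longrightarrow>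
     norm (ft (\<lambda>x. (\<phi> x * complex_of_real (x $ j)) * complex_of_real (norm x powr s)) \<xi>) \<le> C * (1 + \<bar>s\<bar>) ^ (2 * CARD('n)) * B * wgt \<xi>"
    using annular_ft_bound[OF annular_coord[OF a] e] by blast
  have "norm (ft (\<lambda>x. \<phi> x * hsym i s x) \<xi>) \<le> (C / \<epsilon>) * (2 + \<bar>s\<bar>) ^ (2 * CARD('n)) * B * wgt \<xi>"
    if B: "0 \<le> B" "\<And>x::'n rspace. \<epsilon> \<le> norm x \<Longrightarrow> norm x \<le> M \<Longrightarrow> norm x powr s \<le> B" for s B \<xi>
  proof -
    have "norm x powr (s - 1) \<le> B / \<epsilon>" if "\<epsilon> \<le> norm x" "norm x \<le> M" for x :: "'n rspace"
    proof -
      have "norm x powr (s - 1) = norm x powr s / norm x"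
        using that e by (simp add: powr_diff)
      also have "\<dots> \<le> B / \<epsilon>" by (intro frac_le B that e)
      finally show ?thesis .
    qed
    then have "norm (ft (\<lambda>x. \<phi> x * hsym i s x) \<xi>) \<le> C * (1 + \<bar>s - 1\<bar>) ^ (2 * CARD('n)) * (B / \<epsilon>) * wgt \<xi>"
      using C(2)[of "B / \<epsilon>" "s - 1" \<xi>] B(1) e by (simp add: hsym_def Some mult.assoc)
    also have "\<dots> \<le> C * (2 + \<bar>s\<bar>) ^ (2 * CARD('n)) * (B / \<epsilon>) * wgt \<xi>"
      by (intro mult_right_mono mult_left_mono power_mono) (use C(1) B e wgt_pos[of \<xi>] in auto)
    finally show ?thesis by simp
  qed
  moreover have "C / \<epsilon> \<ge> 0" using C(1) e by simp
  ultimately show ?thesis by blast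
qed

text \<open>The factor \<open>b powr s\<close> is the maximum of |x|^s on the outermost dyadic
  annulus, and 1/(1 - 2^(-s)) sums the geometric series of the smaller ones. Since \<open>C\<close>
  is independent of \<open>s\<close>, only the outer radius \<open>b\<close> survives in the limit
  of roots.\<close>

lemma cutoff_hsym_L1:
  fixes \<zeta> :: "'n::finite rspace \<Rightarrow> complex"
  assumes \<zeta>: "cutoff a b \<zeta>"
  shows "\<exists>C\<ge>0. \<forall>s>0. integrable lborel (\<lambda>x. \<zeta> x * hsym i s x) \<and> integrable lborel (ft (\<lambda>x. \<zeta> x * hsym i s x)) \<and>
    (LINT \<xi>|lborel. norm (ft (\<lambda>x. \<zeta> x * hsym i s x) \<xi>)) \<le> C * (2 + s) ^ (2 * CARD('n)) * b powr s / (1 - 2 powr (- s))"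
proof -
  have ab: "a > 0" "b > 0" using \<zeta> by (auto simp: cutoff_def)
  let ?W = "LINT x|lborel. wgt (x::'n rspace)"
  have "a / 2 > 0" using ab by simp
  from annular_hsym_bound[OF cutoff_annular[OF \<zeta>] this] obtain C where C: "C \<ge> 0"
    "\<And>s B \<xi>. 0 \<le> B \<Longrightarrow> (\<And>x::'n rspace. a / 2 \<le> norm x \<Longrightarrow> norm x \<le> b \<Longrightarrow> norm x powr s \<le> B) \<Longrightarrow>
     norm (ft (\<lambda>x. (\<zeta> x - \<zeta> (2 *\<^sub>R x)) * hsym i s x) \<xi>) \<le> C * (2 + \<bar>s\<bar>) ^ (2 * CARD('n)) * B * wgt \<xi>"
    by blast
  have W0: "?W \<ge> 0" by (intro integral_nonneg_AE AE_I2 less_imp_le wgt_pos)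
  have "integrable lborel (\<lambda>x. \<zeta> x * hsym i s x) \<and> integrable lborel (ft (\<lambda>x. \<zeta> x * hsym i s x)) \<and>
    (LINT \<xi>|lborel. norm (ft (\<lambda>x. \<zeta> x * hsym i s x) \<xi>)) \<le> (C * ?W) * (2 + s) ^ (2 * CARD('n)) * b powr s / (1 - 2 powr (- s))"
    if s: "s > 0" for s
  proof -
    have K: "norm (ft (\<lambda>x. (\<zeta> x - \<zeta> (2 *\<^sub>R x)) * hsym i s x) \<xi>) \<le> (C * (2 + s) ^ (2 * CARD('n)) * b powr s) * wgt \<xi>" for \<xi>
      using C(2)[of "b powr s" s \<xi>] s by (simp add: powr_mono2)
    note d = dyadic_ft_L1[OF s \<zeta> hsym_measurable hsym_scale hsym_norm_le K]
    then show ?thesis by (simp add: mult_ac)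
  qed
  then show ?thesis using C(1) W0 by (intro exI[of _ "C * ?W"]) simp
qed

lemma ift_L1:
  fixes g :: "'n::finite rspace \<Rightarrow> complex"
  assumes "integrable lborel (ft g)"
  shows "integrable lborel (ift g)"
    and "(LINT x|lborel. norm (ift g x)) \<le> (LINT x|lborel. norm (ft g x))"
proof -
  let ?c = "1 / (2 * pi) ^ CARD('n)"
  show "integrable lborel (ift g)"
    unfolding ift_eq_ft[abs_def]
    using assms integrable_reflect[of "ft g" 0] by (intro integrable_mult_right) simp
  have "(LINT x|lborel. norm (ift g x)) = ?c * (LINT x|lborel. norm (ft g x))"
    unfolding ift_eq_ft using integral_reflect[of "\<lambda>x. norm (ft g x)" 0]
    by (simp add: norm_mult norm_divide norm_power)
  also have "\<dots> \<le> 1 * (LINT x|lborel. norm (ft g x))"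
  proof (rule mult_right_mono)
    have "1 \<le> (2 * pi) ^ CARD('n)"
      by (rule one_le_power) (use pi_gt3 in simp)
    then show "?c \<le> 1" by (simp add: divide_le_eq_1)
  qed (simp add: integral_nonneg_AE)
  finally show "(LINT x|lborel. norm (ift g x)) \<le> (LINT x|lborel. norm (ft g x))" by simp
qed

lemma ift_ft_schwartz: "schwartz \<phi> \<Longrightarrow> ift (ft \<phi>) = \<phi>"
  using fourier_inversion[OF schwartz_wiener] by blast

lemma ft_mult_L1:
  fixes \<phi> h :: "'n::finite rspace \<Rightarrow> complex"
  assumes \<phi>: "schwartz \<phi>" and h: "integrable lborel h" "integrable lborel (ft h)"
  shows "integrable lborel (ft (\<lambda>x. \<phi> x * h x))"
    and "(LINT \<xi>|lborel. norm (ft (\<lambda>x. \<phi> x * h x) \<xi>))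
       \<le> (LINT x|lborel. norm (ft \<phi> x)) * (LINT x|lborel. norm (ft h x))"
proof -
  have i: "integrable lborel (ft \<phi>)" by (intro schwartz_integrable ft_schwartz \<phi>)
  have e: "ft (\<lambda>x. \<phi> x * h x) = (\<lambda>y. LINT x|lborel. ft \<phi> x * ift h (x - y))"
    using ft_ift_mult[OF i h(1)] by (simp add: ift_ft_schwartz[OF \<phi>] fun_eq_iff)
  note c = convolution_L1[OF i ift_L1(1)[OF h(2)]]
  show "integrable lborel (ft (\<lambda>x. \<phi> x * h x))" unfolding e by (rule c)
  have "(LINT \<xi>|lborel. norm (ft (\<lambda>x. \<phi> x * h x) \<xi>)) \<le> (LINT x|lborel. norm (ft \<phi> x)) * (LINT x|lborel. norm (ift h x))"
    unfolding e by (rule c)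
  also have "\<dots> \<le> (LINT x|lborel. norm (ft \<phi> x)) * (LINT x|lborel. norm (ft h x))"
    by (intro mult_left_mono ift_L1 h) (simp add: integral_nonneg_AE)
  finally show "(LINT \<xi>|lborel. norm (ft (\<lambda>x. \<phi> x * h x) \<xi>))
       \<le> (LINT x|lborel. norm (ft \<phi> x)) * (LINT x|lborel. norm (ft h x))" .
qed

lemma slow_off_one_minus_cutoff: "cutoff a b \<zeta> \<Longrightarrow> slow_off a (\<lambda>x. 1 - \<zeta> x)"
  using cutoff_slow[of a b \<zeta>] by (auto simp: slow_off_def cutoff_def intro: slow_diff slow_const)

text \<open>A cutoff splits the product. Near the origin the dyadic estimate gives an integrable
  transform; away from it the symbol is smooth and slowly increasing, and the product is a Schwartz
  function.\<close>

lemma wiener_mult_hsym: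
  fixes \<phi> :: "'n::finite rspace \<Rightarrow> complex"
  assumes \<phi>: "schwartz \<phi>" and s: "s > 0"
  shows "wiener (\<lambda>x. \<phi> x * hsym i s x)"
proof -
  obtain \<zeta> :: "'n rspace \<Rightarrow> complex" where \<zeta>: "cutoff 1 2 \<zeta>"
    using cutoff_exists[of 1 2] by auto
  have z: "integrable lborel (\<lambda>x. \<zeta> x * hsym i s x)" "integrable lborel (ft (\<lambda>x. \<zeta> x * hsym i s x))"
    using cutoff_hsym_L1[OF \<zeta>, of i] s by blast+
  have bd1: "bounded (range (\<lambda>x. \<phi> x * (\<zeta> x * hsym i s x)))"
  proof -
    obtain P where P: "\<And>x. norm (\<phi> x) \<le> P" using schwartz_bounded[OF \<phi>] unfolding bounded_iff by auto
    obtain Z where Z: "\<And>x. norm (\<zeta> x) \<le> Z"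
      using schwartz_bounded[OF cutoff_schwartz[OF \<zeta>]] unfolding bounded_iff by auto
    have Z0: "Z \<ge> 0" "P \<ge> 0" using order_trans[OF norm_ge_zero Z[of 0]] order_trans[OF norm_ge_zero P[of 0]] by auto
    have "norm (\<phi> x * (\<zeta> x * hsym i s x)) \<le> P * (Z * 2 powr s)" for x
    proof (cases "norm x < 2")
      case True
      then have "norm (hsym i s x) \<le> 2 powr s"
        using order_trans[OF hsym_norm_le powr_mono2[of s "norm x" 2]] s by simp
      then show ?thesis unfolding norm_mult by (intro mult_mono P Z) (use Z0 in auto)
    next
      case False
      then have "\<zeta> x = 0" using \<zeta> by (auto simp: cutoff_def)
      then show ?thesis using Z0 by simp
    qed
    then show ?thesis unfolding bounded_iff by blast
  qed
  have "wiener (\<lambda>x. \<phi> x * (\<zeta> x * hsym i s x))"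
    unfolding wiener_def
  proof (intro conjI bd1)
    show c: "continuous_on UNIV (\<lambda>x. \<phi> x * (\<zeta> x * hsym i s x))"
      by (intro continuous_on_mult hsym_continuous s smooth_continuous[OF schwartz_smooth[OF \<phi>]]
          smooth_continuous[OF cutoff_smooth_vanish(1)[OF \<zeta>]])
    obtain P where P: "\<And>x. norm (\<phi> x) \<le> P" using schwartz_bounded[OF \<phi>] unfolding bounded_iff by auto
    have "integrable lborel (\<lambda>x. complex_of_real P * (\<zeta> x * hsym i s x))"
      by (intro integrable_mult_right z)
    then show "integrable lborel (\<lambda>x. \<phi> x * (\<zeta> x * hsym i s x))"
    proof (rule Bochner_Integration.integrable_bound)
      show "(\<lambda>x. \<phi> x * (\<zeta> x * hsym i s x)) \<in> borel_measurable lborel"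
        using borel_measurable_continuous_onI[OF c] by simp
      show "AE x in lborel. norm (\<phi> x * (\<zeta> x * hsym i s x)) \<le> norm (complex_of_real P * (\<zeta> x * hsym i s x))"
        unfolding norm_mult by (intro AE_I2 mult_right_mono) (auto intro: order_trans[OF P] )
    qed
    show "integrable lborel (ft (\<lambda>x. \<phi> x * (\<zeta> x * hsym i s x)))"
      by (rule ft_mult_L1(1)[OF \<phi> z])
  qed
  moreover have "wiener (\<lambda>x. \<phi> x * ((1 - \<zeta> x) * hsym i s x))"
    using slow_off_hsym[OF slow_off_one_minus_cutoff[OF \<zeta>], of i s]
    by (intro schwartz_wiener schwartz_mult \<phi>) (simp add: slow_off_def)
  ultimately have "wiener (\<lambda>x. \<phi> x * (\<zeta> x * hsym i s x) + \<phi> x * ((1 - \<zeta> x) * hsym i s x))"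
    by (rule wiener_add)
  then show ?thesis by (simp add: algebra_simps)
qed

section \<open>Inequalities of Jensen and Young\<close>

text \<open>A convex function lies above its tangent at \<open>t\<close>. For \<open>p > 1\<close>
  this is Young's inequality applied to \<open>x\<close> and \<open>t powr (p - 1)\<close>.\<close>

lemma powr_tangent:
  fixes x t p :: real
  assumes "x \<ge> 0" "t > 0" "p \<ge> 1"
  shows "t powr p + p * t powr (p - 1) * (x - t) \<le> x powr p"
proof (cases "p = 1")
  case True
  then show ?thesis using assms by simp
next
  case False
  define q where "q = p / (p - 1)"
  have p: "p > 1" "q > 1" "1 / p + 1 / q = 1"
    using False assms by (auto simp: q_def field_simps)
  have "x * t powr (p - 1) \<le> x powr p / p + (t powr (p - 1)) powr q / q"
    using Youngs_inequality[of p q x "t powr (p - 1)"] p assms by simp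
  also have "(t powr (p - 1)) powr q = t powr p"
    using p by (simp add: powr_powr q_def)
  finally have 1: "x * t powr (p - 1) \<le> x powr p / p + t powr p / q" .
  have "1 / q = 1 - 1 / p" using p by simp
  then have "t powr p / q = t powr p * (1 - 1 / p)" by (metis times_divide_eq_right mult.right_neutral)
  with 1 have "p * (x * t powr (p - 1)) \<le> p * (x powr p / p + t powr p * (1 - 1 / p))"
    using p by (intro mult_left_mono) auto
  also have "\<dots> = x powr p + (p - 1) * t powr p" using p by (simp add: field_simps)
  finally have "p * x * t powr (p - 1) \<le> x powr p + (p - 1) * t powr p" by (simp add: mult.assoc)
  moreover have "t powr p = t * t powr (p - 1)" using assms by (simp add: powr_diff)
  ultimately show ?thesis by (simp add: algebra_simps)
qed

lemma le_one_plus_powr: "0 \<le> x \<Longrightarrow> 1 \<le> p \<Longrightarrow> x \<le> 1 + x powr p" for x p :: real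
  using powr_mono[of 1 p x] by (cases "x \<le> 1") (auto intro: add_increasing2)

text \<open>The tangent inequality at the weighted mean of \<open>F\<close>, integrated against
  \<open>w\<close>. The weight need not have mass 1, which accounts for the power
  \<open>p - 1\<close> of its integral.\<close>

lemma jensen_powr:
  fixes w F :: "'a \<Rightarrow> real"
  assumes [measurable]: "F \<in> borel_measurable M" and w: "integrable M w" and wF: "integrable M (\<lambda>y. w y * F y powr p)"
    and nn: "\<And>y. w y \<ge> 0" "\<And>y. F y \<ge> 0" and p: "p \<ge> 1"
  shows "integrable M (\<lambda>y. w y * F y)"
    and "(LINT y|M. w y * F y) powr p \<le> (LINT y|M. w y) powr (p - 1) * (LINT y|M. w y * F y powr p)"
proof -
  have [measurable]: "w \<in> borel_measurable M" using w by auto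
  show i: "integrable M (\<lambda>y. w y * F y)"
  proof (rule Bochner_Integration.integrable_bound)
    show "integrable M (\<lambda>y. w y + w y * F y powr p)" using w wF by simp
    show "AE y in M. norm (w y * F y) \<le> norm (w y + w y * F y powr p)"
    proof (intro AE_I2)
      fix y
      have "w y * F y \<le> w y * (1 + F y powr p)"
        by (intro mult_left_mono le_one_plus_powr nn p)
      then show "norm (w y * F y) \<le> norm (w y + w y * F y powr p)"
        using nn[of y] by (simp add: distrib_left)
    qed
  qed measurable
  define A I J where "A = (LINT y|M. w y)" and "I = (LINT y|M. w y * F y)" and "J = (LINT y|M. w y * F y powr p)"
  have nn': "A \<ge> 0" "I \<ge> 0" "J \<ge> 0"
    unfolding A_def I_def J_def using nn by (auto intro!: integral_nonneg_AE)
  show "I powr p \<le> A powr (p - 1) * J"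
  proof (cases "A = 0 \<or> I = 0")
    case True
    have "I = 0"
    proof (cases "A = 0")
      case True
      then have "AE y in M. w y = 0"
        using integral_nonneg_eq_0_iff_AE[OF w] nn unfolding A_def by simp
      then have "(LINT y|M. w y * F y) = (LINT y|M. 0)"
        by (intro integral_cong_AE) auto
      then show ?thesis by (simp add: I_def)
    qed (use True in simp)
    then show ?thesis using nn' by simp
  next
    case False
    then have pos: "A > 0" "I > 0" using nn' by auto
    \<comment> \<open>The mean of \<open>F\<close> with respect to \<open>w\<close>; with this
      choice the linear term of the tangent integrates to 0.\<close>
    define t where "t = I / A"
    have t: "t > 0" using pos by (simp add: t_def)
    have "(LINT y|M. t powr p * w y + p * t powr (p - 1) * (w y * F y - t * w y)) \<le> J"
      unfolding J_def
    proof (rule integral_mono)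
      show "integrable M (\<lambda>y. t powr p * w y + p * t powr (p - 1) * (w y * F y - t * w y))"
        using w i by simp
      fix y
      have "w y * (t powr p + p * t powr (p - 1) * (F y - t)) \<le> w y * F y powr p"
        by (intro mult_left_mono powr_tangent nn t p)
      then show "t powr p * w y + p * t powr (p - 1) * (w y * F y - t * w y) \<le> w y * F y powr p"
        by (simp add: algebra_simps)
    qed (rule wF)
    also have "(LINT y|M. t powr p * w y + p * t powr (p - 1) * (w y * F y - t * w y))
      = t powr p * A + p * t powr (p - 1) * (I - t * A)"
      using w i by (simp add: A_def I_def)
    also have "I - t * A = 0" using pos by (simp add: t_def)
    finally have "t powr p * A \<le> J" by simp
    then have "A powr (p - 1) * (t powr p * A) \<le> A powr (p - 1) * J"
      by (intro mult_left_mono) auto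
    moreover have "A powr (p - 1) * (t powr p * A) = I powr p"
    proof -
      have "t powr p = I powr p / A powr p" using pos by (simp add: t_def powr_divide)
      moreover have "A powr (p - 1) * A = A powr p" using pos by (simp add: powr_diff)
      ultimately have "A powr (p - 1) * (t powr p * A) = A powr p * (I powr p / A powr p)"
        by (metis mult.assoc mult.commute)
      then show ?thesis using pos by simp
    qed
    ultimately show ?thesis by simp
  qed
qed

text \<open>For almost every \<open>x\<close>, Jensen's inequality with the weight
  \<open>c (x - y)\<close> bounds the p-th power by a convolution of integrable functions, and
  Fubini evaluates its integral. \<open>E\<close> is only assumed to be dominated by a scalar
  convolution kernel, so that Clifford products are covered.\<close>

lemma young_convolution:
  fixes E :: "'n::finite rspace \<Rightarrow> 'n rspace \<Rightarrow> 'v::{banach,second_countable_topology}" and c F :: "'n rspace \<Rightarrow> real"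
  assumes E: "case_prod E \<in> borel_measurable (borel \<Otimes>\<^sub>M borel)"
    and c: "integrable lborel c" and Fm[measurable]: "F \<in> borel_measurable borel"
    and F: "integrable lborel (\<lambda>y. F y powr p)"
    and nn: "\<And>y. c y \<ge> 0" "\<And>y. F y \<ge> 0" and p: "p \<ge> 1"
    and le: "\<And>x y. norm (E x y) \<le> c (x - y) * F y"
  shows "integrable lborel (\<lambda>x. norm (LINT y|lborel. E x y) powr p)"
    and "(LINT x|lborel. norm (LINT y|lborel. E x y) powr p)
      \<le> (LINT y|lborel. c y) powr p * (LINT y|lborel. F y powr p)"
    and "(\<lambda>x. LINT y|lborel. E x y) \<in> borel_measurable borel"
proof -
  have [measurable]: "c \<in> borel_measurable borel" using c by auto
  have E'[measurable]: "case_prod E \<in> borel_measurable (lborel \<Otimes>\<^sub>M lborel)"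
    using E by (simp cong: measurable_cong_sets sets_pair_measure_cong)
  define A where "A = (LINT y|lborel. c y)"
  define v where "v x = (LINT y|lborel. c (x - y) * F y powr p)" for x
  have A0: "A \<ge> 0" unfolding A_def using nn by (auto intro!: integral_nonneg_AE)
  show m: "(\<lambda>x. LINT y|lborel. E x y) \<in> borel_measurable borel"
    using lborel.borel_measurable_lebesgue_integral[OF E'] by simp
  have c': "integrable lborel (\<lambda>z. c (- z))" using integrable_reflect[of c 0] c by simp
  note pr = convolution_pair_integrable[OF F c']
  have v: "integrable lborel v"
    using lborel_pair.integrable_snd[OF pr] by (simp add: v_def[abs_def] mult.commute)
  have vI: "(LINT x|lborel. v x) = A * (LINT y|lborel. F y powr p)"
  proof -
    have "(LINT x|lborel. v x) = (LINT x|lborel. LINT y|lborel. F y powr p * c (- (y - x)))"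
      by (simp add: v_def mult.commute)
    also have "\<dots> = (LINT y|lborel. LINT x|lborel. F y powr p * c (- (y - x)))"
      using lborel_pair.Fubini_integral[OF pr] .
    also have "\<dots> = (LINT y|lborel. F y powr p * A)"
    proof -
      have "(LINT x|lborel. c (- (y - x))) = A" for y
        using integral_translate[of c "- y"] by (simp add: A_def)
      then show ?thesis by simp
    qed
    finally show ?thesis by (simp add: mult.commute)
  qed
  have ae: "AE x in lborel. norm (LINT y|lborel. E x y) powr p \<le> A powr (p - 1) * v x"
    using lborel_pair.AE_integrable_snd[OF pr]
  proof (rule eventually_mono)
    fix x assume "integrable lborel (\<lambda>y. F y powr p * c (- (y - x)))"
    then have i1: "integrable lborel (\<lambda>y. c (x - y) * F y powr p)" by (simp add: mult.commute)
    have i2: "integrable lborel (\<lambda>y. c (x - y))" using c integrable_reflect by blast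
    have Fm': "F \<in> borel_measurable lborel" by simp
    note j = jensen_powr[OF Fm' i2 i1 nn p]
    have "norm (LINT y|lborel. E x y) \<le> (LINT y|lborel. c (x - y) * F y)"
    proof (rule Bochner_Integration.integral_norm_bound_integral[OF _ j(1) le])
      show "integrable lborel (E x)"
        by (rule Bochner_Integration.integrable_bound[OF j(1)])
           (simp, intro AE_I2, unfold real_norm_def, rule order_trans[OF le abs_ge_self])
    qed
    then have "norm (LINT y|lborel. E x y) powr p \<le> (LINT y|lborel. c (x - y) * F y) powr p"
      using p by (intro powr_mono2) auto
    also have "\<dots> \<le> A powr (p - 1) * v x"
      using j(2) integral_reflect[of c x] by (simp add: A_def v_def)
    finally show "norm (LINT y|lborel. E x y) powr p \<le> A powr (p - 1) * v x" .
  qed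
  have iv: "integrable lborel (\<lambda>x. A powr (p - 1) * v x)" using v by simp
  show i: "integrable lborel (\<lambda>x. norm (LINT y|lborel. E x y) powr p)"
    by (rule Bochner_Integration.integrable_bound[OF iv])
       (use m ae in \<open>auto elim!: eventually_mono intro: order_trans[OF _ abs_ge_self]\<close>)
  have "(LINT x|lborel. norm (LINT y|lborel. E x y) powr p) \<le> (LINT x|lborel. A powr (p - 1) * v x)"
    by (rule integral_mono_AE[OF i iv ae])
  also have "\<dots> = A powr (p - 1) * A * (LINT y|lborel. F y powr p)"
    by (simp add: vI)
  also have "A powr (p - 1) * A = A powr p"
    using A0 p by (cases "A = 0") (auto simp: powr_diff)
  finally show "(LINT x|lborel. norm (LINT y|lborel. E x y) powr p)
      \<le> (LINT y|lborel. c y) powr p * (LINT y|lborel. F y powr p)" by (simp add: A_def)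
qed

text \<open>Since \<open>F\<close> is at most 1 + \<open>F powr p\<close>, the majorant splits into
  two terms. The first is integrable on the product because \<open>b\<close> and \<open>c\<close>
  are, the second because \<open>b\<close> is bounded while \<open>c\<close> and the p-th power of
  \<open>F\<close> are integrable.\<close>

lemma convolution_fubini:
  fixes T :: "'n::finite rspace \<Rightarrow> 'n rspace \<Rightarrow> 'v::{banach,second_countable_topology}" and b c F :: "'n rspace \<Rightarrow> real"
  assumes T: "case_prod T \<in> borel_measurable (borel \<Otimes>\<^sub>M borel)"
    and b: "integrable lborel b" "\<And>x. b x \<le> B"
    and c: "integrable lborel c" and Fm[measurable]: "F \<in> borel_measurable borel"
    and F: "integrable lborel (\<lambda>y. F y powr p)"
    and nn: "\<And>y. b y \<ge> 0" "\<And>y. c y \<ge> 0" "\<And>y. F y \<ge> 0" and p: "p \<ge> 1"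
    and le: "\<And>x y. norm (T x y) \<le> b x * c (x - y) * F y"
  shows "(LINT x|lborel. LINT y|lborel. T x y) = (LINT y|lborel. LINT x|lborel. T x y)"
proof -
  have T'[measurable]: "case_prod T \<in> borel_measurable (lborel \<Otimes>\<^sub>M lborel)"
    using T by (simp cong: measurable_cong_sets sets_pair_measure_cong)
  have c': "integrable lborel (\<lambda>z. c (- z))" using integrable_reflect[of c 0] c by simp
  have i1: "integrable (lborel \<Otimes>\<^sub>M lborel) (\<lambda>(x, y). b x * c (x - y))"
    by (rule convolution_pair_integrable[OF b(1) c])
  have i2: "integrable (lborel \<Otimes>\<^sub>M lborel) (\<lambda>(x, y). F y powr p * c (x - y))"
    using lborel_pair.integrable_product_swap[OF convolution_pair_integrable[OF F c']]
    by (simp add: case_prod_unfold)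
  have i3: "integrable (lborel \<Otimes>\<^sub>M lborel) (\<lambda>z. (case z of (x, y) \<Rightarrow> b x * c (x - y)) + B * (case z of (x, y) \<Rightarrow> F y powr p * c (x - y)))"
    using i1 i2 by (intro Bochner_Integration.integrable_add integrable_mult_right)
  have "integrable (lborel \<Otimes>\<^sub>M lborel) (case_prod T)"
  proof (rule Bochner_Integration.integrable_bound[OF i3 T'], intro AE_I2)
    fix z :: "'n rspace \<times> 'n rspace"
    obtain x y where z: "z = (x, y)" by force
    have "norm (T x y) \<le> b x * c (x - y) * F y" by (rule le)
    also have "\<dots> \<le> b x * c (x - y) * (1 + F y powr p)"
      by (intro mult_left_mono le_one_plus_powr nn p mult_nonneg_nonneg)
    also have "\<dots> = b x * c (x - y) + b x * (F y powr p * c (x - y))"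
      by (simp add: algebra_simps)
    also have "\<dots> \<le> b x * c (x - y) + B * (F y powr p * c (x - y))"
      by (intro add_left_mono mult_right_mono b mult_nonneg_nonneg nn) auto
    finally show "norm (case z of (x, y) \<Rightarrow> T x y) \<le> norm ((case z of (x, y) \<Rightarrow> b x * c (x - y)) + B * (case z of (x, y) \<Rightarrow> F y powr p * c (x - y)))"
      by (simp add: z)
  qed
  from lborel_pair.Fubini_integral[OF this] show ?thesis by simp
qed

section \<open>The Clifford algebra as a normed algebra\<close>

text \<open>The inversions and the common indices together are the pairs with
  \<open>b \<le> a\<close>. A product over all pairs behaves well under symmetric differences, which
  counting does not.\<close>

lemma blade_sign_prod:
  "blade_sign A B = (\<Prod>a\<in>A. \<Prod>b\<in>B. if b \<le> a then - 1 else 1)"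
proof -
  have fin: "finite (A \<times> B)" by simp
  have "(\<Prod>a\<in>A. \<Prod>b\<in>B. if b \<le> a then - 1 else (1::complex)) = (\<Prod>z\<in>A \<times> B. if snd z \<le> fst z then - 1 else 1)"
    by (simp add: prod.cartesian_product case_prod_unfold)
  also have "\<dots> = (- 1) ^ card {z \<in> A \<times> B. snd z \<le> fst z}"
    by (subst prod.If_cases[OF fin]) (simp add: Int_def conj_commute)
  also have "{z \<in> A \<times> B. snd z \<le> fst z} = {(a, b). a \<in> A \<and> b \<in> B \<and> b < a} \<union> (\<lambda>a. (a, a)) ` (A \<inter> B)"
    by (auto simp: le_less)
  also have "card \<dots> = card {(a, b). a \<in> A \<and> b \<in> B \<and> b < a} + card ((\<lambda>a. (a, a)) ` (A \<inter> B))"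
    by (rule card_Un_disjoint) auto
  also have "card ((\<lambda>a. (a, a)) ` (A \<inter> B)) = card (A \<inter> B)"
    by (rule card_image) (auto simp: inj_on_def)
  finally show ?thesis by (simp add: blade_sign_def)
qed

lemma prod_sym_diff:
  fixes f :: "'n::finite \<Rightarrow> complex"
  assumes "\<And>a. f a * f a = 1"
  shows "(\<Prod>a\<in>sym_diff A A'. f a) = (\<Prod>a\<in>A. f a) * (\<Prod>a\<in>A'. f a)"
proof -
  have 1: "(\<Prod>a\<in>A. f a) = (\<Prod>a\<in>A - A'. f a) * (\<Prod>a\<in>A \<inter> A'. f a)"
    by (subst prod.union_disjoint[symmetric]) (auto intro!: prod.cong)
  have 2: "(\<Prod>a\<in>A'. f a) = (\<Prod>a\<in>A' - A. f a) * (\<Prod>a\<in>A \<inter> A'. f a)"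
    by (subst prod.union_disjoint[symmetric]) (auto intro!: prod.cong)
  have 3: "(\<Prod>a\<in>A \<inter> A'. f a) * (\<Prod>a\<in>A \<inter> A'. f a) = 1"
    by (simp add: assms flip: prod.distrib)
  have "(\<Prod>a\<in>sym_diff A A'. f a) = (\<Prod>a\<in>A - A'. f a) * (\<Prod>a\<in>A' - A. f a)"
    by (rule prod.union_disjoint) auto
  also have "\<dots> = ((\<Prod>a\<in>A - A'. f a) * (\<Prod>a\<in>A' - A. f a)) * ((\<Prod>a\<in>A \<inter> A'. f a) * (\<Prod>a\<in>A \<inter> A'. f a))"
    by (simp add: 3)
  finally show ?thesis unfolding 1 2 by (simp add: mult_ac)
qed

text \<open>Elements common to \<open>A\<close> and \<open>A'\<close> contribute the square of a
  sign, so the sign is multiplicative in its first argument; the next lemma is the same for the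
  second.\<close>

lemma blade_sign_sym_diff_left: "blade_sign (sym_diff A A') B = blade_sign A B * blade_sign A' B"
proof -
  have "(\<Prod>b\<in>B. if b \<le> a then - 1 else 1) * (\<Prod>b\<in>B. if b \<le> a then - 1 else 1) = (1::complex)" for a
    unfolding prod.distrib[symmetric] by (rule prod.neutral) simp
  then show ?thesis unfolding blade_sign_prod by (rule prod_sym_diff)
qed

lemma blade_sign_sym_diff_right: "blade_sign A (sym_diff B B') = blade_sign A B * blade_sign A B'"
  unfolding blade_sign_prod prod.distrib[symmetric]
  by (intro prod.cong refl prod_sym_diff) auto

lemma cliff_mult_nth:
  "(x \<odot> y) $ C = (\<Sum>A\<in>UNIV. blade_sign A (sym_diff A C) * x $ A * y $ sym_diff A C)"
proof -
  have "{(A, B). sym_diff A B = C} = range (\<lambda>A. (A, sym_diff A C))" by auto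
  moreover have "inj (\<lambda>A. (A, sym_diff A C))" by (auto simp: inj_on_def)
  ultimately show ?thesis
    by (simp add: cliff_mult_def sum.reindex)
qed

lemma cliff_mult_add_left: "(x + y) \<odot> z = x \<odot> z + y \<odot> z"
  and cliff_mult_add_right: "z \<odot> (x + y) = z \<odot> x + z \<odot> y"
  and cliff_mult_smult_left: "(c *s x) \<odot> z = c *s (x \<odot> z)"
  and cliff_mult_smult_right: "x \<odot> (c *s z) = c *s (x \<odot> z)"
  by (simp_all add: vec_eq_iff cliff_mult_nth algebra_simps sum.distrib sum_distrib_left)

lemma sym_diff_cancel: "sym_diff A (sym_diff A C) = C" by auto

text \<open>After reindexing by symmetric differences, associativity is the cocycle identity for
  \<open>blade_sign\<close>. Both sides of it are the product of the signs of the pairs (A, B), (A,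
  G) and (B, G).\<close>

lemma cliff_mult_assoc: "(x \<odot> y) \<odot> z = x \<odot> (y \<odot> z)"
proof -
  have "((x \<odot> y) \<odot> z) $ D = (x \<odot> (y \<odot> z)) $ D" for D
  proof -
    let ?s = blade_sign
    have "((x \<odot> y) \<odot> z) $ D = (\<Sum>E\<in>UNIV. \<Sum>A\<in>UNIV. ?s E (sym_diff E D) * ?s A (sym_diff A E) * x $ A * y $ sym_diff A E * z $ sym_diff E D)"
      by (simp add: cliff_mult_nth sum_distrib_left sum_distrib_right mult_ac)
    also have "\<dots> = (\<Sum>A\<in>UNIV. \<Sum>E\<in>UNIV. ?s E (sym_diff E D) * ?s A (sym_diff A E) * x $ A * y $ sym_diff A E * z $ sym_diff E D)"
      by (rule sum.swap)
    also have "\<dots> = (\<Sum>A\<in>UNIV. \<Sum>B\<in>UNIV. ?s A (sym_diff A D) * x $ A * (?s B (sym_diff B (sym_diff A D)) * y $ B * z $ sym_diff B (sym_diff A D)))"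
    proof (rule sum.cong[OF refl])
      fix A
      have "(\<Sum>E\<in>UNIV. ?s E (sym_diff E D) * ?s A (sym_diff A E) * x $ A * y $ sym_diff A E * z $ sym_diff E D)
          = (\<Sum>B\<in>UNIV. ?s (sym_diff A B) (sym_diff (sym_diff A B) D) * ?s A B * x $ A * y $ B * z $ sym_diff (sym_diff A B) D)"
        by (rule sum.reindex_bij_witness[of _ "sym_diff A" "sym_diff A"]) (simp_all only: sym_diff_cancel UNIV_I)
      also have "\<dots> = (\<Sum>B\<in>UNIV. ?s A (sym_diff A D) * x $ A * (?s B (sym_diff B (sym_diff A D)) * y $ B * z $ sym_diff B (sym_diff A D)))"
      proof (rule sum.cong[OF refl])
        fix B
        define G where "G = sym_diff B (sym_diff A D)"
        have G: "sym_diff (sym_diff A B) D = G" "sym_diff A D = sym_diff B G" unfolding G_def by auto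
        have *: "?s (sym_diff A B) G * ?s A B = ?s A (sym_diff B G) * ?s B G"
          by (simp only: blade_sign_sym_diff_left blade_sign_sym_diff_right mult_ac)
        have "?s (sym_diff A B) G * ?s A B * x $ A * y $ B * z $ G = (?s (sym_diff A B) G * ?s A B) * (x $ A * y $ B * z $ G)"
          by (simp only: mult_ac)
        also have "\<dots> = ?s A (sym_diff B G) * x $ A * (?s B G * y $ B * z $ G)"
          unfolding * by (simp only: mult_ac)
        finally show "?s (sym_diff A B) (sym_diff (sym_diff A B) D) * ?s A B * x $ A * y $ B * z $ sym_diff (sym_diff A B) D
          = ?s A (sym_diff A D) * x $ A * (?s B (sym_diff B (sym_diff A D)) * y $ B * z $ sym_diff B (sym_diff A D))"
          unfolding G(1) G_def[symmetric] unfolding G(2) .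
      qed
      finally show "(\<Sum>E\<in>UNIV. ?s E (sym_diff E D) * ?s A (sym_diff A E) * x $ A * y $ sym_diff A E * z $ sym_diff E D)
        = (\<Sum>B\<in>UNIV. ?s A (sym_diff A D) * x $ A * (?s B (sym_diff B (sym_diff A D)) * y $ B * z $ sym_diff B (sym_diff A D)))" .
    qed
    also have "\<dots> = (x \<odot> (y \<odot> z)) $ D"
      by (simp add: cliff_mult_nth sum_distrib_left)
    finally show ?thesis .
  qed
  then show ?thesis by (simp add: vec_eq_iff)
qed

lemma norm_smult: "norm (c *s (x :: complex ^ 'm)) = norm c * norm x"
  by (simp add: norm_vec_def norm_mult L2_set_right_distrib)

lemma scaleR_eq_smult: "r *\<^sub>R (x :: complex ^ 'm) = complex_of_real r *s x"
  by (simp add: vec_eq_iff scaleR_conv_of_real[of _ "_::complex"])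

text \<open>A crude constant is enough: it does not depend on the power of the operator and
  disappears in the roots.\<close>

lemma norm_cliff_mult_le:
  fixes x y :: "'n::{finite,linorder} cliff"
  shows "norm (x \<odot> y) \<le> real CARD('n set) ^ 2 * norm x * norm y"
proof -
  have s: "norm (blade_sign A B :: complex) = 1" for A B :: "'n set" by (simp add: blade_sign_def norm_power)
  have "norm (x \<odot> y) \<le> (\<Sum>C\<in>UNIV. norm ((x \<odot> y) $ C))"
    unfolding norm_vec_def[of "x \<odot> y"] by (rule L2_set_le_sum) simp
  also have "\<dots> \<le> (\<Sum>C\<in>(UNIV::'n set set). \<Sum>A\<in>(UNIV::'n set set). norm x * norm y)"
  proof (rule sum_mono)
    fix C
    have "norm ((x \<odot> y) $ C) \<le> (\<Sum>A\<in>UNIV. norm (blade_sign A (sym_diff A C) * x $ A * y $ sym_diff A C))"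
      unfolding cliff_mult_nth by (rule norm_sum)
    also have "\<dots> \<le> (\<Sum>A\<in>(UNIV::'n set set). norm x * norm y)"
      by (rule sum_mono) (simp add: norm_mult s mult_mono Finite_Cartesian_Product.norm_nth_le)
    finally show "norm ((x \<odot> y) $ C) \<le> (\<Sum>A\<in>(UNIV::'n set set). norm x * norm y)" .
  qed
  finally show ?thesis by (simp add: power2_eq_square mult_ac)
qed

lemma bounded_bilinear_cliff_mult: "bounded_bilinear (\<odot>)"
proof
  show "\<exists>K. \<forall>a b :: 'a cliff. norm (a \<odot> b) \<le> norm a * norm b * K"
  proof (intro exI allI)
    fix a b :: "'a cliff"
    show "norm (a \<odot> b) \<le> norm a * norm b * real CARD('a set) ^ 2"
      using norm_cliff_mult_le[of a b] by (simp only: mult_ac)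
  qed
qed (simp_all add: cliff_mult_add_left cliff_mult_add_right scaleR_eq_smult cliff_mult_smult_left cliff_mult_smult_right)

lemma bounded_bilinear_smult: "bounded_bilinear ((*s) :: complex \<Rightarrow> complex ^ 'm \<Rightarrow> complex ^ 'm)"
proof
  show "\<exists>K. \<forall>a (b::complex ^ 'm). norm (a *s b) \<le> norm a * norm b * K"
    by (intro exI[of _ 1]) (simp add: norm_smult)
qed (simp_all add: vec_eq_iff algebra_simps scaleR_conv_of_real[of _ "_::complex"])

lemma cliff_norm_eq: "cliff_norm (x :: 'n::{finite,linorder} cliff) = 2 powr (real CARD('n) / 2) * norm x"
  by (simp add: cliff_norm_def norm_vec_def L2_set_def)

lemma cliff_expand: "(x :: 'n::{finite,linorder} cliff) = (\<Sum>A\<in>UNIV. x $ A *s blade A)"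
  by (simp add: vec_eq_iff blade_def axis_def if_distrib[of "\<lambda>t. _ * t"] cong: if_cong)

lemma blade_empty_left [simp]: "blade {} \<odot> y = y"
  using cliff_of_complex_mult[of 1 y] by (simp add: cliff_of_complex_def)

lemma blade_empty_right [simp]: "x \<odot> blade {} = x"
proof -
  have "(x \<odot> blade {}) $ C = x $ C" for C
  proof -
    have "(x \<odot> blade {}) $ C = (\<Sum>A\<in>UNIV. if A = C then x $ C else 0)"
      unfolding cliff_mult_nth by (rule sum.cong) (auto simp: blade_def axis_def blade_sign_def)
    then show ?thesis by simp
  qed
  then show ?thesis by (simp add: vec_eq_iff)
qed

lemma cliff_mult_sum_left: "(\<Sum>i\<in>I. x i) \<odot> y = (\<Sum>i\<in>I. x i \<odot> y)"
  by (rule bounded_bilinear.sum_left[OF bounded_bilinear_cliff_mult])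

lemma cliff_mult_sum_right: "y \<odot> (\<Sum>i\<in>I. x i) = (\<Sum>i\<in>I. y \<odot> x i)"
  by (rule bounded_bilinear.sum_right[OF bounded_bilinear_cliff_mult])

text \<open>Adding the double sum to its transpose produces the anticommutators of the generators,
  and these vanish off the diagonal.\<close>

lemma cliff_of_vec_square:
  "cliff_of_vec \<xi> \<odot> cliff_of_vec \<xi> = complex_of_real (- (norm \<xi>)\<^sup>2) *s blade {}"
proof -
  let ?t = "\<lambda>j k. (complex_of_real (\<xi> $ j) * complex_of_real (\<xi> $ k)) *s (blade {j} \<odot> blade {k})"
  let ?q = "cliff_of_vec \<xi> \<odot> cliff_of_vec \<xi>"
  have q: "?q = (\<Sum>j\<in>UNIV. \<Sum>k\<in>UNIV. ?t j k)"
    unfolding cliff_of_vec_def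
    by (subst cliff_mult_sum_left, intro sum.cong refl, subst cliff_mult_sum_right, intro sum.cong refl)
       (simp only: cliff_mult_smult_left cliff_mult_smult_right vector_smult_assoc mult.commute)
  have "?q + ?q = (\<Sum>j\<in>UNIV. \<Sum>k\<in>UNIV. ?t j k) + (\<Sum>j\<in>UNIV. \<Sum>k\<in>UNIV. ?t k j)"
    unfolding q by (subst (2) sum.swap) (rule refl)
  also have "\<dots> = (\<Sum>j\<in>UNIV. \<Sum>k\<in>UNIV. (complex_of_real (\<xi> $ j) * complex_of_real (\<xi> $ k)) *s
      (blade {j} \<odot> blade {k} + blade {k} \<odot> blade {j}))"
    by (simp add: sum.distrib vector_add_ldistrib mult.commute)
  also have "\<dots> = (\<Sum>j\<in>UNIV. \<Sum>k\<in>UNIV. if k = j then (- 2 * complex_of_real ((\<xi> $ j)\<^sup>2)) *s blade {} else 0)"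
    by (intro sum.cong refl)
       (simp add: generators_anticommute cliff_of_complex_def vector_smult_assoc power2_eq_square)
  also have "\<dots> = (\<Sum>j\<in>UNIV. (- 2 * complex_of_real ((\<xi> $ j)\<^sup>2)) *s blade {})"
    by (simp add: sum.delta)
  also have "\<dots> = (- 2 * complex_of_real ((norm \<xi>)\<^sup>2)) *s blade {}"
    by (simp add: vec_eq_iff norm_vec_def L2_set_def real_sqrt_pow2 sum_nonneg sum_distrib_left sum_distrib_right sum_negf)
  finally have qq: "?q + ?q = (- 2 * complex_of_real ((norm \<xi>)\<^sup>2)) *s blade {}" .
  have "?q $ A = (complex_of_real (- (norm \<xi>)\<^sup>2) *s blade {}) $ A" for A
  proof -
    have "2 * ?q $ A = 2 * (complex_of_real (- (norm \<xi>)\<^sup>2) *s blade {}) $ A"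
      using arg_cong[OF qq, of "\<lambda>v. v $ A"] by simp
    then show ?thesis by simp
  qed
  then show ?thesis by (simp add: vec_eq_iff)
qed

section \<open>The symbols of the powers of the Dirac operator\<close>

text \<open>The function |\<xi>|^s (a + b \<omega>) with \<omega> = \<xi>/|\<xi>|, split into the
  scalar symbols for which L^1 estimates are available.\<close>

definition csym :: "complex \<Rightarrow> complex \<Rightarrow> real \<Rightarrow> 'n rspace \<Rightarrow> 'n::{finite,linorder} cliff"
  where "csym a b s \<xi> = (a * hsym None s \<xi>) *s blade {} + (\<Sum>j\<in>UNIV. (b * hsym (Some j) s \<xi>) *s blade {j})"

lemma csym_eq:
  "csym a b s \<xi> = (a * complex_of_real (norm \<xi> powr s)) *s blade {}
     + (b * complex_of_real (norm \<xi> powr (s - 1))) *s cliff_of_vec \<xi>"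
  by (simp add: csym_def hsym_def cliff_of_vec_def vec_eq_iff sum_distrib_left mult_ac)

text \<open>As \<omega> squares to -1, the pairs (a, b) multiply like a + bj with j^2 = -1. At the
  origin all these symbols are 0, because \<open>0 powr s = 0\<close>.\<close>

lemma csym_mult:
  "csym a b s \<xi> \<odot> csym a' b' s' \<xi> = csym (a * a' - b * b') (a * b' + a' * b) (s + s') \<xi>"
proof (cases "\<xi> = 0")
  case True
  have "csym a b s (0::'a rspace) = 0" for a b s by (simp add: csym_eq)
  then show ?thesis
    using bounded_bilinear.zero_left[OF bounded_bilinear_cliff_mult] True by simp
next
  case False
  let ?r = "\<lambda>s. complex_of_real (norm \<xi> powr s)"
  have r: "?r s * ?r s' = ?r (s + s')" for s s'
    by (simp add: powr_add)
  have sq: "complex_of_real (- (norm \<xi>)\<^sup>2) = - ?r 2"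
    using False by (simp add: powr_numeral)
  have "csym a b s \<xi> \<odot> csym a' b' s' \<xi>
    = (a * a' * (?r s * ?r s')) *s blade {} + (a * b' * (?r s * ?r (s' - 1))) *s cliff_of_vec \<xi>
      + (a' * b * (?r (s - 1) * ?r s')) *s cliff_of_vec \<xi>
      + (b * b' * (?r (s - 1) * ?r (s' - 1))) *s (cliff_of_vec \<xi> \<odot> cliff_of_vec \<xi>)"
    by (simp add: csym_eq cliff_mult_add_left cliff_mult_add_right cliff_mult_smult_left
        cliff_mult_smult_right vector_smult_assoc mult_ac add_ac)
  also have "\<dots> = (a * a' * (?r s * ?r s')) *s blade {} + (a * b' * (?r s * ?r (s' - 1))) *s cliff_of_vec \<xi>
      + (a' * b * (?r (s - 1) * ?r s')) *s cliff_of_vec \<xi> - (b * b' * (?r (s - 1) * ?r (s' - 1) * ?r 2)) *s blade {}"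
    unfolding cliff_of_vec_square sq by (simp only: vec_eq_iff) (simp add: algebra_simps)
  also have "\<dots> = csym (a * a' - b * b') (a * b' + a' * b) (s + s') \<xi>"
  proof -
    have "?r (s - 1) * ?r (s' - 1) * ?r 2 = ?r (s + s')" "?r s * ?r s' = ?r (s + s')"
      "?r s * ?r (s' - 1) = ?r (s + s' - 1)" "?r (s - 1) * ?r s' = ?r (s + s' - 1)"
      unfolding r by (simp_all add: algebra_simps)
    then show ?thesis by (simp only: csym_eq) (simp only: vec_eq_iff, simp add: algebra_simps)
  qed
  finally show ?thesis .
qed

lemma csym_nth: "csym a b s \<xi> $ A = (\<Sum>i\<in>UNIV. (case i of None \<Rightarrow> a * blade {} $ A | Some j \<Rightarrow> b * blade {j} $ A) * hsym i s \<xi>)"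
  by (simp add: csym_def UNIV_option_conv sum.reindex mult_ac)

definition fcoef :: "(real \<Rightarrow> real) \<Rightarrow> real \<Rightarrow> nat \<Rightarrow> complex"
  where "fcoef trig \<theta> k = exp (- \<i> * complex_of_real (real k * (pi * \<theta> / 2))) * complex_of_real (trig (real k * (pi * \<theta> / 2)))"

text \<open>De Moivre's formula: the Feller factor is a phase times \<open>exp (\<pi>\<theta>\<omega>/2)\<close> with \<open>\<omega> = \<xi>/|\<xi>|\<close> and \<open>\<omega>\<^sup>2 = - 1\<close>.\<close>

definition dsym :: "real \<Rightarrow> real \<Rightarrow> nat \<Rightarrow> 'n rspace \<Rightarrow> 'n::{finite,linorder} cliff"
  where "dsym \<alpha> \<theta> k = csym (fcoef cos \<theta> k) (fcoef sin \<theta> k) (real k * \<alpha>)"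

text \<open>With a phase e of modulus 1 and c^2 + s^2 = 1, the inverse of e (c + s \<omega>) is the
  conjugate of e times (c - s \<omega>).\<close>

definition dsym_inv :: "real \<Rightarrow> real \<Rightarrow> nat \<Rightarrow> 'n rspace \<Rightarrow> 'n::{finite,linorder} cliff"
  where "dsym_inv \<alpha> \<theta> k = csym (cnj (fcoef cos \<theta> k)) (- cnj (fcoef sin \<theta> k)) (- (real k * \<alpha>))"

lemma norm_fcoef_cos: "norm (fcoef cos \<theta> k) \<le> 1" and norm_fcoef_sin: "norm (fcoef sin \<theta> k) \<le> 1"
  unfolding fcoef_def norm_mult norm_exp_minus_i by simp_all

lemma feller_symbol: "complex_of_real (norm \<xi> powr \<alpha>) *s feller_factor \<theta> \<xi> = dsym \<alpha> \<theta> 1 \<xi>"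
  by (simp add: dsym_def csym_eq feller_factor_def fcoef_def cliff_of_complex_def vector_smult_assoc
      vector_add_ldistrib powr_diff mult_ac)

lemma dsym_Suc: "dsym \<alpha> \<theta> k \<xi> \<odot> dsym \<alpha> \<theta> 1 \<xi> = dsym \<alpha> \<theta> (Suc k) \<xi>"
proof -
  have e: "real (Suc k) * (pi * \<theta> / 2) = real k * (pi * \<theta> / 2) + real 1 * (pi * \<theta> / 2)"
    by (simp add: algebra_simps)
  have E: "exp (- \<i> * complex_of_real (x + y)) = exp (- \<i> * complex_of_real x) * exp (- \<i> * complex_of_real y)" for x y
    by (simp add: algebra_simps exp_diff exp_minus divide_inverse)
  have "fcoef cos \<theta> k * fcoef cos \<theta> 1 - fcoef sin \<theta> k * fcoef sin \<theta> 1 = fcoef cos \<theta> (Suc k)"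
    "fcoef cos \<theta> k * fcoef sin \<theta> 1 + fcoef cos \<theta> 1 * fcoef sin \<theta> k = fcoef sin \<theta> (Suc k)"
    unfolding fcoef_def e E cos_add sin_add
    by (simp_all only: of_real_add of_real_diff of_real_mult ring_distribs mult_ac add_ac)
  moreover have "real k * \<alpha> + real 1 * \<alpha> = real (Suc k) * \<alpha>" by (simp add: algebra_simps)
  ultimately show ?thesis unfolding dsym_def csym_mult by simp
qed

lemma dsym_inv_mult:
  assumes "\<xi> \<noteq> 0"
  shows "dsym_inv \<alpha> \<theta> k \<xi> \<odot> dsym \<alpha> \<theta> k \<xi> = blade {}"
proof -
  let ?e = "exp (- \<i> * complex_of_real (real k * (pi * \<theta> / 2)))"
  let ?c = "complex_of_real (cos (real k * (pi * \<theta> / 2)))" and ?s = "complex_of_real (sin (real k * (pi * \<theta> / 2)))"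
  have e: "cnj ?e * ?e = 1"
    using complex_norm_square[of ?e] by (simp only: norm_exp_minus_i mult.commute) simp
  have cs: "?c * ?c + ?s * ?s = 1"
    unfolding of_real_mult[symmetric] of_real_add[symmetric] sin_cos_squared_add3 by simp
  have "cnj (fcoef cos \<theta> k) * fcoef cos \<theta> k - (- cnj (fcoef sin \<theta> k)) * fcoef sin \<theta> k = (cnj ?e * ?e) * (?c * ?c + ?s * ?s)"
    unfolding fcoef_def complex_cnj_mult complex_cnj_complex_of_real by (simp only: algebra_simps) simp
  also have "\<dots> = 1" by (simp only: e cs mult_1)
  finally have 1: "cnj (fcoef cos \<theta> k) * fcoef cos \<theta> k - (- cnj (fcoef sin \<theta> k)) * fcoef sin \<theta> k = 1" .
  have 2: "cnj (fcoef cos \<theta> k) * fcoef sin \<theta> k + fcoef cos \<theta> k * (- cnj (fcoef sin \<theta> k)) = 0"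
    unfolding fcoef_def complex_cnj_mult complex_cnj_complex_of_real by (simp only: algebra_simps) simp
  show ?thesis
    unfolding dsym_inv_def dsym_def csym_mult 1 2 using assms by (simp add: csym_eq)
qed

section \<open>Pairing with a function in a Lebesgue space\<close>

lemma integrable_vecI:
  fixes G :: "'a \<Rightarrow> complex ^ 'm"
  assumes "\<And>A. integrable M (\<lambda>x. G x $ A)"
  shows "integrable M G"
proof -
  have "integrable M (\<lambda>x. \<Sum>A\<in>UNIV. G x $ A *s axis A 1)"
    by (intro Bochner_Integration.integrable_sum
        integrable_bounded_linear[OF bounded_bilinear.bounded_linear_left[OF bounded_bilinear_smult]] assms)
  moreover have "(\<lambda>x. \<Sum>A\<in>UNIV. G x $ A *s axis A 1) = G"
    by (auto simp: vec_eq_iff axis_def if_distrib[of "\<lambda>t. _ * t"] cong: if_cong)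
  ultimately show ?thesis by simp
qed

lemma integrable_vecD: "integrable M G \<Longrightarrow> integrable M (\<lambda>x. (G x :: complex ^ 'm) $ A)"
  by (rule integrable_bounded_linear[OF bounded_linear_vec_nth])

lemma integrable_character_smult:
  fixes G :: "'n::finite rspace \<Rightarrow> complex ^ 'm"
  assumes "integrable lborel G"
  shows "integrable lborel (\<lambda>x. exp (- \<i> * complex_of_real (x \<bullet> \<xi>)) *s G x)"
  by (rule integrable_vecI) (use ft_integrand_integrable[OF integrable_vecD[OF assms]] in simp)

lemma smult_measurable [measurable]:
  fixes G :: "'a \<Rightarrow> complex ^ 'm"
  assumes [measurable]: "c \<in> borel_measurable M" "G \<in> borel_measurable M"
  shows "(\<lambda>x. c x *s G x) \<in> borel_measurable M"
  by (rule borel_measurable_continuous_Pair[OF assms])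
     (intro bounded_bilinear.continuous_on[OF bounded_bilinear_smult] continuous_intros)

lemma cliff_mult_measurable [measurable]:
  assumes [measurable]: "H \<in> borel_measurable M" "G \<in> borel_measurable M"
  shows "(\<lambda>x. H x \<odot> G x) \<in> borel_measurable M"
  by (rule borel_measurable_continuous_Pair[OF assms])
     (intro bounded_bilinear.continuous_on[OF bounded_bilinear_cliff_mult] continuous_intros)

lemma fourier_lborel:
  assumes "integrable lborel G"
  shows "fourier G \<xi> = (LINT x|lborel. exp (- \<i> * complex_of_real (x \<bullet> \<xi>)) *s G x)"
  unfolding fourier_def
  by (rule integral_completion) (use borel_measurable_integrable[OF assms] in measurable)

lemma fourier_nth:
  assumes "integrable lborel G"
  shows "fourier G \<xi> $ A = ft (\<lambda>x. G x $ A) \<xi>"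
  unfolding fourier_lborel[OF assms] ft_def
  by (subst integral_bounded_linear[OF bounded_linear_vec_nth integrable_character_smult[OF assms], symmetric]) simp

lemma inv_fourier_eq:
  fixes G :: "'n rspace \<Rightarrow> 'n::{finite,linorder} cliff"
  shows "inv_fourier G x = complex_of_real (1 / (2 * pi) ^ CARD('n)) *s fourier G (- x)"
  unfolding inv_fourier_def fourier_def by (simp add: inner_commute)

lemma inv_fourier_nth:
  assumes "integrable lborel G"
  shows "inv_fourier G x $ A = ift (\<lambda>x. G x $ A) x"
  using fourier_nth[OF assms, of "- x" A] by (simp add: inv_fourier_eq ift_eq_ft)

definition cwiener :: "('n rspace \<Rightarrow> 'n::{finite,linorder} cliff) \<Rightarrow> bool"
  where "cwiener H \<longleftrightarrow> (\<forall>A. wiener (\<lambda>x. H x $ A))"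

lemma cwiener_integrable: "cwiener H \<Longrightarrow> integrable lborel H"
  by (rule integrable_vecI) (simp add: cwiener_def wiener_def)

lemma fourier_integrable:
  assumes "cwiener H"
  shows "integrable lborel (fourier H)"
  by (rule integrable_vecI, unfold fourier_nth[OF cwiener_integrable[OF assms]])
     (use assms in \<open>simp add: cwiener_def wiener_def\<close>)

lemma fourier_measurable: "cwiener H \<Longrightarrow> fourier H \<in> borel_measurable borel"
  using borel_measurable_integrable[OF fourier_integrable] by simp

lemma inv_fourier_fourier:
  assumes "cwiener H"
  shows "inv_fourier (fourier H) = H"
proof (rule ext, unfold vec_eq_iff, rule allI)
  fix x A
  have "inv_fourier (fourier H) x $ A = ift (\<lambda>y. fourier H y $ A) x"
    by (rule inv_fourier_nth[OF fourier_integrable[OF assms]])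
  also have "(\<lambda>y. fourier H y $ A) = ft (\<lambda>y. H y $ A)"
    by (rule ext, rule fourier_nth[OF cwiener_integrable[OF assms]])
  also have "ift \<dots> x = H x $ A"
    by (rule fourier_inversion) (use assms in \<open>simp add: cwiener_def\<close>)
  finally show "inv_fourier (fourier H) x $ A = H x $ A" .
qed

lemma wiener_sum:
  fixes g :: "'i \<Rightarrow> 'n::finite rspace \<Rightarrow> complex"
  assumes "finite I" "\<And>i. i \<in> I \<Longrightarrow> wiener (g i)"
  shows "wiener (\<lambda>x. \<Sum>i\<in>I. g i x)"
  using assms
proof (induction I rule: finite_induct)
  case empty
  have "schwartz (\<lambda>x::'n rspace. 0)" by (rule schwartz_vanish[of _ 0]) simp_all
  then show ?case by (simp add: schwartz_wiener)
qed (auto intro: wiener_add)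

lemma cwiener_sum: "finite I \<Longrightarrow> (\<And>i. i \<in> I \<Longrightarrow> cwiener (H i)) \<Longrightarrow> cwiener (\<lambda>x. \<Sum>i\<in>I. H i x)"
  by (simp add: cwiener_def wiener_sum)

lemma cwiener_left_mult: "cwiener H \<Longrightarrow> cwiener (\<lambda>x. c \<odot> H x)"
  by (simp add: cwiener_def cliff_mult_nth wiener_sum wiener_cmult)

lemma cwiener_smult:
  assumes "wiener h"
  shows "cwiener (\<lambda>x. h x *s v)"
  unfolding cwiener_def
proof
  fix A
  have "(\<lambda>x. (h x *s v) $ A) = (\<lambda>x. v $ A * h x)" by (simp add: mult.commute)
  then show "wiener (\<lambda>x. (h x *s v) $ A)" by (simp only: wiener_cmult[OF assms])
qed

lemma fourier_sum:
  assumes "finite I" "\<And>i. i \<in> I \<Longrightarrow> cwiener (H i)"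
  shows "fourier (\<lambda>x. \<Sum>i\<in>I. H i x) \<xi> = (\<Sum>i\<in>I. fourier (H i) \<xi>)"
proof -
  have "(\<lambda>x. exp (- \<i> * complex_of_real (x \<bullet> \<xi>)) *s (\<Sum>i\<in>I. H i x))
     = (\<lambda>x. \<Sum>i\<in>I. exp (- \<i> * complex_of_real (x \<bullet> \<xi>)) *s H i x)"
    by (simp add: bounded_bilinear.sum_right[OF bounded_bilinear_smult])
  then have "fourier (\<lambda>x. \<Sum>i\<in>I. H i x) \<xi> = (LINT x|lborel. (\<Sum>i\<in>I. exp (- \<i> * complex_of_real (x \<bullet> \<xi>)) *s H i x))"
    using fourier_lborel[OF cwiener_integrable[OF cwiener_sum[OF assms]]] by simp
  also have "\<dots> = (\<Sum>i\<in>I. LINT x|lborel. exp (- \<i> * complex_of_real (x \<bullet> \<xi>)) *s H i x)"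
    by (intro Bochner_Integration.integral_sum integrable_character_smult cwiener_integrable assms)
  also have "\<dots> = (\<Sum>i\<in>I. fourier (H i) \<xi>)"
    by (intro sum.cong refl fourier_lborel[symmetric] cwiener_integrable assms)
  finally show ?thesis .
qed

lemma fourier_left_mult:
  assumes "cwiener H"
  shows "fourier (\<lambda>x. c \<odot> H x) \<xi> = c \<odot> fourier H \<xi>"
proof -
  note bl = bounded_bilinear.bounded_linear_right[OF bounded_bilinear_cliff_mult, of c]
  have "fourier (\<lambda>x. c \<odot> H x) \<xi> = (LINT x|lborel. c \<odot> (exp (- \<i> * complex_of_real (x \<bullet> \<xi>)) *s H x))"
    unfolding fourier_lborel[OF cwiener_integrable[OF cwiener_left_mult[OF assms]]]
    by (simp add: cliff_mult_smult_right)
  also have "\<dots> = c \<odot> (LINT x|lborel. exp (- \<i> * complex_of_real (x \<bullet> \<xi>)) *s H x)"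
    by (rule integral_bounded_linear[OF bl integrable_character_smult[OF cwiener_integrable[OF assms]]])
  finally show ?thesis by (simp only: fourier_lborel[OF cwiener_integrable[OF assms]])
qed

text \<open>Working version of \<open>Lp_space\<close>: Borel measurability instead of Lebesgue
  measurability, and the Euclidean norm instead of \<open>cliff_norm\<close>, from which it differs
  by the constant factor 2^(n/2).\<close>

definition borel_Lp :: "real \<Rightarrow> ('n rspace \<Rightarrow> 'n::{finite,linorder} cliff) \<Rightarrow> bool"
  where "borel_Lp p f \<longleftrightarrow> f \<in> borel_measurable borel \<and> integrable lborel (\<lambda>x. norm (f x) powr p)"

definition pairing :: "('n rspace \<Rightarrow> 'n cliff) \<Rightarrow> ('n rspace \<Rightarrow> 'n cliff) \<Rightarrow> 'n::{finite,linorder} cliff"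
  where "pairing f H = (LINT x|lborel. H x \<odot> f x)"

text \<open>Jensen's inequality with the weight |H|, followed by |H| \<le> B in the remaining
  integral. The L^1 norm and the supremum of \<open>H\<close> enter as separate factors, so one of
  them may tend to 0 while the other stays bounded.\<close>

lemma pairing_bound:
  fixes f H :: "'n rspace \<Rightarrow> 'n::{finite,linorder} cliff"
  assumes f: "borel_Lp p f" and p: "p \<ge> 1" and H: "integrable lborel H" and B: "\<And>x. norm (H x) \<le> B"
  shows "integrable lborel (\<lambda>x. H x \<odot> f x)"
    and "norm (pairing f H) \<le> real CARD('n set) ^ 2 *
      ((LINT x|lborel. norm (H x)) powr (p - 1) * (B * (LINT x|lborel. norm (f x) powr p))) powr (1 / p)"
proof -
  let ?\<kappa> = "real CARD('n set) ^ 2"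
  have [measurable]: "f \<in> borel_measurable borel" "H \<in> borel_measurable borel"
    and fp: "integrable lborel (\<lambda>x. norm (f x) powr p)"
    using f H by (auto simp: borel_Lp_def)
  have le: "norm (H x) * norm (f x) powr p \<le> B * norm (f x) powr p" for x
    by (intro mult_right_mono B) simp
  have wF: "integrable lborel (\<lambda>x. norm (H x) * norm (f x) powr p)"
    by (rule Bochner_Integration.integrable_bound[OF integrable_mult_right[OF fp, of B]])
       (use le order_trans[OF le abs_ge_self] in \<open>auto simp: abs_mult intro!: AE_I2\<close>)
  have fm: "(\<lambda>x. norm (f x)) \<in> borel_measurable lborel" by measurable
  note j = jensen_powr[OF fm integrable_norm[OF H] wF norm_ge_zero norm_ge_zero p]
  have nl: "norm (H x \<odot> f x) \<le> ?\<kappa> * (norm (H x) * norm (f x))" for x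
    using norm_cliff_mult_le[of "H x" "f x"] by (simp only: mult.assoc)
  show i: "integrable lborel (\<lambda>x. H x \<odot> f x)"
    by (rule Bochner_Integration.integrable_bound[OF integrable_mult_right[OF j(1), of ?\<kappa>]])
       (measurable, intro AE_I2, unfold real_norm_def, rule order_trans[OF nl abs_ge_self])
  have "norm (pairing f H) \<le> (LINT x|lborel. ?\<kappa> * (norm (H x) * norm (f x)))"
    unfolding pairing_def
    by (rule Bochner_Integration.integral_norm_bound_integral[OF i integrable_mult_right[OF j(1)] nl])
  also have "\<dots> = ?\<kappa> * (LINT x|lborel. norm (H x) * norm (f x))" by (rule integral_mult_right_zero)
  also have "\<dots> \<le> ?\<kappa> * ((LINT x|lborel. norm (H x)) powr (p - 1) * (B * (LINT x|lborel. norm (f x) powr p))) powr (1 / p)"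
  proof (rule mult_left_mono)
    let ?I = "LINT x|lborel. norm (H x) * norm (f x)"
    have "?I \<ge> 0" by (simp add: integral_nonneg_AE)
    then have "?I = (?I powr p) powr (1 / p)" using p by (simp add: powr_powr)
    also have "\<dots> \<le> ((LINT x|lborel. norm (H x)) powr (p - 1) * (LINT x|lborel. norm (H x) * norm (f x) powr p)) powr (1 / p)"
      by (intro powr_mono2 j) (use p in auto)
    also have "\<dots> \<le> ((LINT x|lborel. norm (H x)) powr (p - 1) * (LINT x|lborel. B * norm (f x) powr p)) powr (1 / p)"
      by (intro powr_mono2 mult_left_mono integral_mono wF integrable_mult_right fp le)
         (use p in \<open>auto intro!: mult_nonneg_nonneg integral_nonneg_AE\<close>)
    finally show "?I \<le> ((LINT x|lborel. norm (H x)) powr (p - 1) * (B * (LINT x|lborel. norm (f x) powr p))) powr (1 / p)"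
      by simp
  qed simp
  finally show "norm (pairing f H) \<le> ?\<kappa> *
      ((LINT x|lborel. norm (H x)) powr (p - 1) * (B * (LINT x|lborel. norm (f x) powr p))) powr (1 / p)" .
qed

lemma fourier_bounded:
  assumes "cwiener H"
  shows "norm (fourier H \<xi>) \<le> (\<Sum>A\<in>UNIV. LINT x|lborel. norm (H x $ A))"
proof -
  have "norm (fourier H \<xi>) \<le> (\<Sum>A\<in>UNIV. norm (fourier H \<xi> $ A))"
    unfolding norm_vec_def[of "fourier H \<xi>"] by (rule L2_set_le_sum) simp
  also have "\<dots> \<le> (\<Sum>A\<in>UNIV. LINT x|lborel. norm (H x $ A))"
    unfolding fourier_nth[OF cwiener_integrable[OF assms]]
    by (intro sum_mono ft_norm_le) (use assms in \<open>simp add: cwiener_def wiener_def\<close>)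
  finally show ?thesis .
qed

lemma pairing_fourier_integrable:
  assumes "borel_Lp p f" "p \<ge> 1" "cwiener H"
  shows "integrable lborel (\<lambda>x. fourier H x \<odot> f x)"
  by (rule pairing_bound(1)[OF assms(1,2) fourier_integrable[OF assms(3)] fourier_bounded[OF assms(3)]])

lemma pairing_fourier_sum:
  assumes f: "borel_Lp p f" "p \<ge> 1" and "finite I" "\<And>i. i \<in> I \<Longrightarrow> cwiener (H i)"
  shows "pairing f (fourier (\<lambda>x. \<Sum>i\<in>I. H i x)) = (\<Sum>i\<in>I. pairing f (fourier (H i)))"
  unfolding pairing_def
  by (subst fourier_sum[OF assms(3,4)], assumption, subst cliff_mult_sum_left)
     (rule Bochner_Integration.integral_sum, rule pairing_fourier_integrable[OF f assms(4)])

lemma pairing_fourier_add: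
  assumes f: "borel_Lp p f" "p \<ge> 1" and "cwiener H" "cwiener G"
  shows "pairing f (fourier (\<lambda>x. H x + G x)) = pairing f (fourier H) + pairing f (fourier G)"
  using pairing_fourier_sum[OF f, of "UNIV :: bool set" "\<lambda>b. if b then H else G"] assms(3,4)
  by (simp add: UNIV_bool add.commute)

text \<open>The character is a complex scalar and commutes with \<open>c\<close>, and associativity
  moves \<open>c\<close> out of the product with \<open>f\<close>.\<close>

lemma pairing_fourier_left_mult:
  assumes f: "borel_Lp p f" "p \<ge> 1" and H: "cwiener H"
  shows "pairing f (fourier (\<lambda>x. c \<odot> H x)) = c \<odot> pairing f (fourier H)"
  unfolding pairing_def fourier_left_mult[OF H] cliff_mult_assoc
  by (rule integral_bounded_linear[OF bounded_bilinear.bounded_linear_right[OF bounded_bilinear_cliff_mult]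
        pairing_fourier_integrable[OF f H]])

section \<open>Powers of the Dirac operator on test functions\<close>

lemma cwiener_mult_dsym:
  fixes \<phi> :: "'n::{finite,linorder} rspace \<Rightarrow> complex"
  assumes "schwartz \<phi>" "\<alpha> > 0" "k > 0"
  shows "cwiener (\<lambda>\<xi>. \<phi> \<xi> *s dsym \<alpha> \<theta> k \<xi>)"
  unfolding cwiener_def
proof
  fix A :: "'n set"
  let ?c = "\<lambda>i. case i of None \<Rightarrow> fcoef cos \<theta> k * blade {} $ A | Some j \<Rightarrow> fcoef sin \<theta> k * blade {j} $ A"
  have e: "(\<lambda>\<xi>. (\<phi> \<xi> *s dsym \<alpha> \<theta> k \<xi>) $ A) = (\<lambda>\<xi>. \<Sum>i\<in>UNIV. ?c i * (\<phi> \<xi> * hsym i (real k * \<alpha>) \<xi>))"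
    by (simp add: dsym_def csym_nth sum_distrib_left mult_ac)
  show "wiener (\<lambda>\<xi>. (\<phi> \<xi> *s dsym \<alpha> \<theta> k \<xi>) $ A)"
    unfolding e by (intro wiener_sum wiener_cmult wiener_mult_hsym assms) (use assms in auto)
qed

definition dirac_test :: "real \<Rightarrow> real \<Rightarrow> ('n rspace \<Rightarrow> 'n cliff) \<Rightarrow> 'n rspace \<Rightarrow> 'n::{finite,linorder} cliff"
  where "dirac_test \<alpha> \<theta> \<Phi> = fourier (\<lambda>\<xi>. inv_fourier \<Phi> \<xi> \<odot> dsym \<alpha> \<theta> 1 \<xi>)"

lemma feller_dirac_eq: "feller_dirac \<alpha> \<theta> T = (\<lambda>\<Phi>. T (dirac_test \<alpha> \<theta> \<Phi>))"
  by (simp add: feller_dirac_def dist_multiplier_def dist_inv_fourier_def dist_left_mult_def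
      dist_fourier_def dirac_test_def feller_symbol)

lemma feller_dirac_funpow: "(feller_dirac \<alpha> \<theta> ^^ k) T = (\<lambda>\<Phi>. T ((dirac_test \<alpha> \<theta> ^^ k) \<Phi>))"
  by (induction k) (simp_all add: feller_dirac_eq funpow_swap1)

lemma inv_fourier_cliff_of_complex:
  fixes \<phi> :: "'n::{finite,linorder} rspace \<Rightarrow> complex"
  assumes "integrable lborel \<phi>"
  shows "inv_fourier (\<lambda>x. cliff_of_complex (\<phi> x)) = (\<lambda>\<xi>. cliff_of_complex (ift \<phi> \<xi>))"
proof (rule ext, unfold vec_eq_iff, rule allI)
  fix \<xi> and A :: "'n set"
  have i: "integrable lborel (\<lambda>x. cliff_of_complex (\<phi> x))"
    by (rule integrable_vecI) (simp add: cliff_of_complex_def integrable_mult_left[OF assms])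
  have "ift (\<lambda>x. \<phi> x * b) \<xi> = ift \<phi> \<xi> * b" for b
    using ft_cmult[of b \<phi> "- \<xi>"] by (simp add: ift_eq_ft mult.commute)
  then show "inv_fourier (\<lambda>x. cliff_of_complex (\<phi> x)) \<xi> $ A = cliff_of_complex (ift \<phi> \<xi>) $ A"
    unfolding inv_fourier_nth[OF i] by (simp add: cliff_of_complex_def)
qed

text \<open>After one step the test function is the Fourier transform of a \<open>cwiener\<close>
  function. Inversion in that class cancels \<open>inv_fourier\<close> against
  \<open>fourier\<close> at the next step, and what remains is the product of symbols.\<close>

lemma dirac_test_funpow:
  fixes \<phi> :: "'n::{finite,linorder} rspace \<Rightarrow> complex"
  assumes \<phi>: "schwartz \<phi>" and "\<alpha> > 0"
  shows "(dirac_test \<alpha> \<theta> ^^ Suc k) (\<lambda>x. cliff_of_complex (\<phi> x)) = fourier (\<lambda>\<xi>. ift \<phi> \<xi> *s dsym \<alpha> \<theta> (Suc k) \<xi>)"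
proof (induction k)
  case 0
  show ?case
    by (simp add: dirac_test_def inv_fourier_cliff_of_complex[OF schwartz_integrable[OF \<phi>]] cliff_of_complex_mult)
next
  case (Suc k)
  have c: "cwiener (\<lambda>\<xi>. ift \<phi> \<xi> *s dsym \<alpha> \<theta> (Suc k) \<xi>)"
    by (intro cwiener_mult_dsym ift_schwartz assms) simp
  have "(dirac_test \<alpha> \<theta> ^^ Suc (Suc k)) (\<lambda>x. cliff_of_complex (\<phi> x))
    = dirac_test \<alpha> \<theta> (fourier (\<lambda>\<xi>. ift \<phi> \<xi> *s dsym \<alpha> \<theta> (Suc k) \<xi>))"
    unfolding funpow.simps(2)[of "Suc k"] o_apply Suc ..
  also have "\<dots> = fourier (\<lambda>\<xi>. ift \<phi> \<xi> *s dsym \<alpha> \<theta> (Suc (Suc k)) \<xi>)"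
    unfolding dirac_test_def inv_fourier_fourier[OF c] cliff_mult_smult_left dsym_Suc ..
  finally show ?case .
qed

section \<open>Borel representatives\<close>

lemma lebesgue_borel_representative:
  fixes f :: "'n::finite rspace \<Rightarrow> complex ^ 'm"
  assumes "f \<in> borel_measurable lebesgue"
  shows "\<exists>f'\<in>borel_measurable borel. AE x in lborel. f x = f' x"
proof -
  have m: "(\<lambda>x. Re (f x $ A)) \<in> borel_measurable (completion lborel)"
    "(\<lambda>x. Im (f x $ A)) \<in> borel_measurable (completion lborel)" for A
    using measurable_compose[OF assms borel_measurable_continuous_onI[OF linear_continuous_on[OF bounded_linear_compose[OF bounded_linear_Re bounded_linear_vec_nth[of A]]]]]
      measurable_compose[OF assms borel_measurable_continuous_onI[OF linear_continuous_on[OF bounded_linear_compose[OF bounded_linear_Im bounded_linear_vec_nth[of A]]]]]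
    by auto
  have "\<forall>A. \<exists>g. g \<in> borel_measurable lborel \<and> (AE x in lborel. Re (f x $ A) = g x)"
    using completion_ex_borel_measurable_real[OF m(1)] by blast
  from choice[OF this] obtain g where
    g: "\<forall>A. g A \<in> borel_measurable lborel \<and> (AE x in lborel. Re (f x $ A) = g A x)" by (rule exE)
  have "\<forall>A. \<exists>h. h \<in> borel_measurable lborel \<and> (AE x in lborel. Im (f x $ A) = h x)"
    using completion_ex_borel_measurable_real[OF m(2)] by blast
  from choice[OF this] obtain h where
    h: "\<forall>A. h A \<in> borel_measurable lborel \<and> (AE x in lborel. Im (f x $ A) = h A x)" by (rule exE)
  have gh: "g A \<in> borel_measurable lborel" "h A \<in> borel_measurable lborel"
    "AE x in lborel. Re (f x $ A) = g A x" "AE x in lborel. Im (f x $ A) = h A x" for A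
    using g h by auto
  define f' where "f' x = (\<Sum>A\<in>UNIV. Complex (g A x) (h A x) *s axis A 1)" for x
  have nth: "f' x $ A = Complex (g A x) (h A x)" for x A
    by (simp add: f'_def axis_def if_distrib[of "\<lambda>t. _ * t"] cong: if_cong)
  have "f' \<in> borel_measurable borel"
    unfolding f'_def Complex_eq using gh(1,2) by (intro borel_measurable_sum smult_measurable) auto
  moreover have "AE x in lborel. \<forall>A. Re (f x $ A) = g A x \<and> Im (f x $ A) = h A x"
    using gh(3,4) by (simp add: AE_all_countable AE_conj_iff)
  then have "AE x in lborel. f x = f' x"
    by (rule eventually_mono) (simp add: vec_eq_iff nth complex_eq_iff)
  ultimately show ?thesis by blast
qed

text \<open>Passes to a Borel function equal almost everywhere, because the Fubini arguments need
  joint Borel measurability. Its integral against any Borel test function is unchanged, so the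
  distribution seen by the operator is too.\<close>

lemma Lp_space_borel:
  fixes f :: "'n rspace \<Rightarrow> 'n::{finite,linorder} cliff"
  assumes "f \<in> Lp_space p"
  obtains f' where "borel_Lp p f'"
    "\<And>\<Phi>. \<Phi> \<in> borel_measurable borel \<Longrightarrow> dist_of_fun f \<Phi> = pairing f' \<Phi>"
    "Lp_norm p f = ((LINT x|lborel. (2 powr (real CARD('n) / 2)) powr p * norm (f' x) powr p)) powr (1 / p)"
proof -
  have fm: "f \<in> borel_measurable lebesgue" and fi: "integrable lebesgue (\<lambda>x. cliff_norm (f x) powr p)"
    using assms by (auto simp: Lp_space_def)
  obtain f' where m: "f' \<in> borel_measurable borel" and ae: "AE x in lborel. f x = f' x"
    using lebesgue_borel_representative[OF fm] by blast
  note [measurable] = m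
  have ae': "AE x in lebesgue. f x = f' x" by (rule AE_completion[OF ae])
  have m': "f' \<in> borel_measurable lebesgue" by (rule measurable_completion) simp
  let ?K = "(2 powr (real CARD('n) / 2)) powr p"
  have cn: "cliff_norm v powr p = ?K * norm v powr p" for v :: "'n cliff"
    by (simp add: cliff_norm_eq powr_mult)
  have mn: "(\<lambda>x. ?K * norm (f' x) powr p) \<in> borel_measurable lborel" by measurable
  have mnc: "(\<lambda>x. ?K * norm (f x) powr p) \<in> borel_measurable lebesgue" using fm by measurable
  have aen: "AE x in lebesgue. ?K * norm (f x) powr p = ?K * norm (f' x) powr p"
    using ae' by (rule eventually_mono) simp
  have i1: "integrable lborel (\<lambda>x. ?K * norm (f' x) powr p)"
    using fi integrable_cong_AE[OF mnc measurable_completion[OF mn] aen] integrable_completion[OF mn]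
    unfolding cn by simp
  have K: "?K \<noteq> 0" by simp
  have "integrable lborel (\<lambda>x. inverse ?K * (?K * norm (f' x) powr p))"
    by (rule integrable_mult_right[OF i1])
  then have "borel_Lp p f'"
    unfolding borel_Lp_def using m K by (simp add: mult.assoc[symmetric])
  moreover have "dist_of_fun f \<Phi> = pairing f' \<Phi>" if [measurable]: "\<Phi> \<in> borel_measurable borel" for \<Phi>
  proof -
    have P: "\<Phi> \<in> borel_measurable lebesgue" by (rule measurable_completion) simp
    have "dist_of_fun f \<Phi> = (LINT x|lebesgue. \<Phi> x \<odot> f' x)"
      unfolding dist_of_fun_def
      by (rule integral_cong_AE[OF cliff_mult_measurable[OF P fm] cliff_mult_measurable[OF P m']])
         (use ae' in \<open>auto elim: eventually_mono\<close>)
    also have "\<dots> = pairing f' \<Phi>"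
      unfolding pairing_def by (rule integral_completion) measurable
    finally show ?thesis .
  qed
  moreover have "Lp_norm p f = ((LINT x|lborel. ?K * norm (f' x) powr p)) powr (1 / p)"
    unfolding Lp_norm_def cn integral_cong_AE[OF mnc measurable_completion[OF mn] aen] integral_completion[OF mn] ..
  ultimately show ?thesis by (rule that)
qed

lemma borel_Lp_space:
  fixes f :: "'n rspace \<Rightarrow> 'n::{finite,linorder} cliff"
  assumes f: "borel_Lp p f"
  shows "f \<in> Lp_space p"
    and "\<And>\<Phi>. \<Phi> \<in> borel_measurable borel \<Longrightarrow> dist_of_fun f \<Phi> = pairing f \<Phi>"
    and "Lp_norm p f = ((LINT x|lborel. (2 powr (real CARD('n) / 2)) powr p * norm (f x) powr p)) powr (1 / p)"
proof -
  have m[measurable]: "f \<in> borel_measurable borel" and i: "integrable lborel (\<lambda>x. norm (f x) powr p)"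
    using f by (auto simp: borel_Lp_def)
  let ?K = "(2 powr (real CARD('n) / 2)) powr p"
  have cn: "cliff_norm v powr p = ?K * norm v powr p" for v :: "'n cliff"
    by (simp add: cliff_norm_eq powr_mult)
  have mn: "(\<lambda>x. ?K * norm (f x) powr p) \<in> borel_measurable lborel" by measurable
  have m': "f \<in> borel_measurable lebesgue" by (rule measurable_completion) simp
  show "f \<in> Lp_space p"
    unfolding Lp_space_def cn using m' i integrable_completion[OF mn] by simp
  show "dist_of_fun f \<Phi> = pairing f \<Phi>" if [measurable]: "\<Phi> \<in> borel_measurable borel" for \<Phi>
    unfolding pairing_def dist_of_fun_def by (rule integral_completion) measurable
  show "Lp_norm p f = ((LINT x|lborel. ?K * norm (f x) powr p)) powr (1 / p)"
    unfolding Lp_norm_def cn integral_completion[OF mn] ..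
qed

section \<open>Localization of the Fourier transform\<close>

lemma norm_cliff_of_complex [simp]: "norm (cliff_of_complex c :: 'n::{finite,linorder} cliff) = norm c"
  by (simp add: cliff_of_complex_def blade_def norm_smult)

lemma cwiener_cliff_of_complex: "wiener \<psi> \<Longrightarrow> cwiener (\<lambda>x. cliff_of_complex (\<psi> x))"
  unfolding cliff_of_complex_def by (rule cwiener_smult)

lemma fourier_cliff_of_complex:
  assumes "wiener \<psi>"
  shows "fourier (\<lambda>x. cliff_of_complex (\<psi> x)) = (\<lambda>\<xi>. cliff_of_complex (ft \<psi> \<xi>))"
proof (rule ext, unfold vec_eq_iff, rule allI)
  fix \<xi> and A :: "'a set"
  have "ft (\<lambda>x. \<psi> x * b) \<xi> = ft \<psi> \<xi> * b" for b
    using ft_cmult[of b \<psi> \<xi>] by (simp add: mult.commute)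
  then show "fourier (\<lambda>x. cliff_of_complex (\<psi> x)) \<xi> $ A = cliff_of_complex (ft \<psi> \<xi>) $ A"
    unfolding fourier_nth[OF cwiener_integrable[OF cwiener_cliff_of_complex[OF assms]]]
    by (simp add: cliff_of_complex_def)
qed

text \<open>The Fourier transform of \<open>f\<close> as a distribution, evaluated at \<psi>; it is
  used for \<psi> in \<open>wiener\<close>, not only for Schwartz functions.\<close>

definition hat :: "('n rspace \<Rightarrow> 'n cliff) \<Rightarrow> ('n rspace \<Rightarrow> complex) \<Rightarrow> 'n::{finite,linorder} cliff"
  where "hat f \<psi> = pairing f (fourier (\<lambda>x. cliff_of_complex (\<psi> x)))"

lemma cliff_of_complex_add: "cliff_of_complex (a + b) = cliff_of_complex a + cliff_of_complex b"
  by (simp add: cliff_of_complex_def vec_eq_iff algebra_simps)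

lemma hat_add:
  assumes f: "borel_Lp p f" "p \<ge> 1" and "wiener \<phi>" "wiener \<psi>"
  shows "hat f (\<lambda>x. \<phi> x + \<psi> x) = hat f \<phi> + hat f \<psi>"
  unfolding hat_def cliff_of_complex_add
  by (rule pairing_fourier_add[OF f]) (intro cwiener_cliff_of_complex assms)+

lemma hat_zero: "hat f (\<lambda>x. 0) = 0"
proof -
  have "fourier (\<lambda>x. cliff_of_complex 0) = (\<lambda>\<xi>. 0 :: 'a cliff)"
    by (simp add: fourier_def cliff_of_complex_def fun_eq_iff)
  then show ?thesis
    by (simp add: hat_def pairing_def bounded_bilinear.zero_left[OF bounded_bilinear_cliff_mult])
qed

lemma hat_bound:
  fixes f :: "'n rspace \<Rightarrow> 'n::{finite,linorder} cliff"
  assumes f: "borel_Lp p f" "p \<ge> 1" and \<psi>: "wiener \<psi>"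
  shows "norm (hat f \<psi>) \<le> real CARD('n set) ^ 2 * ((LINT \<xi>|lborel. norm (ft \<psi> \<xi>)) powr (p - 1) *
     ((LINT x|lborel. norm (\<psi> x)) * (LINT x|lborel. norm (f x) powr p))) powr (1 / p)"
proof -
  have i: "integrable lborel (\<lambda>\<xi>. cliff_of_complex (ft \<psi> \<xi>) :: 'n cliff)"
    using fourier_integrable[OF cwiener_cliff_of_complex[OF \<psi>]] by (simp only: fourier_cliff_of_complex[OF \<psi>])
  have b: "norm (cliff_of_complex (ft \<psi> \<xi>) :: 'n cliff) \<le> (LINT x|lborel. norm (\<psi> x))" for \<xi>
    using ft_norm_le[of \<psi> \<xi>] \<psi> by (simp add: wiener_def)
  show ?thesis
    unfolding hat_def fourier_cliff_of_complex[OF \<psi>]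
    using pairing_bound(2)[OF f i b] by simp
qed

text \<open>The transforms are bounded by the L^1 norms of the test functions, so their suprema tend
  to 0 while their L^1 norms stay below \<open>B\<close>. For p > 1 and p = 1 alike the pairing
  estimate then tends to 0.\<close>

lemma hat_tendsto_0:
  fixes f :: "'n rspace \<Rightarrow> 'n::{finite,linorder} cliff"
  assumes f: "borel_Lp p f" "p \<ge> 1" and \<theta>: "\<And>N. wiener (\<theta> N)"
    and B: "\<And>N::nat. (LINT \<xi>|lborel. norm (ft (\<theta> N) \<xi>)) \<le> B"
    and lim: "(\<lambda>N. LINT x|lborel. norm (\<theta> N x)) \<longlonglongrightarrow> 0"
  shows "(\<lambda>N. hat f (\<theta> N)) \<longlonglongrightarrow> 0"
proof (rule Lim_null_comparison)
  let ?If = "LINT x|lborel. norm (f x) powr p"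
  let ?\<kappa> = "real CARD('n set) ^ 2"
  have I0: "?If \<ge> 0" by (simp add: integral_nonneg_AE)
  show "\<forall>\<^sub>F N in sequentially. norm (hat f (\<theta> N)) \<le> ?\<kappa> * (B powr (p - 1) * ((LINT x|lborel. norm (\<theta> N x)) * ?If)) powr (1 / p)"
  proof (intro always_eventually allI)
    fix N
    have "norm (hat f (\<theta> N)) \<le> ?\<kappa> * ((LINT \<xi>|lborel. norm (ft (\<theta> N) \<xi>)) powr (p - 1) *
       ((LINT x|lborel. norm (\<theta> N x)) * ?If)) powr (1 / p)"
      by (rule hat_bound[OF f \<theta>])
    also have "\<dots> \<le> ?\<kappa> * (B powr (p - 1) * ((LINT x|lborel. norm (\<theta> N x)) * ?If)) powr (1 / p)"
      by (intro mult_left_mono powr_mono2 mult_right_mono B mult_nonneg_nonneg integral_nonneg_AE)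
         (use f(2) in auto)
    finally show "norm (hat f (\<theta> N)) \<le> ?\<kappa> * (B powr (p - 1) * ((LINT x|lborel. norm (\<theta> N x)) * ?If)) powr (1 / p)" .
  qed
  have "(\<lambda>N. ?\<kappa> * (B powr (p - 1) * ((LINT x|lborel. norm (\<theta> N x)) * ?If)) powr (1 / p))
    \<longlonglongrightarrow> ?\<kappa> * (B powr (p - 1) * (0 * ?If)) powr (1 / p)"
    by (intro tendsto_mult tendsto_const tendsto_powr' lim)
       (use f(2) I0 in \<open>auto intro!: always_eventually mult_nonneg_nonneg integral_nonneg_AE\<close>)
  then show "(\<lambda>N. ?\<kappa> * (B powr (p - 1) * ((LINT x|lborel. norm (\<theta> N x)) * ?If)) powr (1 / p)) \<longlonglongrightarrow> 0"
    by simp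
qed

definition annihilates :: "('n rspace \<Rightarrow> 'n::{finite,linorder} cliff) \<Rightarrow> ('n rspace) set \<Rightarrow> bool"
  where "annihilates f U \<longleftrightarrow> (\<forall>\<phi>. smooth \<phi> \<and> compact (closure {\<xi>. \<phi> \<xi> \<noteq> 0}) \<and> closure {\<xi>. \<phi> \<xi> \<noteq> 0} \<subseteq> U \<longrightarrow> hat f \<phi> = 0)"

definition spectrum :: "('n rspace \<Rightarrow> 'n::{finite,linorder} cliff) \<Rightarrow> ('n rspace) set"
  where "spectrum f = - \<Union>{U. open U \<and> annihilates f U}"

lemma compact_support_vanish:
  assumes "compact (closure {\<xi>. \<phi> \<xi> \<noteq> 0})"
  shows "\<exists>M. \<forall>x. norm x > M \<longrightarrow> \<phi> x = (0::complex)"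
proof -
  obtain M where M: "\<And>x. x \<in> closure {\<xi>. \<phi> \<xi> \<noteq> 0} \<Longrightarrow> norm x \<le> M"
    using compact_imp_bounded[OF assms] unfolding bounded_iff by blast
  have "\<phi> x = 0" if "norm x > M" for x
    using M[of x] closure_subset[of "{\<xi>. \<phi> \<xi> \<noteq> 0}"] that by force
  then show ?thesis by blast
qed

lemma smooth_compact_schwartz: "smooth \<phi> \<Longrightarrow> compact (closure {\<xi>. \<phi> \<xi> \<noteq> 0}) \<Longrightarrow> schwartz \<phi>"
  using compact_support_vanish[of \<phi>] schwartz_vanish[of \<phi>] by blast

text \<open>A partition of unity is avoided by splitting off one ball of the finite subcover at a time.\<close>

lemma hat_vanish_off_spectrum:
  fixes f :: "'n rspace \<Rightarrow> 'n::{finite,linorder} cliff"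
  assumes f: "borel_Lp p f" "p \<ge> 1" and \<psi>: "smooth \<psi>"
    and K: "compact K" "\<And>x. x \<notin> K \<Longrightarrow> \<psi> x = 0" "K \<inter> spectrum f = {}"
  shows "hat f \<psi> = 0"
proof -
  have "\<forall>x\<in>K. \<exists>r. r > 0 \<and> (\<exists>U. open U \<and> annihilates f U \<and> cball x (2 * r) \<subseteq> U)"
  proof
    fix x assume "x \<in> K"
    then obtain U where U: "open U" "annihilates f U" "x \<in> U"
      using K(3) unfolding spectrum_def by blast
    obtain e where "e > 0" "cball x e \<subseteq> U"
      using U open_contains_cball by blast
    \<comment> \<open>Half the radius, because the cutoff that splits off a ball is supported in the
      ball of twice its radius.\<close>
    then show "\<exists>r. r > 0 \<and> (\<exists>U. open U \<and> annihilates f U \<and> cball x (2 * r) \<subseteq> U)"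
      using U by (intro exI[of _ "e / 2"]) auto
  qed
  from bchoice[OF this] obtain r where
    "\<forall>x\<in>K. r x > 0 \<and> (\<exists>U. open U \<and> annihilates f U \<and> cball x (2 * r x) \<subseteq> U)" by (rule exE)
  then have r: "r x > 0" "\<exists>U. open U \<and> annihilates f U \<and> cball x (2 * r x) \<subseteq> U" if "x \<in> K" for x
    using that by auto
  obtain M where M: "\<And>x. x \<in> K \<Longrightarrow> norm x \<le> M"
    using compact_imp_bounded[OF K(1)] unfolding bounded_iff by blast
  have step: "hat f \<psi> = 0"
    if "finite D" "D \<subseteq> K" "smooth \<psi>" "\<And>x. x \<notin> K \<Longrightarrow> \<psi> x = 0" "\<And>y. \<psi> y \<noteq> 0 \<Longrightarrow> \<exists>x\<in>D. y \<in> ball x (r x)" for D \<psi>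
    using that
  proof (induction D arbitrary: \<psi> rule: finite_induct)
    case empty
    then have "\<psi> = (\<lambda>x. 0)" by auto
    then show ?case by (simp add: hat_zero)
  next
    case (insert x D)
    have x: "x \<in> K" using insert by simp
    obtain \<zeta> where \<zeta>: "smooth \<zeta>" "\<And>y. norm (y - x) \<le> r x \<Longrightarrow> \<zeta> y = 1" "\<And>y. norm (y - x) \<ge> 2 * r x \<Longrightarrow> \<zeta> y = 0"
      using exists_cutoff[of "r x" "2 * r x" x] r(1)[OF x] by auto
    obtain U where U: "open U" "annihilates f U" "cball x (2 * r x) \<subseteq> U" using r(2)[OF x] by blast
    have s1: "smooth (\<lambda>y. \<psi> y * \<zeta> y)" "smooth (\<lambda>y. \<psi> y * (1 - \<zeta> y))"
      by (intro smooth_mult smooth_diff smooth_const insert.prems \<zeta>)+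
    have z: "\<psi> y = 0" if "norm y > M" for y using M[of y] insert.prems(3) that by force
    have w: "wiener (\<lambda>y. \<psi> y * \<zeta> y)" "wiener (\<lambda>y. \<psi> y * (1 - \<zeta> y))"
      by (intro schwartz_wiener schwartz_vanish[of _ M] s1; simp add: z)+
    have "{y. \<psi> y * \<zeta> y \<noteq> 0} \<subseteq> cball x (2 * r x)"
      using \<zeta>(3) by (force simp: dist_norm norm_minus_commute)
    then have c: "closure {y. \<psi> y * \<zeta> y \<noteq> 0} \<subseteq> cball x (2 * r x)"
      by (rule closure_minimal) simp
    then have "compact (closure {y. \<psi> y * \<zeta> y \<noteq> 0})"
      by (meson bounded_cball bounded_subset closed_closure compact_eq_bounded_closed)
    then have 1: "hat f (\<lambda>y. \<psi> y * \<zeta> y) = 0"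
      using U(2,3) c s1(1) unfolding annihilates_def by blast
    have 2: "hat f (\<lambda>y. \<psi> y * (1 - \<zeta> y)) = 0"
    proof (rule insert.IH)
      show "D \<subseteq> K" using insert by simp
      show "smooth (\<lambda>y. \<psi> y * (1 - \<zeta> y))" by (rule s1)
      show "\<psi> y * (1 - \<zeta> y) = 0" if "y \<notin> K" for y using insert.prems(3)[OF that] by simp
      fix y assume y: "\<psi> y * (1 - \<zeta> y) \<noteq> 0"
      then have "\<not> norm (y - x) \<le> r x" using \<zeta>(2) by force
      then have "y \<notin> ball x (r x)" by (simp add: dist_norm norm_minus_commute)
      then show "\<exists>x\<in>D. y \<in> ball x (r x)" using insert.prems(4)[of y] y by auto
    qed
    have "hat f (\<lambda>y. \<psi> y * \<zeta> y + \<psi> y * (1 - \<zeta> y)) = 0"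
      by (simp only: hat_add[OF f w] 1 2 add_0)
    then show ?case by (simp add: algebra_simps)
  qed
  have "K \<subseteq> \<Union>((\<lambda>x. ball x (r x)) ` K)" using r(1) by force
  then obtain D where D: "D \<subseteq> K" "finite D" "K \<subseteq> \<Union>((\<lambda>x. ball x (r x)) ` D)"
    using compactE_image[OF K(1), of K "\<lambda>x. ball x (r x)"] by (metis open_ball)
  show ?thesis
    by (rule step[OF D(2,1) \<psi> K(2)]) (use D(3) K(2) in blast)+
qed

text \<open>The bound does not depend on \<open>c\<close>, because dilations preserve the L^1 norm
  of the Fourier transform. It is used with \<open>c\<close> tending to 0, where the cutoff exhausts
  the space, and with \<open>c\<close> tending to infinity, where it shrinks to the origin.\<close>

lemma cutoff_scaled_mult:
  assumes \<zeta>: "cutoff a b \<zeta>" and \<psi>: "schwartz \<psi>" and c: "c > 0"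
  shows "schwartz (\<lambda>x. \<psi> x * \<zeta> (c *\<^sub>R x))"
    and "(LINT \<xi>|lborel. norm (ft (\<lambda>x. \<psi> x * \<zeta> (c *\<^sub>R x)) \<xi>))
      \<le> (LINT \<xi>|lborel. norm (ft \<psi> \<xi>)) * (LINT \<xi>|lborel. norm (ft \<zeta> \<xi>))"
    and "schwartz (\<lambda>x. \<zeta> (c *\<^sub>R x))"
proof -
  have z: "\<zeta> (c *\<^sub>R x) = 0" if "norm x > b / c" for x
  proof -
    have "norm (c *\<^sub>R x) \<ge> b" using that c by (simp add: field_simps)
    then show ?thesis using \<zeta> by (simp add: cutoff_def)
  qed
  have sm: "smooth (\<lambda>x. \<zeta> (c *\<^sub>R x))" by (rule smooth_scale[OF cutoff_smooth_vanish(1)[OF \<zeta>]])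
  show s: "schwartz (\<lambda>x. \<zeta> (c *\<^sub>R x))" by (rule schwartz_vanish[OF sm z])
  show "schwartz (\<lambda>x. \<psi> x * \<zeta> (c *\<^sub>R x))"
    by (rule schwartz_mult[OF \<psi> slow_vanish[OF sm z]])
  show "(LINT \<xi>|lborel. norm (ft (\<lambda>x. \<psi> x * \<zeta> (c *\<^sub>R x)) \<xi>))
      \<le> (LINT \<xi>|lborel. norm (ft \<psi> \<xi>)) * (LINT \<xi>|lborel. norm (ft \<zeta> \<xi>))"
    using ft_mult_L1(2)[OF \<psi> schwartz_integrable[OF s] schwartz_integrable[OF ft_schwartz[OF s]]]
    by (simp add: ft_scale_L1(1)[OF c])
qed

text \<open>Localisation applies to compactly supported functions; expanding cutoffs carry it over
  to Schwartz functions. This is needed because the part of a test function that a cutoff in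
  frequency removes is in general not compactly supported.\<close>

lemma hat_vanish_schwartz:
  fixes f :: "'n rspace \<Rightarrow> 'n::{finite,linorder} cliff"
  assumes f: "borel_Lp p f" "p \<ge> 1" and \<psi>: "schwartz \<psi>"
    and S: "spectrum f \<subseteq> cball 0 \<sigma>" "\<sigma> < \<sigma>'" and z: "\<And>x. norm x < \<sigma>' \<Longrightarrow> \<psi> x = 0"
  shows "hat f \<psi> = 0"
proof -
  obtain \<zeta> :: "'n rspace \<Rightarrow> complex" where \<zeta>: "cutoff 1 2 \<zeta>" using cutoff_exists[of 1 2] by auto
  define c where "c N = inverse (real (Suc N))" for N
  have c0: "c N > 0" for N by (simp add: c_def)
  define \<theta> where "\<theta> N x = \<psi> x - \<psi> x * \<zeta> (c N *\<^sub>R x)" for N x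
  note ws = cutoff_scaled_mult[OF \<zeta> \<psi> c0]
  have sm: "schwartz (\<theta> N)" for N
    unfolding \<theta>_def[abs_def] using schwartz_add[OF \<psi> schwartz_cmult[OF ws(1), of "-1"]] by simp
  \<comment> \<open>The product is supported in a compact shell that the gap between \<sigma> and
    \<sigma>' keeps away from the spectrum.\<close>
  have hz: "hat f (\<lambda>x. \<psi> x * \<zeta> (c N *\<^sub>R x)) = 0" for N
  proof (rule hat_vanish_off_spectrum[OF f schwartz_smooth[OF ws(1)], of "cball 0 (2 / c N) - ball 0 \<sigma>'"])
    show "compact (cball 0 (2 / c N) - ball 0 \<sigma>' :: 'n rspace set)" by (intro compact_diff) auto
    show "(cball 0 (2 / c N) - ball 0 \<sigma>') \<inter> spectrum f = {}" using S by force
    fix x :: "'n rspace" assume "x \<notin> cball 0 (2 / c N) - ball 0 \<sigma>'"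
    then consider "norm x > 2 / c N" | "norm x < \<sigma>'" by force
    then show "\<psi> x * \<zeta> (c N *\<^sub>R x) = 0"
    proof cases
      case 1
      then have "norm (c N *\<^sub>R x) \<ge> 2" using c0[of N] by (simp add: field_simps)
      then show ?thesis using \<zeta> by (simp add: cutoff_def)
    qed (simp add: z)
  qed
  have eq: "hat f (\<theta> N) = hat f \<psi>" for N
  proof -
    have "hat f \<psi> = hat f (\<lambda>x. \<theta> N x + \<psi> x * \<zeta> (c N *\<^sub>R x))" by (simp add: \<theta>_def)
    also have "\<dots> = hat f (\<theta> N)"
      by (simp only: hat_add[OF f schwartz_wiener[OF sm] schwartz_wiener[OF ws(1)]] hz add_0_right)
    finally show ?thesis ..
  qed
  have "(\<lambda>N. hat f (\<theta> N)) \<longlonglongrightarrow> 0"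
  proof (rule hat_tendsto_0[OF f schwartz_wiener[OF sm]])
    let ?A = "LINT \<xi>|lborel. norm (ft \<psi> \<xi>)" and ?Z = "LINT \<xi>|lborel. norm (ft \<zeta> \<xi>)"
    show "(LINT \<xi>|lborel. norm (ft (\<theta> N) \<xi>)) \<le> ?A + ?A * ?Z" for N
    proof -
      have e: "ft (\<theta> N) \<xi> = ft \<psi> \<xi> - ft (\<lambda>x. \<psi> x * \<zeta> (c N *\<^sub>R x)) \<xi>" for \<xi>
        unfolding \<theta>_def[abs_def] by (rule ft_diff[OF schwartz_integrable[OF \<psi>] schwartz_integrable[OF ws(1)]])
      have i: "integrable lborel (\<lambda>\<xi>. norm (ft \<psi> \<xi>))" "integrable lborel (\<lambda>\<xi>. norm (ft (\<lambda>x. \<psi> x * \<zeta> (c N *\<^sub>R x)) \<xi>))"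
        by (intro integrable_norm schwartz_integrable ft_schwartz \<psi> ws)+
      have "(LINT \<xi>|lborel. norm (ft (\<theta> N) \<xi>)) \<le> (LINT \<xi>|lborel. norm (ft \<psi> \<xi>) + norm (ft (\<lambda>x. \<psi> x * \<zeta> (c N *\<^sub>R x)) \<xi>))"
        by (intro integral_mono integrable_norm schwartz_integrable ft_schwartz sm Bochner_Integration.integrable_add i)
           (simp add: e norm_triangle_ineq4)
      also have "\<dots> \<le> ?A + ?A * ?Z"
        using ws(2)[of N] by (simp add: Bochner_Integration.integral_add[OF i])
      finally show ?thesis .
    qed
    obtain Z where Z: "\<And>x. norm (\<zeta> x) \<le> Z"
      using schwartz_bounded[OF cutoff_schwartz[OF \<zeta>]] unfolding bounded_iff by auto
    have [measurable]: "\<psi> \<in> borel_measurable borel" "\<zeta> \<in> borel_measurable borel"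
      using smooth_measurable schwartz_smooth \<psi> cutoff_schwartz[OF \<zeta>] by blast+
    have "(\<lambda>N. LINT x|lborel. norm (\<theta> N x)) \<longlonglongrightarrow> (LINT x|lborel. (\<lambda>x::'n rspace. 0) x)"
    proof (rule integral_dominated_convergence[where w = "\<lambda>x. (1 + Z) * norm (\<psi> x)"])
      show "integrable lborel (\<lambda>x. (1 + Z) * norm (\<psi> x))"
        by (intro integrable_mult_right integrable_norm schwartz_integrable \<psi>)
      show "(\<lambda>x. norm (\<theta> N x)) \<in> borel_measurable lborel" for N
        using smooth_measurable[OF schwartz_smooth[OF sm]] by simp
      show "AE x in lborel. norm (norm (\<theta> N x)) \<le> (1 + Z) * norm (\<psi> x)" for N
      proof (intro AE_I2)
        fix x
        have "norm (\<theta> N x) = norm (\<psi> x) * norm (1 - \<zeta> (c N *\<^sub>R x))"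
          by (simp add: \<theta>_def norm_mult[symmetric] algebra_simps)
        also have "\<dots> \<le> norm (\<psi> x) * (1 + Z)"
          using norm_triangle_ineq4[of 1 "\<zeta> (c N *\<^sub>R x)"] Z[of "c N *\<^sub>R x"]
          by (intro mult_left_mono) simp_all
        finally show "norm (norm (\<theta> N x)) \<le> (1 + Z) * norm (\<psi> x)"
          by (simp add: mult.commute)
      qed
      show "AE x in lborel. (\<lambda>N. norm (\<theta> N x)) \<longlonglongrightarrow> 0"
      proof (intro AE_I2)
        fix x :: "'n rspace"
        obtain N0 :: nat where N0: "norm x \<le> real N0" using real_arch_simple by blast
        have "norm (\<theta> N x) = 0" if "N \<ge> N0" for N
        proof -
          have "norm (c N *\<^sub>R x) \<le> 1"
            using that N0 by (simp add: c_def field_simps)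
          then have "\<zeta> (c N *\<^sub>R x) = 1" using \<zeta> by (simp add: cutoff_def)
          then show ?thesis by (simp add: \<theta>_def)
        qed
        then show "(\<lambda>N. norm (\<theta> N x)) \<longlonglongrightarrow> 0"
          by (intro tendsto_eventually) (auto simp: eventually_sequentially)
      qed
    qed simp
    then show "(\<lambda>N. LINT x|lborel. norm (\<theta> N x)) \<longlonglongrightarrow> 0" by simp
  qed
  then have "(\<lambda>N::nat. hat f \<psi>) \<longlonglongrightarrow> 0" by (simp only: eq)
  then show ?thesis by (rule LIMSEQ_unique[OF tendsto_const])
qed

text \<open>Multiplying by cutoffs that shrink to the origin keeps the \<open>L\<^sup>1\<close> norm of the Fourier transform bounded,
  while its supremum tends to \<open>0\<close>; hence so does the pairing with an \<open>L\<^sup>p\<close> function.\<close>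

lemma hat_vanish_point_spectrum:
  fixes f :: "'n rspace \<Rightarrow> 'n::{finite,linorder} cliff"
  assumes f: "borel_Lp p f" "p \<ge> 1" and S: "spectrum f \<subseteq> {0}"
  shows "spectrum f = {}"
proof -
  have "hat f \<psi> = 0" if \<psi>': "smooth \<psi>" "compact (closure {\<xi>. \<psi> \<xi> \<noteq> 0})" for \<psi>
  proof -
    have \<psi>: "schwartz \<psi>" by (rule smooth_compact_schwartz[OF \<psi>'])
    obtain M where M: "\<And>x. norm x > M \<Longrightarrow> \<psi> x = 0" using compact_support_vanish[OF \<psi>'(2)] by blast
    obtain \<zeta> :: "'n rspace \<Rightarrow> complex" where \<zeta>: "cutoff 1 2 \<zeta>" using cutoff_exists[of 1 2] by auto
    define c where "c N = real (Suc N)" for N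
    have c0: "c N > 0" for N by (simp add: c_def)
    note ws = cutoff_scaled_mult[OF \<zeta> \<psi> c0]
    have sd: "schwartz (\<lambda>x. \<psi> x - \<psi> x * \<zeta> (c N *\<^sub>R x))" for N
      using schwartz_add[OF \<psi> schwartz_cmult[OF ws(1), of "-1"]] by simp
    have hz: "hat f (\<lambda>x. \<psi> x - \<psi> x * \<zeta> (c N *\<^sub>R x)) = 0" for N
    proof (rule hat_vanish_off_spectrum[OF f schwartz_smooth[OF sd], of "cball 0 M - ball 0 (1 / c N)"])
      show "compact (cball 0 M - ball 0 (1 / c N) :: 'n rspace set)" by (intro compact_diff) auto
      show "(cball 0 M - ball 0 (1 / c N)) \<inter> spectrum f = {}" using S c0[of N] by force
      fix x :: "'n rspace" assume "x \<notin> cball 0 M - ball 0 (1 / c N)"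
      then consider "norm x > M" | "norm x < 1 / c N" by force
      then show "\<psi> x - \<psi> x * \<zeta> (c N *\<^sub>R x) = 0"
      proof cases
        case 2
        then have "norm (c N *\<^sub>R x) \<le> 1" using c0[of N] by (simp add: field_simps)
        then show ?thesis using \<zeta> by (simp add: cutoff_def)
      qed (simp add: M)
    qed
    have eq: "hat f (\<lambda>x. \<psi> x * \<zeta> (c N *\<^sub>R x)) = hat f \<psi>" for N
    proof -
      have "hat f \<psi> = hat f (\<lambda>x. (\<psi> x - \<psi> x * \<zeta> (c N *\<^sub>R x)) + \<psi> x * \<zeta> (c N *\<^sub>R x))" by simp
      also have "\<dots> = hat f (\<lambda>x. \<psi> x * \<zeta> (c N *\<^sub>R x))"
        by (simp only: hat_add[OF f schwartz_wiener[OF sd] schwartz_wiener[OF ws(1)]] hz add_0)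
      finally show ?thesis ..
    qed
    obtain P where P: "\<And>x. norm (\<psi> x) \<le> P"
      using schwartz_bounded[OF \<psi>] unfolding bounded_iff by auto
    have P0: "P \<ge> 0" using order_trans[OF norm_ge_zero P[of 0]] .
    let ?I = "LINT x|lborel. norm (\<zeta> x)"
    have "(\<lambda>N. hat f (\<lambda>x. \<psi> x * \<zeta> (c N *\<^sub>R x))) \<longlonglongrightarrow> 0"
    proof (rule hat_tendsto_0[OF f schwartz_wiener[OF ws(1)] ws(2)])
      show "(\<lambda>N. LINT x|lborel. norm (\<psi> x * \<zeta> (c N *\<^sub>R x))) \<longlonglongrightarrow> 0"
      proof (rule tendsto_sandwich[of "\<lambda>_. 0" _ _ "\<lambda>N. P * ?I * inverse (c N)"])
        show "\<forall>\<^sub>F N in sequentially. (LINT x|lborel. norm (\<psi> x * \<zeta> (c N *\<^sub>R x))) \<le> P * ?I * inverse (c N)"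
        proof (intro always_eventually allI)
          fix N
          have I0: "?I \<ge> 0" by (simp add: integral_nonneg_AE)
          have "(LINT x|lborel. norm (\<psi> x * \<zeta> (c N *\<^sub>R x))) \<le> (LINT x|lborel. P * norm (\<zeta> (c N *\<^sub>R x)))"
            by (intro integral_mono integrable_mult_right integrable_norm schwartz_integrable ws)
               (simp add: norm_mult mult_right_mono P)
          also have "\<dots> = P * (inverse (c N ^ CARD('n)) * ?I)"
            using integral_affine[of "c N" "\<lambda>x. norm (\<zeta> x)" 0] c0[of N] by simp
          \<comment> \<open>The dimension is at least 1 and \<open>c N\<close> is at least
            1.\<close>
          also have "inverse (c N ^ CARD('n)) \<le> inverse (c N)"
            by (intro le_imp_inverse_le c0 self_le_power) (auto simp: c_def)
          then have "P * (inverse (c N ^ CARD('n)) * ?I) \<le> P * (inverse (c N) * ?I)"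
            by (intro mult_left_mono mult_right_mono I0 P0)
          finally show "(LINT x|lborel. norm (\<psi> x * \<zeta> (c N *\<^sub>R x))) \<le> P * ?I * inverse (c N)"
            by (simp add: mult_ac)
        qed
        show "(\<lambda>N. P * ?I * inverse (c N)) \<longlonglongrightarrow> 0"
          unfolding c_def by (intro tendsto_mult_right_zero LIMSEQ_inverse_real_of_nat)
      qed (auto intro!: always_eventually integral_nonneg_AE)
    qed
    then have "(\<lambda>N::nat. hat f \<psi>) \<longlonglongrightarrow> 0" by (simp only: eq)
    then show ?thesis by (rule LIMSEQ_unique[OF tendsto_const])
  qed
  then have "annihilates f UNIV" unfolding annihilates_def by blast
  then show ?thesis unfolding spectrum_def by blast
qed

lemma dist_apply_fourier:
  assumes f': "\<And>\<Phi>. \<Phi> \<in> borel_measurable borel \<Longrightarrow> dist_of_fun f \<Phi> = pairing f' \<Phi>" and \<psi>: "wiener \<psi>"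
  shows "dist_apply (dist_fourier (dist_of_fun f)) \<psi> = hat f' \<psi>"
  using f'[OF fourier_measurable[OF cwiener_cliff_of_complex[OF \<psi>]]]
  by (simp add: dist_apply_def dist_fourier_def hat_def)

lemma dist_support_eq_spectrum:
  assumes f': "\<And>\<Phi>. \<Phi> \<in> borel_measurable borel \<Longrightarrow> dist_of_fun f \<Phi> = pairing f' \<Phi>"
  shows "dist_support (dist_fourier (dist_of_fun f)) = spectrum f'"
  using dist_apply_fourier[OF f' schwartz_wiener[OF smooth_compact_schwartz]]
  unfolding dist_support_def spectrum_def annihilates_def
  by (smt (verit, del_insts) Collect_cong)

section \<open>Bounds for the powers of the Dirac operator\<close>

lemma wgt_le_1: "wgt x \<le> 1"
  unfolding wgt_def by (simp add: inverse_le_1_iff one_le_power)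

lemma dist_apply_dirac_power:
  assumes f': "\<And>\<Phi>. \<Phi> \<in> borel_measurable borel \<Longrightarrow> dist_of_fun f \<Phi> = pairing f' \<Phi>"
    and \<phi>: "schwartz \<phi>" and \<alpha>: "\<alpha> > 0" and k: "k > 0"
  shows "dist_apply ((feller_dirac \<alpha> \<theta> ^^ k) (dist_of_fun f)) \<phi> = pairing f' (fourier (\<lambda>\<xi>. ift \<phi> \<xi> *s dsym \<alpha> \<theta> k \<xi>))"
proof -
  obtain l where k: "k = Suc l" using k by (cases k) auto
  have "cwiener (\<lambda>\<xi>. ift \<phi> \<xi> *s dsym \<alpha> \<theta> k \<xi>)"
    by (intro cwiener_mult_dsym ift_schwartz \<phi> \<alpha>) (simp add: k)
  from f'[OF fourier_measurable[OF this]] show ?thesis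
    unfolding dist_apply_def feller_dirac_funpow k dirac_test_funpow[OF \<phi> \<alpha>] .
qed

text \<open>Both the L^1 norm and the supremum of \<phi> are bounded by multiples of
  \<open>B\<close>, so the powers \<open>p - 1\<close> and 1 combine and the bound is linear in
  \<open>B\<close> after the p-th root.\<close>

lemma pairing_scalar_bound:
  fixes g :: "'n rspace \<Rightarrow> 'n::{finite,linorder} cliff"
  assumes g: "borel_Lp p g" "p \<ge> 1" and \<phi>: "\<phi> \<in> borel_measurable borel" and B: "B \<ge> 0" "\<And>x. norm (\<phi> x) \<le> B * wgt x"
  shows "norm (pairing g (\<lambda>x. cliff_of_complex (\<phi> x))) \<le> real CARD('n set) ^ 2 * B *
    ((LINT x|lborel. wgt (x::'n rspace)) powr (p - 1)) powr (1 / p) * (LINT x|lborel. norm (g x) powr p) powr (1 / p)"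
proof -
  let ?W = "LINT x|lborel. wgt (x::'n rspace)" and ?I = "LINT x|lborel. norm (g x) powr p"
  have W0: "?W \<ge> 0" by (intro integral_nonneg_AE AE_I2 less_imp_le wgt_pos)
  have I0: "?I \<ge> 0" by (simp add: integral_nonneg_AE)
  have m: "(\<lambda>x. cliff_of_complex (\<phi> x) :: 'n cliff) \<in> borel_measurable borel"
    unfolding cliff_of_complex_def using \<phi> by (intro smult_measurable) auto
  have nb: "norm (cliff_of_complex (\<phi> x) :: 'n cliff) \<le> B * wgt x" for x using B by simp
  have b1: "norm (cliff_of_complex (\<phi> x) :: 'n cliff) \<le> B" for x
    using order_trans[OF nb mult_left_mono[OF wgt_le_1 B(1)]] by simp
  note i = integrable_wgt_bound[OF m nb]
  have "norm (pairing g (\<lambda>x. cliff_of_complex (\<phi> x))) \<le> real CARD('n set) ^ 2 *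
      ((LINT x|lborel. norm (cliff_of_complex (\<phi> x) :: 'n cliff)) powr (p - 1) * (B * ?I)) powr (1 / p)"
    by (rule pairing_bound(2)[OF g i(1) b1])
  also have "\<dots> \<le> real CARD('n set) ^ 2 * ((B * ?W) powr (p - 1) * (B * ?I)) powr (1 / p)"
    by (intro mult_left_mono powr_mono2 mult_right_mono i(2) mult_nonneg_nonneg B I0 integral_nonneg_AE)
       (use g(2) in auto)
  also have "(B * ?W) powr (p - 1) * (B * ?I) = B powr p * (?W powr (p - 1) * ?I)"
  proof (cases "B = 0")
    case False
    then have "B powr (p - 1) * B = B powr p" using B by (simp add: powr_diff)
    then show ?thesis using B W0 by (simp add: powr_mult mult_ac)
  qed (use g(2) in simp)
  also have "(B powr p * (?W powr (p - 1) * ?I)) powr (1 / p) = B * ((?W powr (p - 1)) powr (1 / p) * ?I powr (1 / p))"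
    using B W0 I0 g(2) by (simp add: powr_mult powr_powr)
  finally show ?thesis by (simp only: mult.assoc)
qed

lemma Lp_norm_borel:
  fixes g :: "'n rspace \<Rightarrow> 'n::{finite,linorder} cliff"
  assumes "p > 0"
  shows "((LINT x|lborel. (2 powr (real CARD('n) / 2)) powr p * norm (g x) powr p)) powr (1 / p)
    = 2 powr (real CARD('n) / 2) * (LINT x|lborel. norm (g x) powr p) powr (1 / p)"
proof -
  have "(LINT x|lborel. norm (g x) powr p) \<ge> 0" by (simp add: integral_nonneg_AE)
  then show ?thesis using assms by (simp add: powr_mult powr_powr)
qed

text \<open>Dividing a test function by the symbol expresses \<open>\<langle>Ff, \<psi>\<rangle>\<close> through the pairing of the \<open>k\<close>-th power
  with the Fourier transform of \<open>\<psi> m\<^sup>-\<^sup>k\<close>.\<close>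

lemma dirac_power_lower_bound:
  fixes f :: "'n rspace \<Rightarrow> 'n::{finite,linorder} cliff"
  assumes f': "\<And>\<Phi>. \<Phi> \<in> borel_measurable borel \<Longrightarrow> dist_of_fun f \<Phi> = pairing f' \<Phi>" "borel_Lp p f'"
    and p: "p \<ge> 1" and \<alpha>: "\<alpha> > 0" and \<psi>: "annular \<epsilon> M \<psi>" and e: "\<epsilon> > 0"
  shows "\<exists>C\<ge>0. \<forall>k>0. \<forall>g\<in>Lp_space p. dist_eq ((feller_dirac \<alpha> \<theta> ^^ k) (dist_of_fun f)) (dist_of_fun g) \<longrightarrow>
     norm (hat f' \<psi>) \<le> C * (2 + real k * \<alpha>) ^ (2 * CARD('n)) * \<epsilon> powr (- (real k * \<alpha>)) * Lp_norm p g"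
proof -
  let ?m = "2 * CARD('n)"
  let ?W = "((LINT x|lborel. wgt (x::'n rspace)) powr (p - 1)) powr (1 / p)"
  let ?\<kappa> = "real CARD('n set) ^ 2"
  have "\<forall>i. \<exists>C\<ge>0. \<forall>s B \<xi>. 0 \<le> B \<longrightarrow> (\<forall>x::'n rspace. \<epsilon> \<le> norm x \<longrightarrow> norm x \<le> M \<longrightarrow> norm x powr s \<le> B) \<longrightarrow>
     norm (ft (\<lambda>x. \<psi> x * hsym i s x) \<xi>) \<le> C * (2 + \<bar>s\<bar>) ^ ?m * B * wgt \<xi>"
    using annular_hsym_bound[OF \<psi> e] by blast
  from choice[OF this] obtain D where
    D': "\<forall>i. D i \<ge> 0 \<and> (\<forall>s B \<xi>. 0 \<le> B \<longrightarrow> (\<forall>x::'n rspace. \<epsilon> \<le> norm x \<longrightarrow> norm x \<le> M \<longrightarrow> norm x powr s \<le> B) \<longrightarrow>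
     norm (ft (\<lambda>x. \<psi> x * hsym i s x) \<xi>) \<le> D i * (2 + \<bar>s\<bar>) ^ ?m * B * wgt \<xi>)" by (rule exE)
  then have D0: "D i \<ge> 0" for i by blast
  have D2: "norm (ft (\<lambda>x. \<psi> x * hsym i s x) \<xi>) \<le> D i * (2 + \<bar>s\<bar>) ^ ?m * B * wgt \<xi>"
    if "0 \<le> B" "\<And>x::'n rspace. \<epsilon> \<le> norm x \<Longrightarrow> norm x powr s \<le> B" for i s B \<xi>
    using D' that by blast
  define D1 where "D1 = (\<Sum>i\<in>UNIV. D i)"
  have D1: "D1 \<ge> 0" unfolding D1_def by (intro sum_nonneg D0)
  have nb: "norm (blade A :: 'n cliff) = 1" for A by (simp add: blade_def)
  have bl: "norm (blade A $ B :: complex) \<le> 1" for A B :: "'n set" by (simp add: blade_def axis_def)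
  \<comment> \<open>The division by 2^(n/2) compensates the factor that \<open>Lp_norm\<close>
    carries compared with the Euclidean norm.\<close>
  define C where "C = (\<Sum>A\<in>(UNIV::'n set set). ?\<kappa> * (?\<kappa> * D1 * ?W)) / 2 powr (real CARD('n) / 2)"
  have W0: "?W \<ge> 0" by simp
  have C0: "C \<ge> 0" unfolding C_def by (intro divide_nonneg_nonneg sum_nonneg mult_nonneg_nonneg D1 W0) auto
  have "norm (hat f' \<psi>) \<le> C * (2 + real k * \<alpha>) ^ ?m * \<epsilon> powr (- (real k * \<alpha>)) * Lp_norm p g"
    if k: "k > 0" and g: "g \<in> Lp_space p"
      and eq: "dist_eq ((feller_dirac \<alpha> \<theta> ^^ k) (dist_of_fun f)) (dist_of_fun g)" for k g
  proof -
    obtain g' where g': "borel_Lp p g'" "\<And>\<Phi>. \<Phi> \<in> borel_measurable borel \<Longrightarrow> dist_of_fun g \<Phi> = pairing g' \<Phi>"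
      and gn: "Lp_norm p g = ((LINT x|lborel. (2 powr (real CARD('n) / 2)) powr p * norm (g' x) powr p)) powr (1 / p)"
      by (rule Lp_space_borel[OF g]) (rule that)
    let ?s = "real k * \<alpha>"
    let ?I = "(LINT x|lborel. norm (g' x) powr p) powr (1 / p)"
    \<comment> \<open>The coordinates of \<psi> m^(-k). They are smooth because \<psi> vanishes near
      the origin, and being scalar they are admissible in \<open>dist_eq\<close>.\<close>
    define \<Psi> where "\<Psi> A x = \<psi> x * dsym_inv \<alpha> \<theta> k x $ A" for A and x :: "'n rspace"
    let ?c = "\<lambda>A i. case i of None \<Rightarrow> cnj (fcoef cos \<theta> k) * blade {} $ (A :: 'n set) | Some j \<Rightarrow> - cnj (fcoef sin \<theta> k) * blade {j} $ A"
    have c1: "norm (?c A i) \<le> 1" for A i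
      by (cases i) (use bl norm_fcoef_cos norm_fcoef_sin in \<open>auto simp: norm_mult intro!: mult_le_one\<close>)
    have \<Psi>: "\<Psi> A = (\<lambda>x. \<Sum>i\<in>UNIV. ?c A i * (\<psi> x * hsym i (- ?s) x))" for A
      by (simp add: \<Psi>_def[abs_def] dsym_inv_def csym_nth sum_distrib_left mult_ac)
    have sch1: "schwartz (\<lambda>x. \<psi> x * hsym i (- ?s) x)" for i
      by (rule annular_schwartz[OF annular_hsym[OF \<psi> e]])
    have sum_schwartz: "schwartz (\<lambda>x. \<Sum>i\<in>I. h i x)" if "finite I" "\<And>i. schwartz (h i)" for I and h :: "'n option \<Rightarrow> 'n rspace \<Rightarrow> complex"
      using that by (induction I rule: finite_induct) (auto intro: schwartz_add schwartz_vanish)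
    have sch: "schwartz (\<Psi> A)" for A
      unfolding \<Psi> by (intro sum_schwartz schwartz_cmult sch1) simp
    have ftsum: "ft (\<lambda>x. \<Sum>i\<in>I. h i x) \<xi> = (\<Sum>i\<in>I. ft (h i) \<xi>)" if "finite I" "\<And>i. schwartz (h i)" for I \<xi> and h :: "'n option \<Rightarrow> 'n rspace \<Rightarrow> complex"
      using that
    proof (induction I rule: finite_induct)
      case (insert i I)
      then show ?case by (simp add: ft_add schwartz_integrable sum_schwartz)
    qed (simp add: ft_def)
    let ?B = "D1 * (2 + ?s) ^ ?m * \<epsilon> powr (- ?s)"
    have B0: "?B \<ge> 0" using D1 \<alpha> by simp
    have ft\<Psi>: "norm (ft (\<Psi> A) \<xi>) \<le> ?B * wgt \<xi>" for A \<xi>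
    proof -
      have "ft (\<Psi> A) \<xi> = (\<Sum>i\<in>UNIV. ?c A i * ft (\<lambda>x. \<psi> x * hsym i (- ?s) x) \<xi>)"
        unfolding \<Psi> by (subst ftsum) (simp_all add: schwartz_cmult sch1 ft_cmult)
      also have "norm \<dots> \<le> (\<Sum>i\<in>UNIV. norm (?c A i * ft (\<lambda>x. \<psi> x * hsym i (- ?s) x) \<xi>))"
        by (rule norm_sum)
      also have "\<dots> \<le> (\<Sum>i\<in>UNIV. D i * (2 + ?s) ^ ?m * \<epsilon> powr (- ?s) * wgt \<xi>)"
      proof (rule sum_mono)
        fix i
        \<comment> \<open>The exponent is negative, so the inner radius of the annulus governs; this
          is the origin of the growth rate \<epsilon>^(-k \<alpha>).\<close>
        have le: "norm x powr (- ?s) \<le> \<epsilon> powr (- ?s)" if "\<epsilon> \<le> norm x" for x :: "'n rspace"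
          using that e \<alpha> by (intro powr_mono2') auto
        have "norm (ft (\<lambda>x. \<psi> x * hsym i (- ?s) x) \<xi>) \<le> D i * (2 + \<bar>- ?s\<bar>) ^ ?m * \<epsilon> powr (- ?s) * wgt \<xi>"
          by (rule D2[OF powr_ge_zero le])
        moreover have "\<bar>- ?s\<bar> = ?s" using \<alpha> by simp
        ultimately have "norm (ft (\<lambda>x. \<psi> x * hsym i (- ?s) x) \<xi>) \<le> D i * (2 + ?s) ^ ?m * \<epsilon> powr (- ?s) * wgt \<xi>"
          by simp
        from mult_mono[OF c1[of A i] this] show "norm (?c A i * ft (\<lambda>x. \<psi> x * hsym i (- ?s) x) \<xi>) \<le> D i * (2 + ?s) ^ ?m * \<epsilon> powr (- ?s) * wgt \<xi>"
          unfolding norm_mult by simp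
      qed
      also have "\<dots> = ?B * wgt \<xi>" by (simp add: D1_def sum_distrib_right)
      finally show ?thesis .
    qed
    have cw: "cwiener (\<lambda>x. \<Psi> A x *s dsym \<alpha> \<theta> k x)" for A by (intro cwiener_mult_dsym sch \<alpha> k)
    have pe: "pairing f' (fourier (\<lambda>x. \<Psi> A x *s dsym \<alpha> \<theta> k x)) = pairing g' (\<lambda>x. cliff_of_complex (ft (\<Psi> A) x))" for A
    proof -
      have s: "schwartz (ft (\<Psi> A))" by (rule ft_schwartz[OF sch])
      have m: "(\<lambda>x. cliff_of_complex (ft (\<Psi> A) x) :: 'n cliff) \<in> borel_measurable borel"
        unfolding cliff_of_complex_def using smooth_measurable[OF schwartz_smooth[OF s]] by (intro smult_measurable) auto
      have "pairing f' (fourier (\<lambda>x. \<Psi> A x *s dsym \<alpha> \<theta> k x)) = dist_apply ((feller_dirac \<alpha> \<theta> ^^ k) (dist_of_fun f)) (ft (\<Psi> A))"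
        using dist_apply_dirac_power[OF f'(1) s \<alpha> k, of \<theta>] by (simp add: ift_ft_schwartz[OF sch])
      also have "\<dots> = dist_apply (dist_of_fun g) (ft (\<Psi> A))"
        using eq s unfolding dist_eq_def by blast
      also have "\<dots> = pairing g' (\<lambda>x. cliff_of_complex (ft (\<Psi> A) x))"
        unfolding dist_apply_def by (rule g'(2)[OF m])
      finally show ?thesis .
    qed
    \<comment> \<open>Reassembles \<psi> m^(-k) m^k with every blade on the left, so that the
      pairing with the k-th power can be taken coordinate by coordinate.\<close>
    have "(\<lambda>x. cliff_of_complex (\<psi> x)) = (\<lambda>x. \<Sum>A\<in>UNIV. blade A \<odot> (\<Psi> A x *s dsym \<alpha> \<theta> k x))"
    proof
      fix x :: "'n rspace"
      have "(\<Sum>A\<in>UNIV. blade A \<odot> (\<Psi> A x *s dsym \<alpha> \<theta> k x)) = (\<Sum>A\<in>UNIV. \<Psi> A x *s blade A) \<odot> dsym \<alpha> \<theta> k x"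
        by (simp add: cliff_mult_sum_left cliff_mult_smult_left cliff_mult_smult_right)
      also have "(\<Sum>A\<in>UNIV. \<Psi> A x *s blade A) = \<psi> x *s (\<Sum>A\<in>UNIV. dsym_inv \<alpha> \<theta> k x $ A *s blade A)"
        by (simp add: \<Psi>_def bounded_bilinear.sum_right[OF bounded_bilinear_smult] vector_smult_assoc)
      also have "(\<Sum>A\<in>UNIV. dsym_inv \<alpha> \<theta> k x $ A *s blade A) = dsym_inv \<alpha> \<theta> k x"
        by (rule cliff_expand[symmetric])
      also have "(\<psi> x *s dsym_inv \<alpha> \<theta> k x) \<odot> dsym \<alpha> \<theta> k x = cliff_of_complex (\<psi> x)"
      proof (cases "x = 0")
        case True
        then have "\<psi> x = 0" using \<psi> e by (simp add: annular_def)
        then show ?thesis by (simp add: cliff_of_complex_def bounded_bilinear.zero_left[OF bounded_bilinear_cliff_mult])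
      next
        case False
        then show ?thesis by (simp add: cliff_mult_smult_left dsym_inv_mult cliff_of_complex_def)
      qed
      finally show "cliff_of_complex (\<psi> x) = (\<Sum>A\<in>UNIV. blade A \<odot> (\<Psi> A x *s dsym \<alpha> \<theta> k x))" ..
    qed
    then have "hat f' \<psi> = pairing f' (fourier (\<lambda>x. \<Sum>A\<in>UNIV. blade A \<odot> (\<Psi> A x *s dsym \<alpha> \<theta> k x)))"
      by (simp add: hat_def)
    also have "\<dots> = (\<Sum>A\<in>UNIV. pairing f' (fourier (\<lambda>x. blade A \<odot> (\<Psi> A x *s dsym \<alpha> \<theta> k x))))"
      by (rule pairing_fourier_sum[OF f'(2) p]) (auto intro: cwiener_left_mult cw)
    also have "\<dots> = (\<Sum>A\<in>UNIV. blade A \<odot> pairing g' (\<lambda>x. cliff_of_complex (ft (\<Psi> A) x)))"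
      by (simp only: pairing_fourier_left_mult[OF f'(2) p cw] pe)
    also have "norm \<dots> \<le> (\<Sum>A\<in>UNIV. norm (blade A \<odot> pairing g' (\<lambda>x. cliff_of_complex (ft (\<Psi> A) x))))"
      by (rule norm_sum)
    also have "\<dots> \<le> (\<Sum>A\<in>(UNIV::'n set set). ?\<kappa> * (?\<kappa> * ?B * ?W * ?I))"
    proof (rule sum_mono)
      fix A
      have "norm (blade A \<odot> pairing g' (\<lambda>x. cliff_of_complex (ft (\<Psi> A) x))) \<le> ?\<kappa> * norm (blade A :: 'n cliff) * norm (pairing g' (\<lambda>x. cliff_of_complex (ft (\<Psi> A) x)))"
        by (rule norm_cliff_mult_le)
      also have "\<dots> = ?\<kappa> * norm (pairing g' (\<lambda>x. cliff_of_complex (ft (\<Psi> A) x)))" by (simp only: nb mult_1_right)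
      also have "\<dots> \<le> ?\<kappa> * (?\<kappa> * ?B * ?W * ?I)"
        by (intro mult_left_mono pairing_scalar_bound[OF g'(1) p _ B0] ft\<Psi> ft_measurable schwartz_integrable sch) simp
      finally show "norm (blade A \<odot> pairing g' (\<lambda>x. cliff_of_complex (ft (\<Psi> A) x))) \<le> ?\<kappa> * (?\<kappa> * ?B * ?W * ?I)" .
    qed
    also have "\<dots> = C * (2 + ?s) ^ ?m * \<epsilon> powr (- ?s) * Lp_norm p g"
    proof -
      have "Lp_norm p g = 2 powr (real CARD('n) / 2) * ?I"
        unfolding gn by (rule Lp_norm_borel) (use p in simp)
      moreover have "C * 2 powr (real CARD('n) / 2) = (\<Sum>A\<in>(UNIV::'n set set). ?\<kappa> * (?\<kappa> * D1 * ?W))"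
        unfolding C_def by simp
      moreover have "C * (2 + ?s) ^ ?m * \<epsilon> powr (- ?s) * (2 powr (real CARD('n) / 2) * ?I)
        = (C * 2 powr (real CARD('n) / 2)) * ((2 + ?s) ^ ?m * \<epsilon> powr (- ?s) * ?I)"
        by (simp only: mult_ac)
      ultimately show ?thesis by (simp only: sum_constant) (simp only: mult_ac)
    qed
    finally show ?thesis .
  qed
  then show ?thesis using C0 by blast
qed

text \<open>If \<open>h\<close> is not integrable and \<open>c\<close> is not 0, both integrals have
  the default value 0. This matters at the points where the integral defining the convolution may
  diverge.\<close>

lemma integral_smult:
  fixes h :: "'a \<Rightarrow> complex ^ 'm"
  shows "(LINT y|M. c *s h y) = c *s (LINT y|M. h y)"
proof (cases "c = 0 \<or> integrable M h")
  case True
  then show ?thesis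
    using integral_bounded_linear[OF bounded_bilinear.bounded_linear_right[OF bounded_bilinear_smult, of c]]
    by auto
next
  case False
  have "\<not> integrable M (\<lambda>y. c *s h y)"
  proof
    assume "integrable M (\<lambda>y. c *s h y)"
    then have "integrable M (\<lambda>y. inverse c *s (c *s h y))"
      by (rule integrable_bounded_linear[OF bounded_bilinear.bounded_linear_right[OF bounded_bilinear_smult]])
    then show False using False by (simp add: vector_smult_assoc)
  qed
  then show ?thesis using False by (simp add: not_integrable_integral_eq)
qed

text \<open>Expanding the test function in blades, placed on the left, reduces the claim to its
  scalar coordinates.\<close>

lemma hat_combination_vanish:
  fixes f :: "'n rspace \<Rightarrow> 'n::{finite,linorder} cliff"
  assumes f: "borel_Lp p f" "p \<ge> 1" and H: "\<And>A. schwartz (\<lambda>x. H x $ A)" and z: "\<And>A. hat f (\<lambda>x. H x $ A) = 0"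
  shows "pairing f (fourier H) = 0"
proof -
  have cw: "cwiener (\<lambda>x. cliff_of_complex (H x $ A))" for A
    by (intro cwiener_cliff_of_complex schwartz_wiener H)
  have "H = (\<lambda>x. \<Sum>A\<in>UNIV. blade A \<odot> cliff_of_complex (H x $ A))"
    using cliff_expand by (auto simp: cliff_of_complex_def cliff_mult_smult_right fun_eq_iff)
  then have "pairing f (fourier H) = pairing f (fourier (\<lambda>x. \<Sum>A\<in>UNIV. blade A \<odot> cliff_of_complex (H x $ A)))"
    by simp
  also have "\<dots> = (\<Sum>A\<in>UNIV. pairing f (fourier (\<lambda>x. blade A \<odot> cliff_of_complex (H x $ A))))"
    by (rule pairing_fourier_sum[OF f]) (auto intro: cwiener_left_mult cw)
  also have "\<dots> = 0"
    using z by (simp add: pairing_fourier_left_mult[OF f cw] hat_def bounded_bilinear.zero_right[OF bounded_bilinear_cliff_mult])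
  finally show ?thesis .
qed

text \<open>On a band-limited function the \<open>k\<close>-th power acts as convolution with the integrable kernel whose
  Fourier transform is the symbol times a cutoff.\<close>

lemma dirac_power_upper_bound:
  fixes f :: "'n rspace \<Rightarrow> 'n::{finite,linorder} cliff"
  assumes f': "\<And>\<Phi>. \<Phi> \<in> borel_measurable borel \<Longrightarrow> dist_of_fun f \<Phi> = pairing f' \<Phi>" "borel_Lp p f'"
    and p: "p \<ge> 1" and \<alpha>: "\<alpha> > 0" and S: "spectrum f' \<subseteq> cball 0 \<sigma>" "0 < \<sigma>" "\<sigma> < \<sigma>'"
  shows "\<exists>C\<ge>0. \<forall>k>0. \<exists>g\<in>Lp_space p. dist_eq ((feller_dirac \<alpha> \<theta> ^^ k) (dist_of_fun f)) (dist_of_fun g) \<and>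
     Lp_norm p g \<le> C * (2 + real k * \<alpha>) ^ (2 * CARD('n)) * \<sigma>' powr (real k * \<alpha>)"
proof -
  let ?m = "2 * CARD('n)"
  let ?\<kappa> = "real CARD('n set) ^ 2"
  \<comment> \<open>An intermediate radius: the cutoff is 1 up to \<open>a\<close>, beyond the
    spectrum with room to spare, and 0 from \<open>\<sigma>'\<close> on.\<close>
  define a where "a = (\<sigma> + \<sigma>') / 2"
  have a: "0 < a" "\<sigma> < a" "a < \<sigma>'" unfolding a_def using S by auto
  obtain \<zeta> :: "'n rspace \<Rightarrow> complex" where \<zeta>: "cutoff a \<sigma>' \<zeta>" using cutoff_exists[OF a(1,3)] by blast
  have "\<forall>i. \<exists>C\<ge>0. \<forall>s>0. integrable lborel (\<lambda>x. \<zeta> x * hsym i s x) \<and> integrable lborel (ft (\<lambda>x. \<zeta> x * hsym i s x)) \<and>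
    (LINT \<xi>|lborel. norm (ft (\<lambda>x. \<zeta> x * hsym i s x) \<xi>)) \<le> C * (2 + s) ^ ?m * \<sigma>' powr s / (1 - 2 powr (- s))"
    using cutoff_hsym_L1[OF \<zeta>] by blast
  from choice[OF this] obtain D where
    D': "\<forall>i. D i \<ge> 0 \<and> (\<forall>s>0. integrable lborel (\<lambda>x. \<zeta> x * hsym i s x) \<and> integrable lborel (ft (\<lambda>x. \<zeta> x * hsym i s x)) \<and>
    (LINT \<xi>|lborel. norm (ft (\<lambda>x. \<zeta> x * hsym i s x) \<xi>)) \<le> D i * (2 + s) ^ ?m * \<sigma>' powr s / (1 - 2 powr (- s)))" by (rule exE)
  then have D0: "D i \<ge> 0" and Dint: "s > 0 \<Longrightarrow> integrable lborel (\<lambda>x. \<zeta> x * hsym i s x)"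
    "s > 0 \<Longrightarrow> integrable lborel (ft (\<lambda>x. \<zeta> x * hsym i s x))"
    and DI: "s > 0 \<Longrightarrow> (LINT \<xi>|lborel. norm (ft (\<lambda>x. \<zeta> x * hsym i s x) \<xi>)) \<le> D i * (2 + s) ^ ?m * \<sigma>' powr s / (1 - 2 powr (- s))" for i s
    by blast+
  \<comment> \<open>For \<open>k > 0\<close> the degree k \<alpha> is at least \<alpha>, so the
    geometric factor 1/(1 - 2^(-k \<alpha>)) is bounded uniformly in \<open>k\<close>.\<close>
  define D1 where "D1 = (\<Sum>i\<in>UNIV. D i / (1 - 2 powr (- \<alpha>)))"
  have q: "1 - 2 powr (- \<alpha>) > 0" using \<alpha> by (simp add: powr_less_one)
  have D1: "D1 \<ge> 0" unfolding D1_def using q by (intro sum_nonneg divide_nonneg_nonneg D0) auto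
  let ?N = "real CARD('n set)"
  let ?If = "LINT x|lborel. norm (f' x) powr p"
  define C where "C = 2 powr (real CARD('n) / 2) * (?\<kappa> * (?N * D1) * ?If powr (1 / p))"
  have C0: "C \<ge> 0" unfolding C_def using D1 by simp
  have "\<exists>g\<in>Lp_space p. dist_eq ((feller_dirac \<alpha> \<theta> ^^ k) (dist_of_fun f)) (dist_of_fun g) \<and>
     Lp_norm p g \<le> C * (2 + real k * \<alpha>) ^ ?m * \<sigma>' powr (real k * \<alpha>)" if k: "k > 0" for k
  proof -
    let ?s = "real k * \<alpha>"
    have s: "?s > 0" "?s \<ge> \<alpha>" using k \<alpha> by auto
    let ?c = "\<lambda>A i. case i of None \<Rightarrow> fcoef cos \<theta> k * blade {} $ (A :: 'n set) | Some j \<Rightarrow> fcoef sin \<theta> k * blade {j} $ A"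
    have bl: "norm (blade A $ B :: complex) \<le> 1" for A B :: "'n set" by (simp add: blade_def axis_def)
    have c1: "norm (?c A i) \<le> 1" for A i
      by (cases i) (use bl norm_fcoef_cos norm_fcoef_sin in \<open>auto simp: norm_mult intro!: mult_le_one\<close>)
    have dn: "dsym \<alpha> \<theta> k x $ A = (\<Sum>i\<in>UNIV. ?c A i * hsym i ?s x)" for A x
      by (simp add: dsym_def csym_nth)
    define n where "n A x = \<zeta> x * dsym \<alpha> \<theta> k x $ A" for A x
    have n: "n A = (\<lambda>x. \<Sum>i\<in>UNIV. ?c A i * (\<zeta> x * hsym i ?s x))" for A
      by (simp add: n_def[abs_def] dn sum_distrib_left mult_ac)
    have nint: "integrable lborel (n A)" for A
      unfolding n by (intro Bochner_Integration.integrable_sum integrable_mult_right Dint s)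
    have ftsum: "ft (\<lambda>x. \<Sum>i\<in>I. h i x) \<xi> = (\<Sum>i\<in>I. ft (h i) \<xi>)" if "finite I" "\<And>i. integrable lborel (h i)" for I \<xi> and h :: "'n option \<Rightarrow> 'n rspace \<Rightarrow> complex"
      using that
    proof (induction I rule: finite_induct)
      case (insert i I)
      then show ?case by (simp add: ft_add)
    qed (simp add: ft_def)
    have ftn: "ft (n A) = (\<lambda>\<xi>. \<Sum>i\<in>UNIV. ?c A i * ft (\<lambda>x. \<zeta> x * hsym i ?s x) \<xi>)" for A
      unfolding n by (rule ext, subst ftsum) (simp_all add: integrable_mult_right[OF Dint(1)[OF s(1)]] ft_cmult)
    have ftnint: "integrable lborel (ft (n A))" for A
      unfolding ftn by (intro Bochner_Integration.integrable_sum integrable_mult_right Dint s)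
    let ?B = "D1 * (2 + ?s) ^ ?m * \<sigma>' powr ?s"
    have nL1: "(LINT \<xi>|lborel. norm (ft (n A) \<xi>)) \<le> ?B" for A
    proof -
      have i1: "integrable lborel (\<lambda>\<xi>. norm (ft (\<lambda>x. \<zeta> x * hsym i ?s x) \<xi>))" for i
        by (intro integrable_norm Dint s)
      have "(LINT \<xi>|lborel. norm (ft (n A) \<xi>)) \<le> (LINT \<xi>|lborel. (\<Sum>i\<in>UNIV. norm (ft (\<lambda>x. \<zeta> x * hsym i ?s x) \<xi>)))"
      proof (rule integral_mono)
        show "integrable lborel (\<lambda>\<xi>. norm (ft (n A) \<xi>))" by (intro integrable_norm ftnint)
        show "integrable lborel (\<lambda>\<xi>. \<Sum>i\<in>UNIV. norm (ft (\<lambda>x. \<zeta> x * hsym i ?s x) \<xi>))"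
          by (intro Bochner_Integration.integrable_sum i1)
        fix \<xi>
        have "norm (ft (n A) \<xi>) \<le> (\<Sum>i\<in>UNIV. norm (?c A i * ft (\<lambda>x. \<zeta> x * hsym i ?s x) \<xi>))"
          unfolding ftn by (rule norm_sum)
        also have "\<dots> \<le> (\<Sum>i\<in>UNIV. 1 * norm (ft (\<lambda>x. \<zeta> x * hsym i ?s x) \<xi>))"
          unfolding norm_mult by (intro sum_mono mult_right_mono c1) simp
        finally show "norm (ft (n A) \<xi>) \<le> (\<Sum>i\<in>UNIV. norm (ft (\<lambda>x. \<zeta> x * hsym i ?s x) \<xi>))" by simp
      qed
      also have "\<dots> = (\<Sum>i\<in>UNIV. LINT \<xi>|lborel. norm (ft (\<lambda>x. \<zeta> x * hsym i ?s x) \<xi>))"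
        by (rule Bochner_Integration.integral_sum[OF i1])
      also have "\<dots> \<le> (\<Sum>i\<in>UNIV. (D i / (1 - 2 powr (- \<alpha>))) * ((2 + ?s) ^ ?m * \<sigma>' powr ?s))"
      proof (rule sum_mono)
        fix i
        have "(LINT \<xi>|lborel. norm (ft (\<lambda>x. \<zeta> x * hsym i ?s x) \<xi>)) \<le> D i * (2 + ?s) ^ ?m * \<sigma>' powr ?s / (1 - 2 powr (- ?s))"
          by (rule DI[OF s(1)])
        also have "\<dots> \<le> D i * (2 + ?s) ^ ?m * \<sigma>' powr ?s / (1 - 2 powr (- \<alpha>))"
        proof (rule divide_left_mono)
          show le: "1 - 2 powr (- \<alpha>) \<le> 1 - 2 powr (- ?s)" using s(2) by simp
          show "0 \<le> D i * (2 + ?s) ^ ?m * \<sigma>' powr ?s" using D0[of i] s(1) by simp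
          show "0 < (1 - 2 powr (- ?s)) * (1 - 2 powr (- \<alpha>))" using le q by (intro mult_pos_pos) linarith+
        qed
        finally show "(LINT \<xi>|lborel. norm (ft (\<lambda>x. \<zeta> x * hsym i ?s x) \<xi>)) \<le> (D i / (1 - 2 powr (- \<alpha>))) * ((2 + ?s) ^ ?m * \<sigma>' powr ?s)"
          by (simp add: mult_ac)
      qed
      also have "\<dots> = ?B" by (simp only: D1_def sum_distrib_right[symmetric] mult.assoc)
      finally show ?thesis .
    qed
    \<comment> \<open>The convolution kernel, whose Fourier transform is the truncated symbol; its
      L^1 norm carries the whole dependence on \<open>k\<close>.\<close>
    define K :: "'n rspace \<Rightarrow> 'n cliff" where "K x = (\<chi> A. ift (n A) x)" for x
    have Kint: "integrable lborel K"
      by (rule integrable_vecI) (simp add: K_def ift_L1(1)[OF ftnint])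
    have Km[measurable]: "K \<in> borel_measurable borel" using borel_measurable_integrable[OF Kint] by simp
    have KL1: "(LINT x|lborel. norm (K x)) \<le> ?N * ?B"
    proof -
      have i: "integrable lborel (\<lambda>x. norm (ift (n A) x))" for A by (intro integrable_norm ift_L1 ftnint)
      have "(LINT x|lborel. norm (K x)) \<le> (LINT x|lborel. (\<Sum>A\<in>UNIV. norm (ift (n A) x)))"
      proof (rule integral_mono)
        show "integrable lborel (\<lambda>x. \<Sum>A\<in>UNIV. norm (ift (n A) x))" by (intro Bochner_Integration.integrable_sum i)
        fix x
        have "norm (K x) \<le> (\<Sum>A\<in>UNIV. norm (K x $ A))"
          unfolding norm_vec_def[of "K x"] by (rule L2_set_le_sum) simp
        then show "norm (K x) \<le> (\<Sum>A\<in>UNIV. norm (ift (n A) x))" by (simp add: K_def)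
      qed (rule integrable_norm[OF Kint])
      also have "\<dots> = (\<Sum>A\<in>UNIV. LINT x|lborel. norm (ift (n A) x))"
        by (rule Bochner_Integration.integral_sum[OF i])
      also have "\<dots> \<le> (\<Sum>A\<in>(UNIV::'n set set). ?B)"
        by (intro sum_mono order_trans[OF ift_L1(2)[OF ftnint] nL1])
      finally show ?thesis by simp
    qed
    have fm[measurable]: "f' \<in> borel_measurable borel" and fp: "integrable lborel (\<lambda>x. norm (f' x) powr p)"
      using f'(2) by (auto simp: borel_Lp_def)
    define g where "g x = (LINT y|lborel. K (x - y) \<odot> f' y)" for x
    have nl: "norm (K (x - y) \<odot> f' y) \<le> ?\<kappa> * norm (K (x - y)) * norm (f' y)" for x y
      by (rule norm_cliff_mult_le)
    have Em: "(\<lambda>(x, y). K (x - y) \<odot> f' y) \<in> borel_measurable (borel \<Otimes>\<^sub>M borel)" by measurable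
    have cint: "integrable lborel (\<lambda>x. ?\<kappa> * norm (K x))" by (intro integrable_mult_right integrable_norm Kint)
    have Fm: "(\<lambda>y. norm (f' y)) \<in> borel_measurable borel" by measurable
    have c0: "0 \<le> ?\<kappa> * norm (K x)" for x by simp
    note Y = young_convolution[OF Em cint Fm fp c0 norm_ge_zero p nl]
    have g: "borel_Lp p g"
      using Y(1,3) unfolding borel_Lp_def g_def[abs_def] by simp
    note gL = borel_Lp_space[OF g]
    have norm_g: "Lp_norm p g \<le> C * (2 + ?s) ^ ?m * \<sigma>' powr ?s"
    proof -
      have I0: "?If \<ge> 0" by (simp add: integral_nonneg_AE)
      have L0: "(LINT x|lborel. norm (K x)) \<ge> 0" by (simp add: integral_nonneg_AE)
      have "(LINT x|lborel. norm (g x) powr p) \<le> (?\<kappa> * (LINT x|lborel. norm (K x))) powr p * ?If"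
        using Y(2) by (simp add: g_def)
      also have "\<dots> \<le> (?\<kappa> * (?N * ?B)) powr p * ?If"
        by (intro mult_right_mono powr_mono2 mult_left_mono KL1 I0) (use p L0 in auto)
      finally have "(LINT x|lborel. norm (g x) powr p) powr (1 / p) \<le> ((?\<kappa> * (?N * ?B)) powr p * ?If) powr (1 / p)"
        by (intro powr_mono2) (use p in \<open>auto intro!: integral_nonneg_AE\<close>)
      also have "\<dots> = ?\<kappa> * (?N * ?B) * ?If powr (1 / p)"
      proof -
        have *: "(x powr p * ?If) powr (1 / p) = x * ?If powr (1 / p)" if "x \<ge> 0" for x
          using that I0 p by (simp add: powr_mult powr_powr)
        show ?thesis by (rule *) (use D1 s(1) in simp)
      qed
      finally have *: "(LINT x|lborel. norm (g x) powr p) powr (1 / p) \<le> ?\<kappa> * (?N * ?B) * ?If powr (1 / p)" .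
      have "Lp_norm p g = 2 powr (real CARD('n) / 2) * (LINT x|lborel. norm (g x) powr p) powr (1 / p)"
        unfolding gL(3) by (rule Lp_norm_borel) (use p in simp)
      also have "\<dots> \<le> 2 powr (real CARD('n) / 2) * (?\<kappa> * (?N * ?B) * ?If powr (1 / p))"
        by (rule mult_left_mono[OF *]) simp
      finally show ?thesis unfolding C_def by (simp only: mult_ac)
    qed
    have "dist_eq ((feller_dirac \<alpha> \<theta> ^^ k) (dist_of_fun f)) (dist_of_fun g)"
      unfolding dist_eq_def
    proof (intro allI impI)
      fix \<phi> :: "'n rspace \<Rightarrow> complex" assume \<phi>: "schwartz \<phi>"
      obtain P where P: "\<And>x. norm (\<phi> x) \<le> P" using schwartz_bounded[OF \<phi>] unfolding bounded_iff by auto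
      have \<phi>m[measurable]: "\<phi> \<in> borel_measurable borel" by (rule smooth_measurable[OF schwartz_smooth[OF \<phi>]])
      have ty: "integrable lborel (\<lambda>x. \<phi> x *s K (x - y))" for y
      proof -
        have ty: "integrable lborel (\<lambda>x. K (x - y))" using integrable_translate[of K "- y"] Kint by simp
        show ?thesis
        proof (rule Bochner_Integration.integrable_bound[OF integrable_mult_right[OF integrable_norm[OF ty], of P]])
          show "(\<lambda>x. \<phi> x *s K (x - y)) \<in> borel_measurable lborel" by measurable
          show "AE x in lborel. norm (\<phi> x *s K (x - y)) \<le> norm (P * norm (K (x - y)))"
          proof (intro AE_I2)
            fix x
            have "norm (\<phi> x) * norm (K (x - y)) \<le> P * norm (K (x - y))" by (intro mult_right_mono P) simp
            then show "norm (\<phi> x *s K (x - y)) \<le> norm (P * norm (K (x - y)))"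
              unfolding norm_smult real_norm_def by linarith
          qed
        qed
      qed
      have i\<phi>: "schwartz (ift \<phi>)" by (rule ift_schwartz[OF \<phi>])
      \<comment> \<open>The truncated part becomes a convolution; the remainder \<open>?H2\<close>
        vanishes on the ball of radius \<open>a\<close>, which contains the spectrum, and
        contributes nothing.\<close>
      let ?H1 = "\<lambda>\<xi>. (ift \<phi> \<xi> * \<zeta> \<xi>) *s dsym \<alpha> \<theta> k \<xi>"
      let ?H2 = "\<lambda>\<xi>. (ift \<phi> \<xi> * (1 - \<zeta> \<xi>)) *s dsym \<alpha> \<theta> k \<xi>"
      have so: "slow_off a (\<lambda>\<xi>. 1 - \<zeta> \<xi>)" by (rule slow_off_one_minus_cutoff[OF \<zeta>])
      have cw1: "cwiener ?H1" by (intro cwiener_mult_dsym schwartz_mult i\<phi> cutoff_slow[OF \<zeta>] \<alpha> k)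
      have cw2: "cwiener ?H2"
        by (intro cwiener_mult_dsym schwartz_mult i\<phi> \<alpha> k) (use so in \<open>simp add: slow_off_def\<close>)
      have H2: "(\<lambda>\<xi>. ?H2 \<xi> $ A) = (\<lambda>\<xi>. ift \<phi> \<xi> * (\<Sum>i\<in>UNIV. ?c A i * ((1 - \<zeta> \<xi>) * hsym i ?s \<xi>)))" for A
        by (simp add: dn sum_distrib_left mult_ac)
      have slsum: "slow (\<lambda>x. \<Sum>i\<in>I. h i x)" if "finite I" "\<And>i. slow (h i)" for I and h :: "'n option \<Rightarrow> 'n rspace \<Rightarrow> complex"
        using that by (induction I rule: finite_induct) (auto intro: slow_add slow_const)
      have sl: "slow (\<lambda>\<xi>. (1 - \<zeta> \<xi>) * hsym i ?s \<xi>)" for i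
        using slow_off_hsym[OF so a(1)] by (simp add: slow_off_def)
      have H2s: "schwartz (\<lambda>\<xi>. ?H2 \<xi> $ A)" for A
        unfolding H2 by (intro schwartz_mult i\<phi> slsum slow_cmult sl) simp
      have H2v: "?H2 \<xi> $ A = 0" if "norm \<xi> < a" for \<xi> A
        using so that by (simp add: slow_off_def)
      have P2: "pairing f' (fourier ?H2) = 0"
        by (rule hat_combination_vanish[OF f'(2) p H2s hat_vanish_schwartz[OF f'(2) p H2s S(1) a(2) H2v]])
      have "dist_apply ((feller_dirac \<alpha> \<theta> ^^ k) (dist_of_fun f)) \<phi> = pairing f' (fourier (\<lambda>\<xi>. ift \<phi> \<xi> *s dsym \<alpha> \<theta> k \<xi>))"
        by (rule dist_apply_dirac_power[OF f'(1) \<phi> \<alpha> k])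
      also have "(\<lambda>\<xi>. ift \<phi> \<xi> *s dsym \<alpha> \<theta> k \<xi>) = (\<lambda>\<xi>. ?H1 \<xi> + ?H2 \<xi>)"
        by (simp add: fun_eq_iff vec_eq_iff algebra_simps)
      also have "pairing f' (fourier \<dots>) = pairing f' (fourier ?H1)"
        by (simp only: pairing_fourier_add[OF f'(2) p cw1 cw2] P2 add_0_right)
      also have "fourier ?H1 = (\<lambda>y. LINT x|lborel. \<phi> x *s K (x - y))"
      proof (rule ext, unfold vec_eq_iff, rule allI)
        fix y A
        have "(LINT x|lborel. \<phi> x *s K (x - y)) $ A = (LINT x|lborel. \<phi> x * ift (n A) (x - y))"
          by (subst integral_bounded_linear[OF bounded_linear_vec_nth ty, symmetric]) (simp_all add: K_def)
        also have "\<dots> = ft (\<lambda>\<xi>. ift \<phi> \<xi> * n A \<xi>) y"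
          by (rule ft_ift_mult[OF schwartz_integrable[OF \<phi>] nint, symmetric])
        also have "\<dots> = fourier ?H1 y $ A"
          unfolding fourier_nth[OF cwiener_integrable[OF cw1]] by (simp add: n_def mult.assoc)
        finally show "fourier ?H1 y $ A = (LINT x|lborel. \<phi> x *s K (x - y)) $ A" ..
      qed
      also have "pairing f' \<dots> = pairing g (\<lambda>x. cliff_of_complex (\<phi> x))"
      proof -
        let ?T = "\<lambda>x y. \<phi> x *s (K (x - y) \<odot> f' y)"
        have Tm: "(\<lambda>(x, y). ?T x y) \<in> borel_measurable (borel \<Otimes>\<^sub>M borel)" by measurable
        have Tn: "norm (?T x y) \<le> norm (\<phi> x) * (?\<kappa> * norm (K (x - y))) * norm (f' y)" for x y
          unfolding norm_smult using mult_left_mono[OF nl, of "norm (\<phi> x)"] by (simp only: norm_ge_zero mult.assoc)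
        \<comment> \<open>A Schwartz test function is integrable and bounded by \<open>P\<close>,
          which is what the exchange of integrals asks of its outer factor.\<close>
        note F = convolution_fubini[OF Tm integrable_norm[OF schwartz_integrable[OF \<phi>]] P cint Fm fp norm_ge_zero c0 norm_ge_zero p Tn]
        have "pairing f' (\<lambda>y. LINT x|lborel. \<phi> x *s K (x - y)) = (LINT y|lborel. LINT x|lborel. ?T x y)"
          unfolding pairing_def
        proof (rule Bochner_Integration.integral_cong[OF refl])
          fix y
          show "(LINT x|lborel. \<phi> x *s K (x - y)) \<odot> f' y = (LINT x|lborel. ?T x y)"
            unfolding cliff_mult_smult_left[symmetric]
            by (rule integral_bounded_linear[OF bounded_bilinear.bounded_linear_left[OF bounded_bilinear_cliff_mult] ty, symmetric])
        qed
        also have "\<dots> = (LINT x|lborel. LINT y|lborel. ?T x y)" by (rule F[symmetric])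
        also have "\<dots> = (LINT x|lborel. \<phi> x *s g x)"
          unfolding g_def integral_smult ..
        also have "\<dots> = pairing g (\<lambda>x. cliff_of_complex (\<phi> x))"
          by (simp add: pairing_def cliff_of_complex_mult)
        finally show ?thesis .
      qed
      also have "\<dots> = dist_apply (dist_of_fun g) \<phi>"
      proof -
        have "(\<lambda>x. cliff_of_complex (\<phi> x) :: 'n cliff) \<in> borel_measurable borel"
          unfolding cliff_of_complex_def using smooth_measurable[OF schwartz_smooth[OF \<phi>]] by (intro smult_measurable) auto
        then show ?thesis unfolding dist_apply_def by (rule gL(2)[symmetric])
      qed
      finally show "dist_apply ((feller_dirac \<alpha> \<theta> ^^ k) (dist_of_fun f)) \<phi> = dist_apply (dist_of_fun g) \<phi>" .
    qed
    then show ?thesis using gL(1) norm_g by blast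
  qed
  then show ?thesis using C0 by blast
qed

section \<open>The spectral radius formula\<close>

text \<open>Take logarithms: ln(2 + k \<alpha>) divided by k \<alpha> tends to 0, and so does ln C
  divided by k \<alpha>.\<close>

lemma polynomial_root_tendsto_1:
  fixes C \<alpha> :: real
  assumes C: "C > 0" and \<alpha>: "\<alpha> > 0"
  shows "(\<lambda>k. (C * (2 + real k * \<alpha>) ^ m) powr (1 / (\<alpha> * real k))) \<longlonglongrightarrow> 1"
proof -
  have top: "filterlim (\<lambda>k. 2 + real k * \<alpha>) at_top sequentially"
    using \<alpha> by (intro filterlim_tendsto_add_at_top[OF tendsto_const]
      filterlim_at_top_mult_tendsto_pos[OF tendsto_const _ filterlim_real_sequentially])
  have inv: "(\<lambda>k. 1 / (\<alpha> * real k)) \<longlonglongrightarrow> 0"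
    using tendsto_mult[OF tendsto_const[of "1 / \<alpha>"] lim_1_over_n[where 'a = real]] by (simp add: field_simps)
  \<comment> \<open>The second factor equals (2 + k \<alpha>)/(\<alpha> k) for
    \<open>k \<ge> 1\<close>; it trades the denominator 2 + k \<alpha> of the standard limit ln x /
    x for \<alpha> k.\<close>
  have "(\<lambda>k. ln (2 + real k * \<alpha>) / (2 + real k * \<alpha>) * (2 * (1 / (\<alpha> * real k)) + 1)) \<longlonglongrightarrow> 0 * (2 * 0 + 1)"
    by (intro tendsto_intros inv filterlim_compose[OF ln_x_over_x_tendsto_0 top])
  then have l0: "(\<lambda>k. ln (2 + real k * \<alpha>) / (2 + real k * \<alpha>) * (2 * (1 / (\<alpha> * real k)) + 1)) \<longlonglongrightarrow> 0" by simp
  have "(\<lambda>k. ln (2 + real k * \<alpha>) * (1 / (\<alpha> * real k))) \<longlonglongrightarrow> 0"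
  proof (rule Lim_transform_eventually[OF l0], rule eventually_sequentiallyI[of 1])
    fix k :: nat assume "1 \<le> k"
    then have pos: "2 + real k * \<alpha> \<noteq> 0" "\<alpha> \<noteq> 0" "real k \<noteq> 0"
      using \<alpha> add_pos_nonneg[of 2 "real k * \<alpha>"] by auto
    then have "2 * (1 / (\<alpha> * real k)) + 1 = (2 + real k * \<alpha>) / (\<alpha> * real k)"
      by (simp add: add_divide_distrib)
    then show "ln (2 + real k * \<alpha>) / (2 + real k * \<alpha>) * (2 * (1 / (\<alpha> * real k)) + 1) = ln (2 + real k * \<alpha>) * (1 / (\<alpha> * real k))"
      using pos(1) by (simp only: times_divide_times_eq) simp
  qed
  then have "(\<lambda>k. exp (ln C * (1 / (\<alpha> * real k)) + real m * (ln (2 + real k * \<alpha>) * (1 / (\<alpha> * real k))))) \<longlonglongrightarrow> exp (ln C * 0 + real m * 0)"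
    by (intro tendsto_intros inv)
  moreover have "exp (ln C * (1 / (\<alpha> * real k)) + real m * (ln (2 + real k * \<alpha>) * (1 / (\<alpha> * real k))))
      = (C * (2 + real k * \<alpha>) ^ m) powr (1 / (\<alpha> * real k))" for k
  proof -
    have pos: "2 + real k * \<alpha> > 0" using \<alpha> by (simp add: add_pos_nonneg)
    then show ?thesis using C
      by (simp add: powr_def ln_mult ln_realpow add_divide_distrib)
  qed
  ultimately show ?thesis by simp
qed

lemma Lp_norm_nonneg: "Lp_norm p g \<ge> 0"
  by (simp add: Lp_norm_def)

lemma dist_Lp_norm_nonneg: "dist_Lp_norm p T \<ge> 0"
  unfolding dist_Lp_norm_def by (rule INF_greatest) (simp add: Lp_norm_nonneg)

lemma ereal_powr_le: "0 \<le> x \<Longrightarrow> x \<le> ereal c \<Longrightarrow> 0 \<le> a \<Longrightarrow> ereal_powr x a \<le> ereal (c powr a)"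
  by (cases x) (auto simp: ereal_powr_def intro: powr_mono2)

lemma ereal_powr_ge: "0 \<le> c \<Longrightarrow> ereal c \<le> x \<Longrightarrow> 0 \<le> a \<Longrightarrow> ereal (c powr a) \<le> ereal_powr x a"
  by (cases x) (auto simp: ereal_powr_def intro: powr_mono2)

lemma root_of_bound:
  fixes c :: real
  assumes "c \<ge> 0" "\<sigma> > 0" "\<alpha> > 0" "k > 0"
  shows "(c * \<sigma> powr (real k * \<alpha>)) powr (1 / (\<alpha> * real k)) = c powr (1 / (\<alpha> * real k)) * \<sigma>"
  using assms by (simp add: powr_mult powr_powr)

text \<open>The estimate is applied at a radius strictly between \<sigma> and \<open>t\<close>. The
  remaining gap absorbs the root of the polynomial factor, which tends to 1.\<close>

lemma dirac_power_root_upper: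
  fixes f :: "'n rspace \<Rightarrow> 'n::{finite,linorder} cliff"
  assumes f: "f \<in> Lp_space p" and p: "p \<ge> 1" and \<alpha>: "\<alpha> > 0"
    and S: "dist_support (dist_fourier (dist_of_fun f)) \<subseteq> closure (ball 0 \<sigma>)" "0 < \<sigma>" "\<sigma> < t"
  shows "\<forall>\<^sub>F k in sequentially. dirac_power_root \<alpha> \<theta> p f k < ereal t"
proof -
  obtain f' where f': "borel_Lp p f'" "\<And>\<Phi>. \<Phi> \<in> borel_measurable borel \<Longrightarrow> dist_of_fun f \<Phi> = pairing f' \<Phi>"
    by (rule Lp_space_borel[OF f]) (rule that)
  have supp: "dist_support (dist_fourier (dist_of_fun f)) = spectrum f'"
    by (rule dist_support_eq_spectrum) (rule f'(2))
  define \<sigma>' where "\<sigma>' = (\<sigma> + t) / 2"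
  have \<sigma>': "\<sigma> < \<sigma>'" "\<sigma>' < t" "\<sigma>' > 0" using S by (auto simp: \<sigma>'_def)
  have "spectrum f' \<subseteq> cball 0 \<sigma>"
    using S(1,2) unfolding supp by simp
  from dirac_power_upper_bound[OF f'(2,1) p \<alpha> this S(2) \<sigma>'(1), of \<theta>] obtain C where C: "C \<ge> 0"
    "\<And>k. k > 0 \<Longrightarrow> \<exists>g\<in>Lp_space p. dist_eq ((feller_dirac \<alpha> \<theta> ^^ k) (dist_of_fun f)) (dist_of_fun g) \<and>
       Lp_norm p g \<le> C * (2 + real k * \<alpha>) ^ (2 * CARD('n)) * \<sigma>' powr (real k * \<alpha>)" by blast
  \<comment> \<open>\<open>C + 1\<close> keeps the constant positive, as the root limit
    requires.\<close>
  let ?q = "\<lambda>k. ((C + 1) * (2 + real k * \<alpha>) ^ (2 * CARD('n))) powr (1 / (\<alpha> * real k))"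
  have "(\<lambda>k. ?q k * \<sigma>') \<longlonglongrightarrow> 1 * \<sigma>'"
    using C(1) \<alpha> by (intro tendsto_mult tendsto_const polynomial_root_tendsto_1) auto
  then have "\<forall>\<^sub>F k in sequentially. ?q k * \<sigma>' < t"
    using \<sigma>' by (intro order_tendstoD(2)) auto
  then show ?thesis
    using eventually_gt_at_top[of 0]
  proof eventually_elim
    fix k :: nat assume k: "?q k * \<sigma>' < t" "k > 0"
    obtain g where g: "g \<in> Lp_space p" "dist_eq ((feller_dirac \<alpha> \<theta> ^^ k) (dist_of_fun f)) (dist_of_fun g)"
      "Lp_norm p g \<le> C * (2 + real k * \<alpha>) ^ (2 * CARD('n)) * \<sigma>' powr (real k * \<alpha>)"
      using C(2)[OF k(2)] by blast
    let ?c = "(C + 1) * (2 + real k * \<alpha>) ^ (2 * CARD('n))"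
    have c: "?c \<ge> 0" using C(1) \<alpha> by simp
    have "dist_Lp_norm p ((feller_dirac \<alpha> \<theta> ^^ k) (dist_of_fun f)) \<le> ereal (Lp_norm p g)"
      unfolding dist_Lp_norm_def by (rule INF_lower) (use g in simp)
    also have "\<dots> \<le> ereal (?c * \<sigma>' powr (real k * \<alpha>))"
      using g(3) order_trans[OF _ mult_right_mono[OF mult_right_mono[of C "C + 1"]]] C(1) \<alpha> by simp
    finally have "dirac_power_root \<alpha> \<theta> p f k \<le> ereal ((?c * \<sigma>' powr (real k * \<alpha>)) powr (1 / (\<alpha> * real k)))"
      unfolding dirac_power_root_def by (intro ereal_powr_le dist_Lp_norm_nonneg) (use \<alpha> in auto)
    also have "\<dots> = ereal (?q k * \<sigma>')"
      using root_of_bound[OF c \<sigma>'(3) \<alpha> k(2)] by simp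
    also have "\<dots> < ereal t" using k(1) by simp
    finally show "dirac_power_root \<alpha> \<theta> p f k < ereal t" .
  qed
qed

lemma dirac_power_root_lower:
  fixes f :: "'n rspace \<Rightarrow> 'n::{finite,linorder} cliff"
  assumes f: "f \<in> Lp_space p" and p: "p \<ge> 1" and \<alpha>: "\<alpha> > 0"
    and s: "0 < s" "ereal s < spectral_radius f"
  shows "\<forall>\<^sub>F k in sequentially. ereal s < dirac_power_root \<alpha> \<theta> p f k"
proof -
  obtain f' where f': "borel_Lp p f'" "\<And>\<Phi>. \<Phi> \<in> borel_measurable borel \<Longrightarrow> dist_of_fun f \<Phi> = pairing f' \<Phi>"
    by (rule Lp_space_borel[OF f]) (rule that)
  have supp: "dist_support (dist_fourier (dist_of_fun f)) = spectrum f'"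
    by (rule dist_support_eq_spectrum) (rule f'(2))
  \<comment> \<open>Some frequency of \<open>f\<close> lies beyond \<epsilon>, and the gap between
    \<open>s\<close> and \<epsilon> absorbs the polynomial root.\<close>
  obtain \<epsilon> where \<epsilon>: "ereal s < ereal \<epsilon>" "ereal \<epsilon> < spectral_radius f"
    using ereal_dense2[OF s(2)] by blast
  have \<epsilon>0: "\<epsilon> > 0" "s < \<epsilon>" using \<epsilon>(1) s(1) by auto
  have "\<not> spectrum f' \<subseteq> cball 0 \<epsilon>"
  proof
    assume "spectrum f' \<subseteq> cball 0 \<epsilon>"
    then have "spectral_radius f \<le> ereal \<epsilon>"
      unfolding spectral_radius_def supp
      by (intro INF_lower) (use \<epsilon>0 in simp)
    then show False using \<epsilon>(2) by simp
  qed
  then obtain \<xi> where \<xi>: "\<xi> \<in> spectrum f'" "norm \<xi> > \<epsilon>" by force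
  have "open (- cball 0 \<epsilon> :: 'n rspace set)" by (simp add: open_Compl)
  with \<xi> have "\<not> annihilates f' (- cball 0 \<epsilon>)" unfolding spectrum_def by force
  then obtain \<psi> where \<psi>: "smooth \<psi>" "compact (closure {\<xi>. \<psi> \<xi> \<noteq> 0})" "closure {\<xi>. \<psi> \<xi> \<noteq> 0} \<subseteq> - cball 0 \<epsilon>"
    and nz: "hat f' \<psi> \<noteq> 0" unfolding annihilates_def by blast
  obtain M where M: "\<And>x. norm x > M \<Longrightarrow> \<psi> x = 0" using compact_support_vanish[OF \<psi>(2)] by blast
  have "\<psi> x = 0" if "norm x < \<epsilon>" for x
    using \<psi>(3) closure_subset[of "{\<xi>. \<psi> \<xi> \<noteq> 0}"] that by force
  then have ann: "annular \<epsilon> M \<psi>" using \<psi>(1) M by (simp add: annular_def)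
  from dirac_power_lower_bound[OF f'(2,1) p \<alpha> ann \<epsilon>0(1), of \<theta>] obtain C where C: "C \<ge> 0"
    "\<And>k g. k > 0 \<Longrightarrow> g \<in> Lp_space p \<Longrightarrow> dist_eq ((feller_dirac \<alpha> \<theta> ^^ k) (dist_of_fun f)) (dist_of_fun g) \<Longrightarrow>
       norm (hat f' \<psi>) \<le> C * (2 + real k * \<alpha>) ^ (2 * CARD('n)) * \<epsilon> powr (- (real k * \<alpha>)) * Lp_norm p g" by blast
  define D where "D = (C + 1) / norm (hat f' \<psi>)"
  have D: "D > 0" using C(1) nz by (simp add: D_def add_nonneg_pos)
  let ?q = "\<lambda>k. (D * (2 + real k * \<alpha>) ^ (2 * CARD('n))) powr (1 / (\<alpha> * real k))"
  have "(\<lambda>k. inverse (?q k) * \<epsilon>) \<longlonglongrightarrow> inverse 1 * \<epsilon>"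
    by (intro tendsto_mult tendsto_const tendsto_inverse polynomial_root_tendsto_1 D \<alpha>) simp
  then have "\<forall>\<^sub>F k in sequentially. s < inverse (?q k) * \<epsilon>"
    using \<epsilon>0 by (intro order_tendstoD(1)) auto
  then show ?thesis
    using eventually_gt_at_top[of 0]
  proof eventually_elim
    fix k :: nat assume k: "s < inverse (?q k) * \<epsilon>" "k > 0"
    let ?P = "(2 + real k * \<alpha>) ^ (2 * CARD('n))"
    have P: "?P > 0" using \<alpha> by (simp add: add_pos_nonneg)
    have le: "inverse (D * ?P) * \<epsilon> powr (real k * \<alpha>) \<le> Lp_norm p g"
      if g: "g \<in> Lp_space p" "dist_eq ((feller_dirac \<alpha> \<theta> ^^ k) (dist_of_fun f)) (dist_of_fun g)" for g
    proof -
      let ?h = "norm (hat f' \<psi>)"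
      have h: "?h > 0" using nz by simp
      have e: "\<epsilon> powr (real k * \<alpha>) > 0" using \<epsilon>0 by simp
      have "?h \<le> C * ?P * \<epsilon> powr (- (real k * \<alpha>)) * Lp_norm p g" by (rule C(2)[OF k(2) g])
      also have "\<dots> \<le> (C + 1) * ?P * \<epsilon> powr (- (real k * \<alpha>)) * Lp_norm p g"
        using P by (intro mult_right_mono Lp_norm_nonneg) auto
      finally have "?h * \<epsilon> powr (real k * \<alpha>) \<le> (C + 1) * ?P * Lp_norm p g"
        using e by (simp add: powr_minus field_simps)
      moreover have "(C + 1) * ?P > 0" using C(1) P by (intro mult_pos_pos) simp_all
      ultimately have "?h * \<epsilon> powr (real k * \<alpha>) / ((C + 1) * ?P) \<le> Lp_norm p g"
        by (simp only: pos_divide_le_eq mult.commute)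
      then show ?thesis
        by (simp add: D_def divide_inverse mult_ac)
    qed
    \<comment> \<open>The bound holds for every L^p representative. If there is none, the infimum is
      infinite and the inequality is trivial.\<close>
    have "ereal (inverse (D * ?P) * \<epsilon> powr (real k * \<alpha>)) \<le> dist_Lp_norm p ((feller_dirac \<alpha> \<theta> ^^ k) (dist_of_fun f))"
      unfolding dist_Lp_norm_def by (rule INF_greatest) (use le in simp)
    then have "ereal ((inverse (D * ?P) * \<epsilon> powr (real k * \<alpha>)) powr (1 / (\<alpha> * real k))) \<le> dirac_power_root \<alpha> \<theta> p f k"
      unfolding dirac_power_root_def
      by (intro ereal_powr_ge) (use \<alpha> D P in \<open>auto intro!: mult_nonneg_nonneg\<close>)
    moreover have "(inverse (D * ?P) * \<epsilon> powr (real k * \<alpha>)) powr (1 / (\<alpha> * real k)) = inverse (?q k) * \<epsilon>"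
    proof -
      have "inverse (D * ?P) \<ge> 0" using D P by simp
      from root_of_bound[OF this \<epsilon>0(1) \<alpha> k(2)]
      have "(inverse (D * ?P) * \<epsilon> powr (real k * \<alpha>)) powr (1 / (\<alpha> * real k)) = inverse (D * ?P) powr (1 / (\<alpha> * real k)) * \<epsilon>" .
      also have "inverse (D * ?P) powr (1 / (\<alpha> * real k)) = inverse (?q k)"
        using D P by (intro inverse_powr)
      finally show ?thesis .
    qed
    ultimately show "ereal s < dirac_power_root \<alpha> \<theta> p f k"
      using k(1) by (metis ereal_less_eq(3) less_eq_ereal_def less_ereal.simps(1) order_less_le_trans)
  qed
qed

lemma spectral_radius_nonneg: "spectral_radius f \<ge> 0"
  unfolding spectral_radius_def by (rule INF_greatest) simp

lemma spectral_radius_lessD: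
  assumes "spectral_radius f < ereal t"
  obtains \<sigma> where "0 < \<sigma>" "\<sigma> < t" "dist_support (dist_fourier (dist_of_fun f)) \<subseteq> closure (ball 0 \<sigma>)"
  using assms unfolding spectral_radius_def INF_less_iff by auto

lemma dirac_power_root_tendsto:
  fixes f :: "'n rspace \<Rightarrow> 'n::{finite,linorder} cliff"
  assumes f: "f \<in> Lp_space p" and p: "p \<ge> 1" and \<alpha>: "\<alpha> > 0" and L: "spectral_radius f = ereal L"
  shows "dirac_power_root \<alpha> \<theta> p f \<longlonglongrightarrow> ereal L"
proof (rule order_tendstoI)
  fix a assume a: "a < ereal L"
  show "\<forall>\<^sub>F k in sequentially. a < dirac_power_root \<alpha> \<theta> p f k"
  proof (cases "a < 0")
    case True
    have "dirac_power_root \<alpha> \<theta> p f k \<ge> 0" for k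
      by (simp add: dirac_power_root_def ereal_powr_def)
    with True show ?thesis by (intro always_eventually allI) (rule less_le_trans)
  next
    case False
    obtain s where s: "a < ereal s" "ereal s < ereal L" using ereal_dense2[OF a] by blast
    have "0 < ereal s" using False s(1) by (metis not_less order.strict_trans1)
    then have "0 < s" by simp
    from dirac_power_root_lower[OF f p \<alpha> this, of \<theta>] s(2) L
    have "\<forall>\<^sub>F k in sequentially. ereal s < dirac_power_root \<alpha> \<theta> p f k" by simp
    then show ?thesis by (rule eventually_mono) (rule less_trans[OF s(1)])
  qed
next
  fix a assume a: "ereal L < a"
  obtain t where t: "ereal L < ereal t" "ereal t < a" using ereal_dense2[OF a] by blast
  obtain \<sigma> where \<sigma>: "0 < \<sigma>" "\<sigma> < t" "dist_support (dist_fourier (dist_of_fun f)) \<subseteq> closure (ball 0 \<sigma>)"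
    using spectral_radius_lessD[of f t] t(1) L by auto
  from dirac_power_root_upper[OF f p \<alpha> \<sigma>(3,1,2), of \<theta>]
  show "\<forall>\<^sub>F k in sequentially. dirac_power_root \<alpha> \<theta> p f k < a"
    by (rule eventually_mono) (rule less_trans[OF _ t(2)])
qed

text \<open>An infinite radius would exceed \<open>\<bar>L\<bar> + 1\<close>, and the lower bound
  would push the limit up to at least that number.\<close>

lemma spectral_radius_finite:
  fixes f :: "'n rspace \<Rightarrow> 'n::{finite,linorder} cliff"
  assumes f: "f \<in> Lp_space p" and p: "p \<ge> 1" and \<alpha>: "\<alpha> > 0"
    and L: "dirac_power_root \<alpha> \<theta> p f \<longlonglongrightarrow> ereal L"
  shows "spectral_radius f < \<infinity>"
proof (rule ccontr)
  assume "\<not> spectral_radius f < \<infinity>"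
  then have inf: "ereal (\<bar>L\<bar> + 1) < spectral_radius f" by (simp add: not_less)
  have "0 < \<bar>L\<bar> + 1" by simp
  from dirac_power_root_lower[OF f p \<alpha> this inf, of \<theta>]
  have "\<forall>\<^sub>F k in sequentially. ereal (\<bar>L\<bar> + 1) \<le> dirac_power_root \<alpha> \<theta> p f k"
    by (rule eventually_mono) simp
  then have "ereal (\<bar>L\<bar> + 1) \<le> ereal L"
    by (intro tendsto_lowerbound[OF L]) simp_all
  then show False by simp
qed

text \<open>The infimum defining the radius may not be attained, so the support is first placed in
  the balls of all larger radii, whose intersection is the closed ball of radius
  \<open>r\<close>.\<close>

lemma support_subset_spectral_ball:
  fixes f :: "'n rspace \<Rightarrow> 'n::{finite,linorder} cliff"
  assumes f: "f \<in> Lp_space p" and p: "p \<ge> 1" and r: "spectral_radius f = ereal r"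
  shows "dist_support (dist_fourier (dist_of_fun f)) \<subseteq> closure (ball 0 r)"
proof -
  obtain f' where f': "borel_Lp p f'" "\<And>\<Phi>. \<Phi> \<in> borel_measurable borel \<Longrightarrow> dist_of_fun f \<Phi> = pairing f' \<Phi>"
    by (rule Lp_space_borel[OF f]) (rule that)
  have supp: "dist_support (dist_fourier (dist_of_fun f)) = spectrum f'"
    by (rule dist_support_eq_spectrum) (rule f'(2))
  have S: "norm x \<le> r" if "x \<in> spectrum f'" for x
  proof (rule dense_ge)
    fix t assume "r < t"
    then obtain \<sigma> where "0 < \<sigma>" "\<sigma> < t" "dist_support (dist_fourier (dist_of_fun f)) \<subseteq> closure (ball 0 \<sigma>)"
      using spectral_radius_lessD[of f t] r by auto
    with that show "norm x \<le> t" unfolding supp by force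
  qed
  have "r \<ge> 0" using spectral_radius_nonneg[of f] r by simp
  show ?thesis
  proof (cases "r = 0")
    \<comment> \<open>Here \<open>closure (ball 0 r)\<close> is empty, so the support has to be
      shown empty and not merely contained in the origin.\<close>
    case True
    then have "spectrum f' \<subseteq> {0}" using S by force
    then show ?thesis
      using hat_vanish_point_spectrum[OF f'(1) p] unfolding supp by simp
  next
    case False
    then show ?thesis using S \<open>r \<ge> 0\<close> unfolding supp by auto
  qed
qed

theorem theorem7:
  fixes \<alpha> \<theta> p :: real
    and f :: "'n rspace \<Rightarrow> 'n::{finite,linorder} cliff"
  assumes "0 < \<alpha>" and "\<alpha> \<le> 1"
    and "\<bar>1 - \<theta>\<bar> < \<alpha> / 2"
    and "1 < p"
    and "f \<in> Lp_space p"
  shows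
    "(\<forall>R>0. dist_support (dist_fourier (dist_of_fun f)) \<subseteq> closure (ball 0 R) \<longrightarrow>
        (\<exists>L::real. dirac_power_root \<alpha> \<theta> p f \<longlonglongrightarrow> ereal L \<and> spectral_radius f = ereal L)) \<and>
     (\<forall>R>0. \<forall>u\<in>bernstein_space \<alpha> \<theta> p R. (\<lambda>x. u x 0) = f \<longrightarrow>
        (\<exists>L::real. dirac_power_root \<alpha> \<theta> p f \<longlonglongrightarrow> ereal L) \<longrightarrow>
        spectral_radius f < \<infinity> \<and>
        dist_support (dist_fourier (dist_of_fun f)) \<subseteq> closure (ball 0 (real_of_ereal (spectral_radius f))))"
proof -
  have p: "p \<ge> 1" using assms by simp
  have real: "\<exists>r. spectral_radius f = ereal r" if "spectral_radius f < \<infinity>"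
    using that spectral_radius_nonneg[of f] by (cases "spectral_radius f") auto
  show ?thesis
  proof (intro conjI allI ballI impI)
    fix R :: real assume "R > 0" "dist_support (dist_fourier (dist_of_fun f)) \<subseteq> closure (ball 0 R)"
    then have "spectral_radius f \<le> ereal R"
      unfolding spectral_radius_def by (intro INF_lower) simp
    then have "spectral_radius f < \<infinity>" by (rule le_less_trans) simp
    then obtain L where "spectral_radius f = ereal L" using real by blast
    then show "\<exists>L::real. dirac_power_root \<alpha> \<theta> p f \<longlonglongrightarrow> ereal L \<and> spectral_radius f = ereal L"
      using dirac_power_root_tendsto[OF assms(5) p assms(1)] by blast
  next
    assume "\<exists>L::real. dirac_power_root \<alpha> \<theta> p f \<longlonglongrightarrow> ereal L"
    then show fin: "spectral_radius f < \<infinity>"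
      using spectral_radius_finite[OF assms(5) p assms(1)] by blast
    then obtain r where "spectral_radius f = ereal r" using real by blast
    then show "dist_support (dist_fourier (dist_of_fun f)) \<subseteq> closure (ball 0 (real_of_ereal (spectral_radius f)))"
      using support_subset_spectral_ball[OF assms(5) p] by simp
  qed
qed

end
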